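(* Let $\theta>0$ be sufficiently small such that $\theta\le (C_{inv,0}^2C_u^2)^{-1}$, and let $\delta>0$. Then the discrete bilinear form $a_h(\cdot,\cdot):V_{0h}\times V_{0h}\to\mathbb R$ is $V_{0h}$-coercive with respect to the norm $\|\cdot\|_h$, i.e. $$a_h(v_h,v_h)\ge\mu_c\|v_h\|_h^2\qquad\forall v_h\in V_{0h},$$ with $\mu_c=1/2$.
   Context: **Domain.** Let $d\in\{1,2,3\}$, $T>0$, and let $Q=\{(x,t): t\in(0,T),\ x\in\Omega(t)\}\subset\mathbb{R}^{d+1}$ (written $\Omega(t)\times(0,T)$) be a bounded Lipschitz space-time domain, with $\Omega(t)\subset\mathbb{R}^d$ a possibly moving spatial domain. Its boundary is $\partial Q=\Sigma\cup\Sigma_0\cup\Sigma_T$, with lateral boundary $\Sigma=\partial\Omega(t)\times(0,T)$ (i.e. $x\in\partial\Omega(t)$, $0<t<T$), bottom $\Sigma_0=\Omega(0)\times\{0\}$ and top $\Sigma_T=\Omega(T)\times\{T\}$. $\nabla_x$ is the gradient in the spatial variables and $\partial_t$ the time derivative. $H^{1,1}_{0,\underline 0}(Q)=\{u\in L_2(Q):\nabla_x u\in[L_2(Q)]^d,\ \partial_t u\in L_2(Q),\ u=0\text{ on }\Sigma,\ u=0\text{ on }\Sigma_0\}$. **Mesh.** $\mathcal K_h=\{K_1,\dots,K_N\}$ is a (conforming) decomposition of $Q$ into non-degenerate $(d+1)$-simplices, $h_K$ is the diameter of $K$, $h=\max_K h_K$. The family of meshes is shape-regular and quasi-uniform: there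 is $C_u>0$ independent of $h$ with $h_K\le h\le C_u h_K$ for all $K\in\mathcal K_h$. For a polynomial degree $p\ge1$, $V_h=\{v_h\in C^0(\overline Q): v_h|_K\in\mathbb P_p(K)\ \forall K\in\mathcal K_h\}$, where $\mathbb P_p$ denotes polynomials of degree $\le p$, and $V_{0h}=V_h\cap H^{1,1}_{0,\underline 0}(Q)$. $C_{inv,0}>0$ is a constant, independent of $h$ and $K$, for which the inverse inequality $\|v_h\|_{L_2(\partial K)}\le C_{inv,0}h_K^{-1/2}\|v_h\|_{L_2(K)}$ holds for all $v_h\in V_h$ and all $K\in\mathcal K_h$. **Facets, jumps, averages.** An interior facet is $F_{ij}=\overline K_i\cap\overline K_j$, $i\ne j$, when this set is a $d$-dimensional facet; $\mathcal F_I$ is the set of all interior facets. Let $\mathbf n_i=(\mathbf n_{i,x},n_{i,t})$ be the outer unit normal of $K_i$ on $F_{ij}$, and $\mathbf n_j=-\mathbf n_i$. With $v_i,v_j$ (resp. $\mathbf q_i,\mathbf q_j$) the traces from $K_i,K_j$ of a scalar $v$ (resp. vector $\mathbf q$): $[\![v]\!]_x=v_i\mathbf n_{i,x}+v_j\mathbf n_{j,x}$; $[\![\mathbf q]\!]_t=\mathbf q_i n_{i,t}+\mathbf q_j n_{j,t}$; $\{\mathbf q\}=\tfrac12(\mathbf q_i+\mathbf q_j)$; $\{\mathbf q\}^{up}=\mathbf q_i$ if $n_{i,t}\ge0$ and $\{\mathbf q\}^{up}=\mathbf q_j$ if $n_{i,t}<0$. **Bilinear form.** For constants $\theta,\delta>0$,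 $$\begin{aligned}a_h(w,v_h)=&\int_Q\big(\partial_t w(v_h+\theta h\,\partial_t v_h)+\nabla_x w\cdot\nabla_x v_h\big)dx\,dt-\theta h\sum_{K\in\mathcal K_h}\int_K\partial_t\nabla_x w\cdot\nabla_x v_h\,dx\,dt+\theta h\int_{\Sigma_T}\nabla_x w\cdot\nabla_x v_h\,ds\\&+\theta h\sum_{F_{ij}\in\mathcal F_I}\int_{F_{ij}}\Big(\{\nabla_x w\}^{up}\cdot[\![\nabla_x v_h]\!]_t-\{\nabla_x w\}\cdot[\![\partial_t v_h]\!]_x+\{\nabla_x v_h\}\cdot[\![\partial_t w]\!]_x+\delta[\![\partial_t w]\!]_x\cdot[\![\partial_t v_h]\!]_x\Big)ds.\end{aligned}$$ **Norm.** $$\|v\|_h^2=\|\nabla_x v\|^2_{L_2(Q)}+\theta h\|\partial_t v\|^2_{L_2(Q)}+\tfrac12\|v\|^2_{L_2(\Sigma_T)}+\tfrac{\theta h}2\|\nabla_x v\|^2_{L_2(\Sigma_T)}+\tfrac{\theta h}2\sum_{F_{ij}\in\mathcal F_I}\|[\![\nabla_x v]\!]_t\|^2_{L_2(F_{ij})}+\delta\theta h\sum_{F_{ij}\in\mathcal F_I}\|[\![\partial_t v]\!]_x\|^2_{L_2(F_{ij})}.$$ *)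

theory Defs
  imports "HOL-Analysis.Analysis"
begin

text \<open>
  Points of space-time are pairs \<open>(x, t)\<close> of type \<open>(real^'d) \<times> real\<close>; the product carries the
  Euclidean structure of \<open>\<real>\<^sup>d\<^sup>+\<^sup>1\<close>.
\<close>

section \<open>Space-time domain\<close>

definition st_domain :: "(real \<Rightarrow> (real^'d) set) \<Rightarrow> real \<Rightarrow> ((real^'d) \<times> real) set" where
  "st_domain \<Omega> T = {(x, t). 0 < t \<and> t < T \<and> x \<in> \<Omega> t}"

definition lateral_bd :: "(real \<Rightarrow> (real^'d) set) \<Rightarrow> real \<Rightarrow> ((real^'d) \<times> real) set" where
  "lateral_bd \<Omega> T = {(x, t). 0 < t \<and> t < T \<and> x \<in> frontier (\<Omega> t)}"

definition bottom_bd :: "(real \<Rightarrow> (real^'d) set) \<Rightarrow> ((real^'d) \<times> real) set" where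
  "bottom_bd \<Omega> = \<Omega> 0 \<times> {0}"

definition top_bd :: "(real \<Rightarrow> (real^'d) set) \<Rightarrow> real \<Rightarrow> ((real^'d) \<times> real) set" where
  "top_bd \<Omega> T = \<Omega> T \<times> {T}"

text \<open>Near every boundary point the set is, in the direction \<open>e\<close>, the strict epigraph of a
  Lipschitz function on the hyperplane orthogonal to \<open>e\<close>.\<close>

definition bounded_lipschitz_domain :: "'a::euclidean_space set \<Rightarrow> bool" where
  "bounded_lipschitz_domain Q \<longleftrightarrow>
     open Q \<and> connected Q \<and> Q \<noteq> {} \<and> bounded Q \<and>
     (\<forall>z \<in> frontier Q. \<exists>e r L g.
        norm e = 1 \<and> 0 < r \<and> L-lipschitz_on {w. w \<bullet> e = 0} g \<and>
        (\<forall>y \<in> ball z r. y \<in> Q \<longleftrightarrow> g (y - (y \<bullet> e) *\<^sub>R e) < y \<bullet> e))"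

text \<open>Sets of vanishing \<open>d\<close>-dimensional Hausdorff measure in \<open>\<real>\<^sup>d\<^sup>+\<^sup>1\<close>.\<close>

definition surface_null :: "((real^'d) \<times> real) set \<Rightarrow> bool" where
  "surface_null N \<longleftrightarrow>
     (\<forall>\<epsilon>>0. \<exists>(c :: nat \<Rightarrow> (real^'d) \<times> real) (r :: nat \<Rightarrow> real).
        (\<forall>i. 0 \<le> r i) \<and> N \<subseteq> (\<Union>i. cball (c i) (r i)) \<and>
        summable (\<lambda>i. r i ^ CARD('d)) \<and> (\<Sum>i. r i ^ CARD('d)) < \<epsilon>)"

text \<open>
  The boundary of \<open>Q\<close> is the union of the three parts up to a set of surface measure zero:
  with open \<open>\<Omega>(0)\<close> and \<open>\<Omega>(T)\<close> the edges \<open>\<partial>\<Omega>(0) \<times> {0}\<close> and \<open>\<partial>\<Omega>(T) \<times> {T}\<close> belong to none of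
  them.
\<close>

definition space_time_domain :: "(real \<Rightarrow> (real^'d) set) \<Rightarrow> real \<Rightarrow> bool" where
  "space_time_domain \<Omega> T \<longleftrightarrow>
     (\<forall>t \<in> {0..T}. open (\<Omega> t) \<and> connected (\<Omega> t) \<and> \<Omega> t \<noteq> {}) \<and>
     bounded_lipschitz_domain (st_domain \<Omega> T) \<and>
     lateral_bd \<Omega> T \<union> bottom_bd \<Omega> \<union> top_bd \<Omega> T \<subseteq> frontier (st_domain \<Omega> T) \<and>
     surface_null (frontier (st_domain \<Omega> T) - (lateral_bd \<Omega> T \<union> bottom_bd \<Omega> \<union> top_bd \<Omega> T))"

section \<open>Derivatives, traces, integrals\<close>

definition nabla_x :: "((real^'d) \<times> real \<Rightarrow> real) \<Rightarrow> (real^'d) \<times> real \<Rightarrow> real^'d" where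
  "nabla_x v z = (THE g. GDERIV (\<lambda>x. v (x, snd z)) (fst z) :> g)"

definition dt :: "((real^'d) \<times> real \<Rightarrow> 'b::real_normed_vector) \<Rightarrow> (real^'d) \<times> real \<Rightarrow> 'b" where
  "dt v z = vector_derivative (\<lambda>s. v (fst z, s)) (at (snd z))"

text \<open>The trace at a boundary point of \<open>G\<close>, as the limit from inside \<open>G\<close>.\<close>

definition trace_from :: "'a::topological_space set \<Rightarrow> ('a \<Rightarrow> 'b::t2_space) \<Rightarrow> 'a \<Rightarrow> 'b" where
  "trace_from G f z = Lim (at z within G) f"

text \<open>
  Surface measure on the hyperplane \<open>affine hull F\<close>: the image of Lebesgue measure on \<open>\<real>\<^sup>d\<close>
  under an isometric parametrisation, whose choice is immaterial.
\<close>

definition flat_measure :: "((real^'d) \<times> real) set \<Rightarrow> ((real^'d) \<times> real) measure" where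
  "flat_measure F =
     distr lborel borel
       (SOME \<phi> :: real^'d \<Rightarrow> (real^'d) \<times> real.
          (\<forall>x y. dist (\<phi> x) (\<phi> y) = dist x y) \<and> range \<phi> = affine hull F)"

definition L2_norm_on :: "'a measure \<Rightarrow> 'a set \<Rightarrow> ('a \<Rightarrow> 'b::real_normed_vector) \<Rightarrow> real" where
  "L2_norm_on M A f = sqrt (LINT z:A|M. (norm (f z))\<^sup>2)"

definition L2_norm_bd :: "((real^'d) \<times> real) set \<Rightarrow> ((real^'d) \<times> real \<Rightarrow> real) \<Rightarrow> real" where
  "L2_norm_bd K f = sqrt (\<Sum>F | F facet_of K. (L2_norm_on (flat_measure F) F f)\<^sup>2)"

section \<open>The Sobolev space\<close>

definition in_L2 ::
    "'a::euclidean_space set \<Rightarrow> ('a \<Rightarrow> 'b::{banach,second_countable_topology}) \<Rightarrow> bool" where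
  "in_L2 Q u \<longleftrightarrow> set_borel_measurable lebesgue Q u \<and> set_integrable lebesgue Q (\<lambda>z. (norm (u z))\<^sup>2)"

text \<open>Weak gradients, tested with compactly supported \<open>C\<^sup>1\<close> functions \<open>\<phi>\<close> with gradient \<open>\<phi>'\<close>.\<close>

definition weak_gradient :: "'a::euclidean_space set \<Rightarrow> ('a \<Rightarrow> real) \<Rightarrow> ('a \<Rightarrow> 'a) \<Rightarrow> bool" where
  "weak_gradient Q u g \<longleftrightarrow>
     (\<forall>\<phi> \<phi>'. (\<forall>z. GDERIV \<phi> z :> \<phi>' z) \<and> continuous_on UNIV \<phi>' \<and>
         compact (closure {z. \<phi> z \<noteq> 0}) \<and> closure {z. \<phi> z \<noteq> 0} \<subseteq> Q \<longrightarrow>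
       (LINT z:Q|lebesgue. u z *\<^sub>R \<phi>' z) = - (LINT z:Q|lebesgue. \<phi> z *\<^sub>R g z))"

text \<open>
  The trace of a Sobolev function on the boundary of a Lipschitz domain, as the boundary value
  in the mean (Evans and Gariepy, Measure Theory and Fine Properties of Functions, Section 5.3):
  the trace \<open>a\<close> at surface-almost every boundary point \<open>z\<close> is determined by the vanishing of
  the averages of \<open>\<bar>u - a\<bar>\<close> over \<open>Q \<inter> ball z r\<close> as \<open>r \<rightarrow> 0\<close>.
\<close>

definition has_trace :: "'a::euclidean_space set \<Rightarrow> ('a \<Rightarrow> real) \<Rightarrow> 'a \<Rightarrow> real \<Rightarrow> bool" where
  "has_trace Q u z a \<longleftrightarrow>
     ((\<lambda>r. (LINT y:Q \<inter> ball z r|lebesgue. \<bar>u y - a\<bar>) / measure lebesgue (Q \<inter> ball z r)) \<longlongrightarrow> 0)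
       (at_right 0)"

definition zero_trace_on ::
    "((real^'d) \<times> real) set \<Rightarrow> ((real^'d) \<times> real) set \<Rightarrow> ((real^'d) \<times> real \<Rightarrow> real) \<Rightarrow> bool" where
  "zero_trace_on Q \<Gamma> u \<longleftrightarrow> surface_null {z \<in> \<Gamma>. \<not> has_trace Q u z 0}"

definition H11_00 :: "(real \<Rightarrow> (real^'d) set) \<Rightarrow> real \<Rightarrow> ((real^'d) \<times> real \<Rightarrow> real) set" where
  "H11_00 \<Omega> T =
     {u. in_L2 (st_domain \<Omega> T) u \<and>
         (\<exists>gx gt. in_L2 (st_domain \<Omega> T) gx \<and> in_L2 (st_domain \<Omega> T) gt \<and>
            weak_gradient (st_domain \<Omega> T) u (\<lambda>z. (gx z, gt z))) \<and>
         zero_trace_on (st_domain \<Omega> T) (lateral_bd \<Omega> T) u \<and>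
         zero_trace_on (st_domain \<Omega> T) (bottom_bd \<Omega>) u}"

section \<open>Meshes and finite element spaces\<close>

text \<open>Elements are represented by closed simplices; \<open>triangulation\<close> expresses conformity.\<close>

definition mesh_of :: "'a::euclidean_space set \<Rightarrow> 'a set set \<Rightarrow> bool" where
  "mesh_of Q \<K> \<longleftrightarrow>
     triangulation \<K> \<and> (\<forall>K \<in> \<K>. int DIM('a) simplex K) \<and> \<Union>\<K> = closure Q"

definition mesh_size :: "'a::metric_space set set \<Rightarrow> real" where
  "mesh_size \<K> = Max (diameter ` \<K>)"

definition quasi_uniform :: "real \<Rightarrow> 'a::metric_space set set set \<Rightarrow> bool" where
  "quasi_uniform C \<M> \<longleftrightarrow>
     (\<forall>\<K> \<in> \<M>. \<forall>K \<in> \<K>. diameter K \<le> mesh_size \<K> \<and> mesh_size \<K> \<le> C * diameter K)"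

definition inradius :: "'a::metric_space set \<Rightarrow> real" where
  "inradius K = Sup {r. 0 \<le> r \<and> (\<exists>z. cball z r \<subseteq> K)}"

definition shape_regular :: "'a::metric_space set set set \<Rightarrow> bool" where
  "shape_regular \<M> \<longleftrightarrow> (\<exists>\<sigma>. \<forall>\<K> \<in> \<M>. \<forall>K \<in> \<K>. diameter K \<le> \<sigma> * inradius K)"

text \<open>Polynomial functions of total degree at most \<open>p\<close>.\<close>

definition poly_fun :: "nat \<Rightarrow> ('a::euclidean_space \<Rightarrow> real) set" where
  "poly_fun p =
     {q. \<exists>c. \<forall>z. q z =
        (\<Sum>\<alpha> | \<alpha> \<in> Basis \<rightarrow>\<^sub>E {..p} \<and> (\<Sum>b\<in>Basis. \<alpha> b) \<le> p. c \<alpha> * (\<Prod>b\<in>Basis. (z \<bullet> b) ^ \<alpha> b))}"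

definition Vh :: "'a::euclidean_space set \<Rightarrow> nat \<Rightarrow> 'a set set \<Rightarrow> ('a \<Rightarrow> real) set" where
  "Vh Q p \<K> =
     {v. continuous_on (closure Q) v \<and> (\<forall>K \<in> \<K>. \<exists>q \<in> poly_fun p. \<forall>z \<in> K. v z = q z)}"

definition V0h :: "(real \<Rightarrow> (real^'d) set) \<Rightarrow> real \<Rightarrow> nat \<Rightarrow> ((real^'d) \<times> real) set set \<Rightarrow>
    ((real^'d) \<times> real \<Rightarrow> real) set" where
  "V0h \<Omega> T p \<K> = Vh (st_domain \<Omega> T) p \<K> \<inter> H11_00 \<Omega> T"

definition inverse_inequality ::
    "real \<Rightarrow> ((real^'d) \<times> real) set \<Rightarrow> nat \<Rightarrow> ((real^'d) \<times> real) set set \<Rightarrow> bool" where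
  "inverse_inequality C Q p \<K> \<longleftrightarrow>
     (\<forall>v \<in> Vh Q p \<K>. \<forall>K \<in> \<K>.
        L2_norm_bd K v \<le> C * diameter K powr (-1/2) * L2_norm_on lebesgue K v)"

section \<open>Facets, jumps, averages\<close>

definition interior_facets :: "'a::euclidean_space set set \<Rightarrow> 'a set set" where
  "interior_facets \<K> =
     {K \<inter> K' | K K'. K \<in> \<K> \<and> K' \<in> \<K> \<and> K \<noteq> K' \<and> K \<inter> K' facet_of K \<and> K \<inter> K' facet_of K'}"

text \<open>
  The two elements \<open>K\<^sub>i\<close>, \<open>K\<^sub>j\<close> sharing a facet, in an arbitrary but fixed order. Only the upwind
  average depends on the order, and only where the time component of the normal vanishes, in
  which case it is multiplied by a vanishing jump.
\<close>

definition facet_elems :: "'a::euclidean_space set set \<Rightarrow> 'a set \<Rightarrow> 'a set \<times> 'a set" where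
  "facet_elems \<K> F = (SOME (K, K'). K \<in> \<K> \<and> K' \<in> \<K> \<and> K \<noteq> K' \<and> F = K \<inter> K')"

definition elem_i :: "'a::euclidean_space set set \<Rightarrow> 'a set \<Rightarrow> 'a set" where
  "elem_i \<K> F = fst (facet_elems \<K> F)"

definition elem_j :: "'a::euclidean_space set set \<Rightarrow> 'a set \<Rightarrow> 'a set" where
  "elem_j \<K> F = snd (facet_elems \<K> F)"

definition outer_normal :: "'a::euclidean_space set \<Rightarrow> 'a set \<Rightarrow> 'a" where
  "outer_normal K F = (THE n. norm n = 1 \<and> (\<forall>x \<in> K. \<forall>y \<in> F. n \<bullet> (x - y) \<le> 0))"

definition normal_i :: "'a::euclidean_space set set \<Rightarrow> 'a set \<Rightarrow> 'a" where
  "normal_i \<K> F = outer_normal (elem_i \<K> F) F"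

definition normal_j :: "'a::euclidean_space set set \<Rightarrow> 'a set \<Rightarrow> 'a" where
  "normal_j \<K> F = - normal_i \<K> F"

definition trace_i :: "'a::euclidean_space set set \<Rightarrow> 'a set \<Rightarrow> ('a \<Rightarrow> 'b::t2_space) \<Rightarrow> 'a \<Rightarrow> 'b" where
  "trace_i \<K> F f = trace_from (interior (elem_i \<K> F)) f"

definition trace_j :: "'a::euclidean_space set set \<Rightarrow> 'a set \<Rightarrow> ('a \<Rightarrow> 'b::t2_space) \<Rightarrow> 'a \<Rightarrow> 'b" where
  "trace_j \<K> F f = trace_from (interior (elem_j \<K> F)) f"

definition jump_x :: "((real^'d) \<times> real) set set \<Rightarrow> ((real^'d) \<times> real) set \<Rightarrow>
    ((real^'d) \<times> real \<Rightarrow> real) \<Rightarrow> (real^'d) \<times> real \<Rightarrow> real^'d" where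
  "jump_x \<K> F v z =
     trace_i \<K> F v z *\<^sub>R fst (normal_i \<K> F) + trace_j \<K> F v z *\<^sub>R fst (normal_j \<K> F)"

definition jump_t :: "((real^'d) \<times> real) set set \<Rightarrow> ((real^'d) \<times> real) set \<Rightarrow>
    ((real^'d) \<times> real \<Rightarrow> real^'d) \<Rightarrow> (real^'d) \<times> real \<Rightarrow> real^'d" where
  "jump_t \<K> F q z =
     snd (normal_i \<K> F) *\<^sub>R trace_i \<K> F q z + snd (normal_j \<K> F) *\<^sub>R trace_j \<K> F q z"

definition avg :: "((real^'d) \<times> real) set set \<Rightarrow> ((real^'d) \<times> real) set \<Rightarrow>
    ((real^'d) \<times> real \<Rightarrow> real^'d) \<Rightarrow> (real^'d) \<times> real \<Rightarrow> real^'d" where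
  "avg \<K> F q z = (1/2) *\<^sub>R (trace_i \<K> F q z + trace_j \<K> F q z)"

definition avg_up :: "((real^'d) \<times> real) set set \<Rightarrow> ((real^'d) \<times> real) set \<Rightarrow>
    ((real^'d) \<times> real \<Rightarrow> real^'d) \<Rightarrow> (real^'d) \<times> real \<Rightarrow> real^'d" where
  "avg_up \<K> F q z = (if 0 \<le> snd (normal_i \<K> F) then trace_i \<K> F q z else trace_j \<K> F q z)"

section \<open>Bilinear form and norm\<close>

definition a_h :: "(real \<Rightarrow> (real^'d) set) \<Rightarrow> real \<Rightarrow> ((real^'d) \<times> real) set set \<Rightarrow> real \<Rightarrow> real \<Rightarrow>
    ((real^'d) \<times> real \<Rightarrow> real) \<Rightarrow> ((real^'d) \<times> real \<Rightarrow> real) \<Rightarrow> real" where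
  "a_h \<Omega> T \<K> \<theta> \<delta> w v =
    (let Q = st_domain \<Omega> T; \<Sigma>T = top_bd \<Omega> T; h = mesh_size \<K> in
       (LINT z:Q|lebesgue. dt w z * (v z + \<theta> * h * dt v z) + nabla_x w z \<bullet> nabla_x v z)
     - \<theta> * h * (\<Sum>K\<in>\<K>. LINT z:K|lebesgue. dt (nabla_x w) z \<bullet> nabla_x v z)
     + \<theta> * h * (LINT z:\<Sigma>T|flat_measure \<Sigma>T.
                   trace_from Q (nabla_x w) z \<bullet> trace_from Q (nabla_x v) z)
     + \<theta> * h * (\<Sum>F\<in>interior_facets \<K>. LINT z:F|flat_measure F.
           avg_up \<K> F (nabla_x w) z \<bullet> jump_t \<K> F (nabla_x v) z
         - avg \<K> F (nabla_x w) z \<bullet> jump_x \<K> F (dt v) z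
         + avg \<K> F (nabla_x v) z \<bullet> jump_x \<K> F (dt w) z
         + \<delta> * (jump_x \<K> F (dt w) z \<bullet> jump_x \<K> F (dt v) z)))"

definition norm_h :: "(real \<Rightarrow> (real^'d) set) \<Rightarrow> real \<Rightarrow> ((real^'d) \<times> real) set set \<Rightarrow> real \<Rightarrow> real \<Rightarrow>
    ((real^'d) \<times> real \<Rightarrow> real) \<Rightarrow> real" where
  "norm_h \<Omega> T \<K> \<theta> \<delta> v =
    (let Q = st_domain \<Omega> T; \<Sigma>T = top_bd \<Omega> T; h = mesh_size \<K> in
     sqrt ((L2_norm_on lebesgue Q (nabla_x v))\<^sup>2
       + \<theta> * h * (L2_norm_on lebesgue Q (dt v))\<^sup>2
       + 1/2 * (L2_norm_on (flat_measure \<Sigma>T) \<Sigma>T (trace_from Q v))\<^sup>2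
       + \<theta> * h / 2 * (L2_norm_on (flat_measure \<Sigma>T) \<Sigma>T (trace_from Q (nabla_x v)))\<^sup>2
       + \<theta> * h / 2 * (\<Sum>F\<in>interior_facets \<K>.
                          (L2_norm_on (flat_measure F) F (jump_t \<K> F (nabla_x v)))\<^sup>2)
       + \<delta> * \<theta> * h * (\<Sum>F\<in>interior_facets \<K>.
                          (L2_norm_on (flat_measure F) F (jump_x \<K> F (dt v)))\<^sup>2)))"

end

theory Submission
  imports Defs
begin

text \<open>
  Testing with \<open>w = v\<close>, the averages against \<open>\<lbrakk>\<partial>\<^sub>t v\<rbrakk>\<^sub>x\<close> cancel. The terms \<open>v \<partial>\<^sub>t v\<close> and
  \<open>\<partial>\<^sub>t \<nabla>\<^sub>x v \<bullet> \<nabla>\<^sub>x v\<close> are half the time derivatives of \<open>v\<^sup>2\<close> and \<open>\<bar>\<nabla>\<^sub>x v\<bar>\<^sup>2\<close>, so on every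
  element they integrate to fluxes \<open>n\<^sub>t v\<^sup>2 / 2\<close> and \<open>n\<^sub>t \<bar>\<nabla>\<^sub>x v\<bar>\<^sup>2 / 2\<close> through the facets. On an
  interior facet the fluxes of \<open>v\<^sup>2\<close> cancel by continuity, and the upwind average turns the fluxes of
  \<open>\<bar>\<nabla>\<^sub>x v\<bar>\<^sup>2\<close> into \<open>\<bar>n\<^sub>t\<bar> \<bar>\<nabla>\<^sub>x v\<^sub>i - \<nabla>\<^sub>x v\<^sub>j\<bar>\<^sup>2 / 2\<close>, which dominates half the squared jump
  since \<open>\<bar>n\<^sub>t\<bar> \<le> 1\<close>. On \<open>\<Sigma>\<^sub>T\<close> the fluxes give the boundary part of the norm. On the rest of the
  boundary \<open>v\<close> vanishes, and the remaining flux of \<open>\<bar>\<nabla>\<^sub>x v\<bar>\<^sup>2\<close> is at most half of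
  \<open>\<parallel>\<nabla>\<^sub>x v\<parallel>\<^sup>2\<close>, by the inverse inequality and the bound on \<open>\<theta>\<close>.
\<close>

section \<open>Linear images of Lebesgue measure\<close>

text \<open>The factor \<open>1/2\<close> is lost in one place only: every part of the norm except
  \<open>\<nabla>\<^sub>x v\<close> is recovered with factor one. The flux of the squared gradient
  enters with a minus sign, and where the boundary of a moving domain tilts so that
  \<open>n\<^sub>t\<close> is positive nothing compensates it; the gradient term itself must pay,
  which is what limits \<open>\<theta>\<close>. All element integrands are time derivatives, so
  Fubini along vertical lines replaces a general divergence theorem. The geometric input is that the
  projection of a facet to space scales surface measure by the absolute value of
  \<open>n\<^sub>t\<close>, which is why determinants come first. The other difficulty is that
  objects match only almost everywhere: traces are limits that may fail to exist on edges of the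
  mesh, the three boundary parts cover the frontier up to a null set, zero boundary values hold up
  to null sets in the sense of averages, and normals are definite descriptions that must be
  identified with supporting hyperplanes.\<close>

lemma det_mat_minus_rank_one:
  fixes l :: "real^'m"
  shows "det (\<chi> i j. (if i = j then 1 else 0) - l $ i * l $ j) = 1 - l \<bullet> l"
proof -
  define B :: "real^'m^'m" where "B = (\<chi> i j. (if i = j then 1 else 0) - l $ i * l $ j)"
  fix k :: 'm
  \<comment> \<open>A rotation or reflection taking \<open>l\<close> to a coordinate axis conjugates
    the rank one perturbation of the identity to the diagonal matrix \<open>D\<close> below; any
    index \<open>k\<close> will do.\<close>
  obtain f where f: "orthogonal_transformation f" "f l = norm l *\<^sub>R axis k (1::real)"
    using orthogonal_transformation_exists[of l "norm l *\<^sub>R axis k (1::real)"] by auto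
  have lin: "linear f" using f(1) orthogonal_transformation_linear by blast
  define P where "P = matrix f"
  have fP: "f x = P *v x" for x using lin by (simp add: P_def)
  have om: "orthogonal_matrix P"
    using f(1) by (simp add: orthogonal_transformation_matrix P_def)
  have detP: "det P * det P = 1"
    using det_orthogonal_matrix[OF om] by auto
  define D :: "real^'m^'m" where
    "D = (\<chi> i j. if i = j then (if i = k then 1 - l \<bullet> l else 1) else 0)"
  have "P ** B = D ** P"
  proof -
    have Bv: "B *v x = x - (l \<bullet> x) *\<^sub>R l" for x
    proof (rule vec_eq_iff[THEN iffD2, rule_format])
      fix i
      have "(B *v x) $ i = (\<Sum>j\<in>UNIV. (if i = j then x $ j else 0) - l $ i * (l $ j * x $ j))"
        by (auto simp: B_def matrix_vector_mult_def left_diff_distrib mult.assoc intro!: sum.cong)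
      then show "(B *v x) $ i = (x - (l \<bullet> x) *\<^sub>R l) $ i"
        by (simp add: sum_subtractf inner_vec_def sum_distrib_left[symmetric] mult.commute)
    qed
    have Dv: "D *v x = x - (l \<bullet> l) *\<^sub>R (x $ k *\<^sub>R axis k 1)" for x
    proof (rule vec_eq_iff[THEN iffD2, rule_format])
      fix i
      have "(D *v x) $ i = (\<Sum>j\<in>UNIV. if i = j then (if i = k then 1 - l \<bullet> l else 1) * x $ j else 0)"
        unfolding matrix_vector_mult_def vec_lambda_beta by (rule sum.cong) (auto simp: D_def)
      then show "(D *v x) $ i = (x - (l \<bullet> l) *\<^sub>R (x $ k *\<^sub>R axis k 1)) $ i"
        by (simp add: axis_def left_diff_distrib)
    qed
    have "P *v (B *v x) = D *v (P *v x)" for x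
    proof -
      have "l \<bullet> x = f l \<bullet> f x" using f(1) by (simp add: orthogonal_transformation_def)
      also have "\<dots> = norm l * (f x $ k)" by (simp add: f(2) inner_axis inner_commute)
      finally have lx: "l \<bullet> x = norm l * (f x $ k)" .
      have "P *v (B *v x) = f x - (l \<bullet> x) *\<^sub>R f l"
        by (simp add: Bv fP[symmetric] linear_diff[OF lin] linear_scale[OF lin])
      also have "\<dots> = f x - (l \<bullet> l) *\<^sub>R (f x $ k *\<^sub>R axis k 1)"
        by (simp add: lx f(2) dot_square_norm power2_eq_square algebra_simps)
      also have "\<dots> = D *v (P *v x)" by (simp add: Dv fP)
      finally show ?thesis .
    qed
    then show ?thesis
      by (simp add: matrix_eq matrix_vector_mul_assoc[symmetric])
  qed
  then have "det P * det B = det D * det P" by (metis det_mul)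
  then have "det B = det D" using detP by (metis mult.commute mult_cancel_right mult_zero_right zero_neq_one)
  also have "det D = (\<Prod>i\<in>UNIV. D $ i $ i)"
    by (rule det_diagonal) (simp add: D_def)
  also have "\<dots> = 1 - l \<bullet> l" by (simp add: D_def)
  finally show ?thesis by (simp add: B_def)
qed

text \<open>The hypothesis on \<open>L\<close> is the Gram identity \<open>L^T L = I - l l^T\<close>
  expressed by norms, so the absolute value of the determinant is \<open>c\<close>. Pushing Lebesgue
  measure forward divides it by this number, which the density undoes. Stated for measures, the
  formula applies to every integrand at once.\<close>

lemma density_distr_projection_wellorder:
  fixes L :: "real^'m::{finite,wellorder} \<Rightarrow> real^'m::_"
  assumes lin: "linear L" and L: "\<And>x. (norm (L x))\<^sup>2 + (l \<bullet> x)\<^sup>2 = (norm x)\<^sup>2"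
    and c: "c > 0" "c\<^sup>2 = 1 - l \<bullet> l"
  shows "density (distr lborel borel L) (\<lambda>_. ennreal c) = lborel"
proof -
  \<comment> \<open>Polarisation, to read off the matrix entries from pairs of basis
    vectors.\<close>
  have pol: "L x \<bullet> L y + (l \<bullet> x) * (l \<bullet> y) = x \<bullet> y" for x y
    using L[of "x + y"] L[of x] L[of y] unfolding power2_norm_eq_inner
    by (simp add: linear_add[OF lin] inner_add inner_commute[of y x]
        inner_commute[of "L y" "L x"] power2_eq_square algebra_simps)
  have "transpose (matrix L) ** matrix L = (\<chi> i j. (if i = j then 1 else 0) - l $ i * l $ j)"
  proof -
    have 1: "(transpose (matrix L) ** matrix L) $ i $ j = L (axis i 1) \<bullet> L (axis j 1)" for i j
      by (simp add: matrix_matrix_mult_def transpose_def matrix_def inner_vec_def)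
    have 2: "L (axis i 1) \<bullet> L (axis j 1) = (if i = j then 1 else 0) - l $ i * l $ j" for i j
    proof -
      have "axis i 1 \<bullet> axis j (1::real) = (if i = j then 1 else 0)"
        by (simp add: inner_axis_axis)
      then show ?thesis
        using pol[of "axis i 1" "axis j 1"] unfolding inner_axis by simp
    qed
    show ?thesis by (simp add: vec_eq_iff 1 2)
  qed
  then have "det (matrix L) * det (matrix L) = c\<^sup>2"
    using det_mul[of "transpose (matrix L)" "matrix L"] by (simp add: det_mat_minus_rank_one c(2))
  then have det: "\<bar>det (matrix L)\<bar> = c"
    using c(1) by (metis abs_of_pos power2_eq_square real_sqrt_abs)
  then have "inj L" using det_nz_iff_inj[OF lin] c by auto
  then have bij: "bij L" using lin linear_injective_imp_surjective by (metis bij_def)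
  have meas: "L \<in> borel_measurable borel"
    using lin by (simp add: linear_continuous_on linear_conv_bounded_linear borel_measurable_continuous_onI)
  show ?thesis
  proof (rule lborel_eqI[symmetric])
    fix a b :: "real^'m::{finite,wellorder}" assume ab: "\<And>i. i \<in> Basis \<Longrightarrow> a \<bullet> i \<le> b \<bullet> i"
    obtain h where h: "linear h" "\<And>x. h (L x) = x" "\<And>x. L (h x) = x"
      using linear_injective_isomorphism[OF lin \<open>inj L\<close>] by blast
    have vim: "L -` box a b = h ` box a b"
      by (auto simp: h image_iff) (metis h(2))
    have op: "open (L -` box a b)"
      by (rule open_vimage) (use lin linear_continuous_on linear_conv_bounded_linear in blast)+
    have bd: "bounded (L -` box a b)"
      unfolding vim by (rule bounded_linear_image) (use h linear_conv_bounded_linear in auto)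
    have S: "L -` box a b \<in> lmeasurable"
      using op bd lmeasurable_open by blast
    have "L ` (L -` box a b) = box a b" using bij by (metis bij_def surj_image_vimage_eq)
    then have "measure lebesgue (box a b) = c * measure lebesgue (L -` box a b)"
      using measure_linear_image[OF lin S] det by simp
    then have 1: "measure lborel (box a b) = c * measure lborel (L -` box a b)"
      using op by (simp add: measure_completion)
    have fin: "emeasure lborel (L -` box a b) = ennreal (measure lborel (L -` box a b))"
      using bd emeasure_bounded_finite[OF bd] by (simp add: emeasure_eq_ennreal_measure)
    have "emeasure (density (distr lborel borel L) (\<lambda>_. ennreal c)) (box a b)
       = ennreal c * emeasure lborel (L -` box a b)"
      using meas op by (subst emeasure_density) (auto simp: nn_integral_cmult emeasure_distr)
    also have "\<dots> = ennreal (measure lborel (box a b))"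
      using 1 c(1) by (simp add: fin ennreal_mult)
    also have "\<dots> = emeasure lborel (box a b)"
      by (rule emeasure_eq_ennreal_measure[symmetric]) (simp add: emeasure_lborel_box_eq)
    also have "\<dots> = ennreal (\<Prod>i\<in>Basis. (b - a) \<bullet> i)"
      using ab by (simp add: emeasure_lborel_box)
    finally show "emeasure (density (distr lborel borel L) (\<lambda>_. ennreal c)) (box a b) = (\<Prod>i\<in>Basis. (b - a) \<bullet> i)" .
  qed simp
qed

text \<open>
  The change of variables formula of the library for linear maps of \<open>real^'n\<close> needs an index
  type in class \<open>wellorder\<close>. An arbitrary finite index type is copied to one.
\<close>

typedef 'a ordered_copy = "UNIV :: 'a set" ..

instantiation ordered_copy :: (finite) "{finite, wellorder}"
begin

definition copy_index :: "'a ordered_copy \<Rightarrow> nat" where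
  "copy_index = (SOME f. inj f)"

definition less_eq_ordered_copy :: "'a ordered_copy \<Rightarrow> 'a ordered_copy \<Rightarrow> bool" where
  "x \<le> y \<longleftrightarrow> copy_index x \<le> copy_index y"

definition less_ordered_copy :: "'a ordered_copy \<Rightarrow> 'a ordered_copy \<Rightarrow> bool" where
  "x < y \<longleftrightarrow> copy_index x < copy_index y"

instance
proof
  have fin: "finite (UNIV :: 'a ordered_copy set)"
    by (metis finite_imageI finite_class.finite_UNIV type_definition.Abs_image
        type_definition_ordered_copy)
  then show "finite (UNIV :: 'a ordered_copy set)" .
  have "\<exists>f :: 'a ordered_copy \<Rightarrow> nat. inj f"
    using finite_imp_inj_to_nat_seg[OF fin] by blast
  then have inj: "inj (copy_index :: 'a ordered_copy \<Rightarrow> nat)"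
    unfolding copy_index_def by (rule someI_ex)
  fix x y z :: "'a ordered_copy"
  show "(x < y) = (x \<le> y \<and> \<not> y \<le> x)" "x \<le> x" "x \<le> y \<or> y \<le> x"
    by (auto simp: less_eq_ordered_copy_def less_ordered_copy_def)
  show "x \<le> y \<Longrightarrow> y \<le> z \<Longrightarrow> x \<le> z" by (simp add: less_eq_ordered_copy_def)
  show "x \<le> y \<Longrightarrow> y \<le> x \<Longrightarrow> x = y"
    using inj by (simp add: less_eq_ordered_copy_def inj_eq)
next
  fix P :: "'a ordered_copy \<Rightarrow> bool" and x :: "'a ordered_copy"
  assume step: "\<And>x. (\<And>y. y < x \<Longrightarrow> P y) \<Longrightarrow> P x"
  show "P x"
    by (induction x rule: measure_induct[of copy_index]) (use step less_ordered_copy_def in blast)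
qed

end

text \<open>\<open>R\<close> and \<open>R'\<close> only relabel coordinates, so they preserve inner
  products and Lebesgue measure. Conjugating \<open>L\<close> with them keeps the hypotheses, with
  \<open>R l\<close> in place of \<open>l\<close>.\<close>

lemma density_distr_projection:
  fixes L :: "real^'d \<Rightarrow> real^'d"
  assumes lin: "linear L" and L: "\<And>x. (norm (L x))\<^sup>2 + (l \<bullet> x)\<^sup>2 = (norm x)\<^sup>2"
    and c: "c > 0" "c\<^sup>2 = 1 - l \<bullet> l"
  shows "density (distr lborel borel L) (\<lambda>_. ennreal c) = lborel"
proof -
  define R :: "real^'d \<Rightarrow> real^'d ordered_copy" where "R = (\<lambda>x. \<chi> i. x $ Rep_ordered_copy i)"
  define R' :: "real^'d ordered_copy \<Rightarrow> real^'d" where "R' = (\<lambda>x. \<chi> i. x $ Abs_ordered_copy i)"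
  have [simp]: "R (R' x) = x" "R' (R y) = y" for x y
    by (simp_all add: R_def R'_def vec_eq_iff Abs_ordered_copy_inverse Rep_ordered_copy_inverse)
  have linR: "linear R" "linear R'"
    by (auto intro!: linearI simp: R_def R'_def vec_eq_iff)
  have bijA: "bij (Abs_ordered_copy :: 'd \<Rightarrow> _)"
    by (metis (no_types, opaque_lifting) Abs_ordered_copy_inverse Rep_ordered_copy_inverse UNIV_I bijI' )
  have inR': "R' x \<bullet> R' y = x \<bullet> y" for x y
    by (simp add: R'_def inner_vec_def sum.reindex_bij_betw[OF bijA, of "\<lambda>i. x $ i * y $ i"])
  have nR': "norm (R' x) = norm x" for x by (simp add: norm_eq_sqrt_inner inR')
  have inR: "R x \<bullet> R y = x \<bullet> y" for x y using inR'[of "R x" "R y"] by simp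
  have nR: "norm (R x) = norm x" for x by (simp add: norm_eq_sqrt_inner inR)
  have measR: "R \<in> borel_measurable borel" "R' \<in> borel_measurable borel"
    using linR by (auto simp: linear_continuous_on linear_conv_bounded_linear borel_measurable_continuous_onI)
  have measL: "L \<in> borel_measurable borel"
    using lin by (simp add: linear_continuous_on linear_conv_bounded_linear borel_measurable_continuous_onI)
  have distR': "distr lborel borel R' = lborel"
  proof (rule lborel_eqI[symmetric])
    fix a b :: "real^'d" assume ab: "\<And>i. i \<in> Basis \<Longrightarrow> a \<bullet> i \<le> b \<bullet> i"
    have ab': "a $ i \<le> b $ i" for i using ab[of "axis i 1"] by (simp add: inner_axis axis_in_Basis_iff)
    have "R' -` box a b = box (R a) (R b)"
    proof (intro set_eqI)
      fix x
      have "(\<forall>i. a $ i < x $ Abs_ordered_copy i \<and> x $ Abs_ordered_copy i < b $ i) \<longleftrightarrow>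
          (\<forall>j. a $ Rep_ordered_copy j < x $ j \<and> x $ j < b $ Rep_ordered_copy j)"
        by (metis Abs_ordered_copy_inverse Rep_ordered_copy_inverse UNIV_I)
      then show "x \<in> R' -` box a b \<longleftrightarrow> x \<in> box (R a) (R b)"
        by (auto simp: box_def Basis_vec_def inner_axis R_def R'_def)
    qed
    then have "emeasure (distr lborel borel R') (box a b) = emeasure lborel (box (R a) (R b))"
      using measR by (simp add: emeasure_distr)
    also have "\<dots> = (\<Prod>i\<in>Basis. (R b - R a) \<bullet> i)"
      by (rule emeasure_lborel_box) (auto simp: Basis_vec_def inner_axis R_def ab')
    also have "(\<Prod>i\<in>Basis. (R b - R a) \<bullet> i) = (\<Prod>i\<in>UNIV. (R b - R a) $ i)"
      by (simp add: Basis_vec_def inner_axis UNION_singleton_eq_range prod.reindex inj_on_def axis_eq_axis)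
    also have "\<dots> = (\<Prod>i\<in>UNIV. (b - a) $ i)"
      using prod.reindex_bij_betw[OF bijA, of "\<lambda>i. (R b - R a) $ i"]
      by (simp add: R_def Abs_ordered_copy_inverse)
    also have "\<dots> = (\<Prod>i\<in>Basis. (b - a) \<bullet> i)"
      by (simp add: Basis_vec_def inner_axis UNION_singleton_eq_range prod.reindex inj_on_def axis_eq_axis)
    finally show "emeasure (distr lborel borel R') (box a b) = (\<Prod>i\<in>Basis. (b - a) \<bullet> i)" .
  qed simp
  define L' where "L' = R \<circ> L \<circ> R'"
  have "density (distr lborel borel L') (\<lambda>_. ennreal c) = lborel"
  proof (rule density_distr_projection_wellorder[where l = "R l"])
    show "linear L'" unfolding L'_def using lin linR by (auto intro: linear_compose)
    show "(norm (L' x))\<^sup>2 + (R l \<bullet> x)\<^sup>2 = (norm x)\<^sup>2" for x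
      using L[of "R' x"] inR[of l "R' x"] by (simp add: L'_def nR nR')
  qed (use c inR in auto)
  then have "distr (density (distr lborel borel L') (\<lambda>_. ennreal c)) borel R' = distr lborel borel R'"
    by simp
  moreover have "distr (density (distr lborel borel L') (\<lambda>_. ennreal c)) borel R' =
     density (distr (distr lborel borel L') borel R') (\<lambda>_. ennreal c)"
    using density_distr[of "\<lambda>_. ennreal c" borel R' "distr lborel borel L'"] measR by simp
  \<comment> \<open>\<open>R'\<close> undoes the outer \<open>R\<close> in \<open>L'\<close>, so
    both sides push forward along \<open>L\<close> after \<open>R'\<close>.\<close>
  moreover have "distr (distr lborel borel L') borel R' = distr (distr lborel borel R') borel L"
    using measR measL
    by (simp add: distr_distr L'_def o_def measurable_compose[OF measurable_compose[OF measR(2) measL] measR(1)])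
  ultimately show ?thesis by (simp add: distR')
qed

section \<open>Surface measure on hyperplanes\<close>

text \<open>Preserved distances give preserved inner products once the origin is fixed. The squared
  norms of the defects of additivity and homogeneity then expand to zero.\<close>

lemma isometry_imp_linear:
  fixes f :: "'a::real_inner \<Rightarrow> 'b::real_inner"
  assumes dist: "\<And>x y. dist (f x) (f y) = dist x y"
  shows "linear (\<lambda>x. f x - f 0)"
proof -
  define g where "g = (\<lambda>x. f x - f 0)"
  have nd: "norm (g x - g y) = norm (x - y)" for x y
    using dist[of x y] by (simp add: g_def dist_norm)
  have n: "norm (g x) = norm x" for x
    using nd[of x 0] by (simp add: g_def)
  have ip: "g x \<bullet> g y = x \<bullet> y" for x y
    using n nd by (simp add: dot_norm_neg)
  show ?thesis unfolding g_def[symmetric]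
  proof (rule linearI)
    fix x y
    have "norm (g (x + y) - g x - g y) ^ 2 = 0"
      unfolding power2_norm_eq_inner by (simp add: inner_diff_left inner_diff_right inner_add_left inner_add_right ip)
    then have "g (x + y) - g x - g y = 0" by (simp only: power_eq_0_iff norm_eq_zero)
    then show "g (x + y) = g x + g y" by (simp add: algebra_simps)
  next
    fix c x
    have "norm (g (c *\<^sub>R x) - c *\<^sub>R g x) ^ 2 = 0"
      unfolding power2_norm_eq_inner by (simp add: inner_diff_left inner_diff_right ip)
    then have "g (c *\<^sub>R x) - c *\<^sub>R g x = 0" by (simp only: power_eq_0_iff norm_eq_zero)
    then show "g (c *\<^sub>R x) = c *\<^sub>R g x" by simp
  qed
qed

lemma flat_measure_cong_hull: "affine hull F = affine hull G \<Longrightarrow> flat_measure F = flat_measure G"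
  by (simp add: flat_measure_def)

text \<open>This makes the choice in \<open>flat_measure\<close> meaningful: the direction space of
  the hull has dimension \<open>d\<close>, hence is a linear isometric copy of
  \<open>real^'d\<close>.\<close>

lemma exists_isometric_parametrisation:
  fixes F :: "((real^'d) \<times> real) set"
  assumes "aff_dim F = CARD('d)"
  shows "\<exists>\<phi> :: real^'d \<Rightarrow> (real^'d) \<times> real. (\<forall>x y. dist (\<phi> x) (\<phi> y) = dist x y) \<and> range \<phi> = affine hull F"
proof -
  obtain a where a: "a \<in> affine hull F"
    using assms by (metis aff_dim_empty affine_hull_eq_empty all_not_in_conv of_nat_0_le_iff not_one_le_zero
        neg_0_le_iff_le)
  define S where "S = (\<lambda>x. x - a) ` (affine hull F)"
  have "S = (+) (-a) ` (affine hull F)" by (auto simp: S_def)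
  then have sub: "subspace S"
    using affine_diffs_subspace[OF _ a] by (simp)
  have "aff_dim (affine hull F) = int (dim S)"
    using aff_dim_dim_affine_diffs[OF affine_affine_hull a] by (simp add: S_def)
  then have dimS: "dim S = CARD('d)" using assms by simp
  obtain f :: "real^'d \<Rightarrow> (real^'d) \<times> real" where f: "linear f" "f ` UNIV = S" "\<And>x. norm (f x) = norm x"
    using isometries_subspaces[of "UNIV :: (real^'d) set" S] sub dimS by (metis UNIV_I dim_UNIV DIM_cart DIM_real mult.right_neutral subspace_UNIV)
  have "dist (a + f x) (a + f y) = dist x y" for x y
    using f by (simp add: dist_norm linear_diff[symmetric])
  moreover have "range (\<lambda>x. a + f x) = affine hull F"
  proof -
    have "range (\<lambda>x. a + f x) = (+) a ` S" using f(2) by (simp add: image_image[symmetric])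
    then show ?thesis by (simp add: S_def image_image)
  qed
  ultimately show ?thesis by (intro exI[of _ "\<lambda>x. a + f x"]) simp
qed

text \<open>Exposes the very parametrisation chosen in \<open>flat_measure\<close>, so that the
  choice operator does not reappear in later arguments on surface integrals.\<close>

lemma flat_measure_parametrisation:
  fixes F :: "((real^'d) \<times> real) set"
  assumes "aff_dim F = CARD('d)"
  obtains \<phi> :: "real^'d \<Rightarrow> (real^'d) \<times> real"
  where "flat_measure F = distr lborel borel \<phi>" "\<And>x y. dist (\<phi> x) (\<phi> y) = dist x y"
    "range \<phi> = affine hull F" "\<phi> \<in> borel_measurable borel" "continuous_on UNIV \<phi>"
    "linear (\<lambda>x. \<phi> x - \<phi> 0)"
proof -
  define \<phi> where "\<phi> = (SOME \<phi> :: real^'d \<Rightarrow> (real^'d) \<times> real.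
          (\<forall>x y. dist (\<phi> x) (\<phi> y) = dist x y) \<and> range \<phi> = affine hull F)"
  have *: "(\<forall>x y. dist (\<phi> x) (\<phi> y) = dist x y) \<and> range \<phi> = affine hull F"
    unfolding \<phi>_def by (rule someI_ex[OF exists_isometric_parametrisation[OF assms]])
  then have cont: "continuous_on UNIV \<phi>"
    by (auto simp: continuous_on_iff)
  show thesis
  proof (rule that[of \<phi>])
    show "flat_measure F = distr lborel borel \<phi>" by (simp add: flat_measure_def \<phi>_def)
    show "\<phi> \<in> borel_measurable borel" using cont by (rule borel_measurable_continuous_onI)
    show "linear (\<lambda>x. \<phi> x - \<phi> 0)" using * isometry_imp_linear by blast
  qed (use * cont in auto)
qed

lemma sets_flat_measure [measurable_cong, simp]: "sets (flat_measure F) = sets borel"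
  and space_flat_measure [simp]: "space (flat_measure F) = UNIV"
  by (simp_all add: flat_measure_def)

lemma borel_measurable_indicator_continuous:
  fixes g :: "'a::topological_space \<Rightarrow> 'b::real_normed_vector"
  assumes "closed F" "continuous_on F g"
  shows "(\<lambda>z. indicator F z *\<^sub>R g z) \<in> borel_measurable borel"
  using assms by (intro borel_measurable_continuous_on_indicator) auto

text \<open>The preimage of a compact set under the isometric parametrisation is closed and bounded,
  so the claim reduces to a continuous function on a compact subset of
  \<open>real^'d\<close>.\<close>

lemma set_integrable_flat_measure:
  fixes F :: "((real^'d) \<times> real) set" and g :: "_ \<Rightarrow> 'b::euclidean_space"
  assumes F: "aff_dim F' = CARD('d)" and K: "compact F" and g: "continuous_on F g"
  shows "set_integrable (flat_measure F') F g"
proof -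
  from F obtain \<phi> :: "real^'d \<Rightarrow> (real^'d) \<times> real" where
    \<phi>: "flat_measure F' = distr lborel borel \<phi>" "\<And>x y. dist (\<phi> x) (\<phi> y) = dist x y"
     "\<phi> \<in> borel_measurable borel" "continuous_on UNIV \<phi>"
    by (rule flat_measure_parametrisation) blast
  have cl: "closed (\<phi> -` F)" using \<phi>(4) K compact_imp_closed closed_vimage by blast
  have bd: "bounded (\<phi> -` F)"
  proof -
    obtain e where "\<forall>x\<in>F. \<forall>y\<in>F. dist x y \<le> e"
      using compact_imp_bounded[OF K] unfolding bounded_two_points by auto
    then show ?thesis unfolding bounded_two_points using \<phi>(2) by (metis vimageD)
  qed
  have "integrable lborel (\<lambda>x. indicator (\<phi> -` F) x *\<^sub>R g (\<phi> x))"
  proof (rule borel_integrable_compact)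
    show "compact (\<phi> -` F)" using cl bd by (simp add: compact_eq_bounded_closed)
    show "continuous_on (\<phi> -` F) (\<lambda>x. g (\<phi> x))"
      by (rule continuous_on_compose2[OF g]) (use \<phi>(4) continuous_on_subset in auto)
  qed
  moreover have "indicator (\<phi> -` F) x = (indicator F (\<phi> x) :: real)" for x by (simp add: indicator_def)
  ultimately show ?thesis
    unfolding set_integrable_def \<phi>(1)
    using borel_measurable_indicator_continuous[OF compact_imp_closed[OF K] g] \<phi>(3)
    by (subst integrable_distr_eq) auto
qed

text \<open>The parametrisation pulls the affine hull of \<open>S\<close> back to a proper affine
  subspace, which is negligible. This discards relative boundaries of facets and lower-dimensional
  sections with the top plane.\<close>

lemma AE_flat_measure_lowdim:
  fixes F S :: "((real^'d) \<times> real) set"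
  assumes F: "aff_dim F = CARD('d)" and S: "aff_dim S < CARD('d)"
  shows "AE z in flat_measure F. z \<notin> S"
proof -
  from F obtain \<phi> :: "real^'d \<Rightarrow> (real^'d) \<times> real" where
    \<phi>: "flat_measure F = distr lborel borel \<phi>" "\<And>x y. dist (\<phi> x) (\<phi> y) = dist x y"
     "range \<phi> = affine hull F"
     "\<phi> \<in> borel_measurable borel" "continuous_on UNIV \<phi>" "linear (\<lambda>x. \<phi> x - \<phi> 0)"
    by (rule flat_measure_parametrisation) blast
  define V where "V = \<phi> -` (affine hull S)"
  have aff: "affine V"
    unfolding affine_def
  proof (intro ballI allI impI)
    fix x y and u v :: real
    assume "x \<in> V" "y \<in> V" and uv: "u + v = 1"
    then have H: "\<phi> x \<in> affine hull S" "\<phi> y \<in> affine hull S" by (auto simp: V_def)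
    have "\<phi> (u *\<^sub>R x + v *\<^sub>R y) - \<phi> 0 = u *\<^sub>R (\<phi> x - \<phi> 0) + v *\<^sub>R (\<phi> y - \<phi> 0)"
      
      by (simp add: linear_add[OF \<phi>(6)] linear_scale[OF \<phi>(6)])
    then have "\<phi> (u *\<^sub>R x + v *\<^sub>R y) = u *\<^sub>R \<phi> x + v *\<^sub>R \<phi> y + (1 - (u + v)) *\<^sub>R \<phi> 0"
      by (simp add: algebra_simps)
    also have "\<dots> = u *\<^sub>R \<phi> x + v *\<^sub>R \<phi> y" using uv by simp
    finally show "u *\<^sub>R x + v *\<^sub>R y \<in> V"
      using H uv mem_affine[OF affine_affine_hull] by (simp add: V_def)
  qed
  have "V \<noteq> UNIV"
  proof
    assume "V = UNIV"
    then have "affine hull F \<subseteq> affine hull S" 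
      using \<phi>(3) image_vimage_subset[of \<phi> "affine hull S"] by (simp add: V_def)
    then have "aff_dim F \<le> aff_dim S" by (metis aff_dim_affine_hull aff_dim_subset)
    then show False using F S by simp
  qed
  then have "interior V = {}"
    using aff affine_hull_nonempty_interior affine_hull_eq by blast
  then have "negligible V" using negligible_convex_interior[OF affine_imp_convex[OF aff]] by simp
  moreover have V: "V \<in> sets borel"
    using \<phi>(4) measurable_sets_borel[OF \<phi>(4), of "affine hull S"] by (simp add: V_def)
  ultimately have "emeasure lborel V = 0"
    by (simp add: negligible_iff_emeasure0 V)
  then have "emeasure (flat_measure F) (affine hull S) = 0"
    using \<phi>(4) by (simp add: \<phi>(1) emeasure_distr V_def)
  then have "affine hull S \<in> null_sets (flat_measure F)"
    by (auto simp: null_sets_def)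
  then show ?thesis
    by (rule AE_I') (use hull_subset in force)
qed

text \<open>Connects the covering definition of null sets with the image measure: a ball of radius
  \<open>r\<close> has surface measure at most a constant times \<open>r^d\<close>, so a cover with
  small sum has small surface measure.\<close>

lemma AE_flat_measure_surface_null:
  fixes F N :: "((real^'d) \<times> real) set"
  assumes F: "aff_dim F = CARD('d)" and N: "surface_null N"
  shows "AE z in flat_measure F. z \<notin> N"
proof -
  from F obtain \<phi> :: "real^'d \<Rightarrow> (real^'d) \<times> real" where
    \<phi>: "flat_measure F = distr lborel borel \<phi>" "\<And>x y. dist (\<phi> x) (\<phi> y) = dist x y"
     "\<phi> \<in> borel_measurable borel"
    by (rule flat_measure_parametrisation) blast
  \<comment> \<open>The volume of a \<open>d\<close>-dimensional ball of radius \<open>2 * r\<close>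
    is \<open>C * r^d\<close>.\<close>
  define C where "C = unit_ball_vol (real CARD('d)) * 2 ^ CARD('d)"
  have C: "C \<ge> 0" by (simp add: C_def)
  have cb: "emeasure (flat_measure F) (cball c r) \<le> ennreal (C * r ^ CARD('d))" if "r \<ge> 0" for c r
  proof (cases "\<phi> -` cball c r = {}")
    case True
    then show ?thesis using \<phi>(3) by (simp add: \<phi>(1) emeasure_distr)
  next
    case False
    \<comment> \<open>The centre \<open>c\<close> may lie off the hyperplane, so the preimage is
      recentred at one of its own points, which doubles the radius.\<close>
    then obtain y where y: "\<phi> y \<in> cball c r" by blast
    have "\<phi> -` cball c r \<subseteq> cball y (2 * r)"
    proof
      fix x assume "x \<in> \<phi> -` cball c r"
      then have "dist (\<phi> y) (\<phi> x) \<le> 2 * r"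
        using y dist_triangle3[of "\<phi> y" "\<phi> x" c] by simp
      then show "x \<in> cball y (2 * r)" by (simp add: \<phi>(2))
    qed
    then have "emeasure (flat_measure F) (cball c r) \<le> emeasure lborel (cball y (2 * r))"
      using \<phi>(3) by (simp add: \<phi>(1) emeasure_distr emeasure_mono)
    also have "\<dots> = ennreal (C * r ^ CARD('d))"
      using that by (simp add: emeasure_cball C_def power_mult_distrib mult_ac)
    finally show ?thesis .
  qed
  have cover: "\<exists>B \<in> sets borel. N \<subseteq> B \<and> emeasure (flat_measure F) B \<le> ennreal (C * \<epsilon>)" if "\<epsilon> > 0" for \<epsilon>
  proof -
    from N[unfolded surface_null_def, rule_format, OF that]
    obtain c :: "nat \<Rightarrow> (real^'d) \<times> real" and r where
      "\<forall>i. 0 \<le> r i" and cr': "N \<subseteq> (\<Union>i. cball (c i) (r i))"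
        "summable (\<lambda>i. r i ^ CARD('d))" "(\<Sum>i. r i ^ CARD('d)) < \<epsilon>"
      by (elim exE conjE)
    then have cr: "\<And>i. 0 \<le> r i" by simp
    note cr = cr cr'
    have "emeasure (flat_measure F) (\<Union>i. cball (c i) (r i)) \<le> (\<Sum>i. emeasure (flat_measure F) (cball (c i) (r i)))"
      by (rule emeasure_subadditive_countably) auto
    also have "\<dots> \<le> (\<Sum>i. ennreal (C * r i ^ CARD('d)))"
      by (intro suminf_le cb cr) auto
    also have "\<dots> = ennreal (\<Sum>i. C * r i ^ CARD('d))"
      using cr C by (intro suminf_ennreal2) auto
    also have "\<dots> \<le> ennreal (C * \<epsilon>)"
      using cr C by (intro ennreal_leI) (simp add: suminf_mult mult_left_mono)
    finally show ?thesis using cr(2) by (intro bexI[of _ "\<Union>i. cball (c i) (r i)"]) auto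
  qed
  \<comment> \<open>\<open>N\<close> is not assumed measurable; the intersection of Borel supersets
    of vanishing measure takes its place.\<close>
  have "\<forall>n. \<exists>B. B \<in> sets borel \<and> N \<subseteq> B \<and> emeasure (flat_measure F) B \<le> ennreal (C * (1 / real (Suc n)))"
    using cover[of "1 / real (Suc n)" for n] by (auto simp del: of_nat_Suc)
  then obtain B where B: "\<And>n. B n \<in> sets borel" "\<And>n. N \<subseteq> B n"
    "\<And>n. emeasure (flat_measure F) (B n) \<le> ennreal (C * (1 / real (Suc n)))"
    by metis
  have le: "emeasure (flat_measure F) (\<Inter>n. B n) \<le> ennreal (C * (1 / real (Suc n)))" for n
    by (rule order_trans[OF emeasure_mono B(3)]) (use B(1) in auto)
  have "(\<lambda>n. ennreal (C * (1 / real (Suc n)))) \<longlonglongrightarrow> ennreal (C * 0)"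
    by (intro tendsto_ennrealI tendsto_mult tendsto_const LIMSEQ_Suc lim_1_over_n)
  then have "emeasure (flat_measure F) (\<Inter>n. B n) \<le> 0"
    using le by (intro LIMSEQ_le_const) auto
  then have "(\<Inter>n. B n) \<in> null_sets (flat_measure F)"
    using B(1) by (auto simp: null_sets_def)
  then show ?thesis by (rule AE_I') (use B(2) in auto)
qed

text \<open>
  Along a parametrisation \<open>\<phi>\<close> of the hyperplane, the spatial projection has the linear part \<open>L\<close> with
  \<open>L\<^sup>T L = I - l l\<^sup>T\<close>, where \<open>l\<close> collects the slopes of \<open>\<phi>\<close> in time and \<open>\<bar>l\<bar>\<^sup>2 = 1 - n\<^sub>t\<^sup>2\<close>.
\<close>

lemma flat_measure_projection:
  fixes F :: "((real^'d) \<times> real) set" and g :: "_ \<Rightarrow> real"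
  assumes F: "aff_dim F = CARD('d)" and H: "affine hull F = {z. n \<bullet> z = \<beta>}"
    and n: "norm n = 1" "snd n \<noteq> 0" and cF: "compact F" and g: "continuous_on F g"
  shows "\<bar>snd n\<bar> * (LINT z:F|flat_measure F. g z) =
    (LINT x:fst ` F|lborel. g (x, (\<beta> - fst n \<bullet> x) / snd n))"
proof -
  from F obtain \<phi> :: "real^'d \<Rightarrow> (real^'d) \<times> real" where
    \<phi>: "flat_measure F = distr lborel borel \<phi>" "\<And>x y. dist (\<phi> x) (\<phi> y) = dist x y"
     "range \<phi> = affine hull F"
     "\<phi> \<in> borel_measurable borel" "linear (\<lambda>x. \<phi> x - \<phi> 0)"
    by (rule flat_measure_parametrisation) blast
  define A where "A = (\<lambda>x. \<phi> x - \<phi> 0)"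
  define a where "a = fst (\<phi> 0)"
  define L where "L = (\<lambda>x. fst (A x))"
  define \<tau> where "\<tau> = (\<lambda>x. (\<beta> - fst n \<bullet> x) / snd n)"
  have linA: "linear A" using \<phi>(5) by (simp add: A_def)
  have linL: "linear L" unfolding L_def
    using linear_compose[OF linA linear_fst] by (simp add: o_def)
  have nA: "norm (A x) = norm x" for x using \<phi>(2)[of x 0] by (simp add: A_def dist_norm)
  have ipA: "A x \<bullet> A y = x \<bullet> y" for x y
    using nA by (simp add: dot_norm linear_add[OF linA, symmetric])
  have n\<phi>: "n \<bullet> \<phi> x = \<beta>" for x using \<phi>(3) H by auto
  have nA0: "A x \<bullet> n = 0" for x using n\<phi>[of x] n\<phi>[of 0] by (simp add: A_def inner_diff inner_commute)
  have nn: "n \<bullet> n = 1" using n by (simp add: dot_square_norm)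
  define e :: "(real^'d) \<times> real" where "e = (0, 1)"
  have en: "e \<bullet> n = snd n" by (simp add: e_def inner_prod_def)
  \<comment> \<open>The projection of the unit time vector to the directions of the hyperplane. Its
    coordinate vector \<open>l\<close> represents the time component of \<open>A\<close> as an inner
    product.\<close>
  have "\<phi> 0 + (e - snd n *\<^sub>R n) \<in> range \<phi>"
    unfolding \<phi>(3) H by (simp add: inner_add inner_diff n\<phi> nn en inner_commute[of n e])
  then obtain l where l: "A l = e - snd n *\<^sub>R n" by (auto simp: A_def algebra_simps)
  have sA: "snd (A x) = l \<bullet> x" for x
  proof -
    have "snd (A x) = A x \<bullet> e" by (simp add: e_def inner_prod_def)
    also have "\<dots> = A x \<bullet> (A l + snd n *\<^sub>R n)" by (simp add: l)
    also have "\<dots> = l \<bullet> x" by (simp add: inner_add_right nA0 ipA inner_commute[of x l])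
    finally show ?thesis .
  qed
  have "(snd n)\<^sup>2 = 1 - l \<bullet> l"
  proof -
    have "l \<bullet> l = (e - snd n *\<^sub>R n) \<bullet> (e - snd n *\<^sub>R n)" using ipA[of l l] l by simp
    also have "\<dots> = 1 - (snd n)\<^sup>2"
      using en by (simp add: inner_diff nn inner_commute[of n e] power2_eq_square)
         (simp add: e_def inner_prod_def)
    finally show ?thesis by simp
  qed
  moreover have "(norm (L x))\<^sup>2 + (l \<bullet> x)\<^sup>2 = (norm x)\<^sup>2" for x
    using nA[of x] unfolding sA[symmetric] L_def by (metis norm_prod_def prod.collapse real_norm_def
        power2_abs real_sqrt_pow2 sum_power2_ge_zero)
  ultimately have dens: "density (distr lborel borel L) (\<lambda>_. ennreal \<bar>snd n\<bar>) = lborel"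
    using n linL by (intro density_distr_projection[where l = l]) auto
  have measL: "L \<in> borel_measurable borel"
    using linL by (simp add: linear_continuous_on linear_conv_bounded_linear borel_measurable_continuous_onI)
  have graph: "z = (fst z, \<tau> (fst z))" if "n \<bullet> z = \<beta>" for z
    using that n(2) by (cases z, cases n) (simp add: \<tau>_def field_simps)
  have Fgr: "n \<bullet> z = \<beta>" if "z \<in> F" for z
    using hull_inc[of z F affine] that unfolding H by simp
  define G where "G = (\<lambda>x. indicator (fst ` F) x *\<^sub>R g (x, \<tau> x))"
  have "closed (fst ` F)"
    by (intro compact_imp_closed compact_continuous_image cF continuous_intros)
  moreover have "continuous_on (fst ` F) (\<lambda>x. g (x, \<tau> x))"
  proof (rule continuous_on_compose2[OF g])
    show "continuous_on (fst ` F) (\<lambda>x. (x, \<tau> x))" unfolding \<tau>_def using n by (intro continuous_intros) auto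
    show "(\<lambda>x. (x, \<tau> x)) ` fst ` F \<subseteq> F" using graph[OF Fgr] by force
  qed
  ultimately have measG: "G \<in> borel_measurable borel"
    unfolding G_def by (rule borel_measurable_indicator_continuous)
  have measG': "(\<lambda>x. G (a + x)) \<in> borel_measurable borel"
    using measG by measurable
  \<comment> \<open>Translation by the spatial part of the base point leaves the purely linear map
    \<open>L\<close>.\<close>
  have "(LINT x:fst ` F|lborel. g (x, \<tau> x)) = (LINT x|distr lborel borel ((+) a). G x)"
    by (simp add: set_lebesgue_integral_def G_def lborel_distr_plus)
  also have "\<dots> = (LINT x|lborel. G (a + x))"
    using measG by (subst integral_distr) auto
  also have "\<dots> = (LINT x|density (distr lborel borel L) (\<lambda>_. ennreal \<bar>snd n\<bar>). G (a + x))"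
    by (simp only: dens)
  also have "\<dots> = \<bar>snd n\<bar> * (LINT x|lborel. G (a + L x))"
    using measG' measL by (subst integral_density) (auto simp: integral_distr)
  also have "(\<lambda>x. G (a + L x)) = (\<lambda>x. indicator F (\<phi> x) *\<^sub>R g (\<phi> x))"
  proof
    fix x
    have 1: "a + L x = fst (\<phi> x)" by (simp add: a_def L_def A_def)
    have 2: "\<phi> x = (fst (\<phi> x), \<tau> (fst (\<phi> x)))" by (rule graph[OF n\<phi>])
    have "fst (\<phi> x) \<in> fst ` F \<longleftrightarrow> \<phi> x \<in> F"
    proof
      assume "fst (\<phi> x) \<in> fst ` F"
      then obtain z where "z \<in> F" "fst z = fst (\<phi> x)" by auto
      then show "\<phi> x \<in> F" using 2 graph[OF Fgr[of z]] by simp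
    qed auto
    then show "G (a + L x) = indicator F (\<phi> x) *\<^sub>R g (\<phi> x)"
      unfolding 1 G_def using 2 by (simp add: indicator_def)
  qed
  also have "(LINT x|lborel. indicator F (\<phi> x) *\<^sub>R g (\<phi> x)) = (LINT z:F|flat_measure F. g z)"
    unfolding set_lebesgue_integral_def \<phi>(1)
    using borel_measurable_indicator_continuous[OF compact_imp_closed[OF cF] g] \<phi>(4)
    by (subst integral_distr) auto
  finally show ?thesis by (simp add: \<tau>_def)
qed

section \<open>Facets of polyhedra\<close>

text \<open>The component \<open>w\<close> of \<open>m\<close> orthogonal to \<open>n\<close> is a
  direction of the smaller hyperplane, so \<open>m\<close> is orthogonal to it; hence
  \<open>w\<close> is orthogonal to itself.\<close>

lemma hyperplane_subset_imp_parallel: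
  fixes m n :: "'a::euclidean_space"
  assumes mn: "norm m = 1" "norm n = 1" and sub: "{z. n \<bullet> z = \<beta>} \<subseteq> {z. m \<bullet> z = \<gamma>}"
  shows "m = n \<or> m = - n"
proof -
  have nn: "n \<bullet> n = 1" "m \<bullet> m = 1" using mn by (simp_all add: dot_square_norm)
  define w where "w = m - (m \<bullet> n) *\<^sub>R n"
  have nw: "n \<bullet> w = 0" by (simp add: w_def inner_diff nn inner_commute)
  have "\<beta> *\<^sub>R n \<in> {z. n \<bullet> z = \<beta>}" "\<beta> *\<^sub>R n + w \<in> {z. n \<bullet> z = \<beta>}"
    by (simp_all add: inner_add nn nw)
  then have "m \<bullet> (\<beta> *\<^sub>R n) = \<gamma>" "m \<bullet> (\<beta> *\<^sub>R n + w) = \<gamma>" using sub by blast+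
  then have "m \<bullet> w = 0" by (simp add: inner_add)
  moreover have "w \<bullet> w = m \<bullet> w - (m \<bullet> n) * (n \<bullet> w)"
    by (subst (1) w_def) (simp add: inner_diff_left)
  ultimately have "w \<bullet> w = 0" using nw by simp
  then have m: "m = (m \<bullet> n) *\<^sub>R n" by (simp add: w_def)
  then have "\<bar>m \<bullet> n\<bar> = 1" using mn by (metis mult.right_neutral norm_scaleR)
  then have "m \<bullet> n = 1 \<or> m \<bullet> n = -1" by linarith
  then show ?thesis using m by (metis scaleR_minus1_left scaleR_one)
qed

text \<open>Identifies the definite description \<open>outer_normal\<close> with the normalised
  normal of a supporting hyperplane. A competing unit vector is constant on the facet, hence
  parallel to this normal, and an interior point of \<open>K\<close> decides the sign.\<close>

lemma facet_hyperplane: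
  fixes K :: "'a::euclidean_space set"
  assumes K: "polyhedron K" "interior K \<noteq> {}" and F: "F facet_of K"
  obtains \<beta> where "norm (outer_normal K F) = 1"
    "\<And>z. z \<in> K \<Longrightarrow> outer_normal K F \<bullet> z \<le> \<beta>"
    "F = K \<inter> {z. outer_normal K F \<bullet> z = \<beta>}"
    "affine hull F = {z. outer_normal K F \<bullet> z = \<beta>}"
    "\<And>z. z \<in> interior K \<Longrightarrow> outer_normal K F \<bullet> z < \<beta>"
proof -
  obtain a b where ab: "a \<noteq> 0" "K \<subseteq> {x. a \<bullet> x \<le> b}" "F = K \<inter> {x. a \<bullet> x = b}"
    using facet_of_polyhedron[OF K(1) F] by metis
  define n where "n = a /\<^sub>R norm a"
  define \<beta> where "\<beta> = b / norm a"
  have n: "norm n = 1" using ab by (simp add: n_def)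
  have le: "n \<bullet> z \<le> \<beta>" if "z \<in> K" for z
    using ab that by (auto simp: n_def \<beta>_def divide_simps)
  have Feq: "F = K \<inter> {z. n \<bullet> z = \<beta>}"
    using ab by (auto simp: n_def \<beta>_def divide_simps)
  have dimK: "aff_dim K = DIM('a)" using K(2) by (rule aff_dim_nonempty_interior)
  have hull: "affine hull F = {z. n \<bullet> z = \<beta>}"
  proof (rule affine_dim_equal)
    show "affine hull F \<subseteq> {z. n \<bullet> z = \<beta>}"
      by (rule hull_minimal) (use Feq affine_hyperplane in auto)
    show "aff_dim (affine hull F) = aff_dim {z. n \<bullet> z = \<beta>}"
    proof -
      have "n \<noteq> 0" using n by auto
      then show ?thesis using F dimK by (simp add: facet_of_def)
    qed
    show "affine hull F \<noteq> {}" using F by (auto simp: facet_of_def)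
  qed (auto simp: affine_hyperplane)
  have int: "n \<bullet> z < \<beta>" if "z \<in> interior K" for z
  proof -
    have "F \<inter> interior K = {}"
      using F by (intro face_of_disjoint_interior) (auto simp: facet_of_def)
    then show ?thesis using that le[of z] Feq interior_subset by fastforce
  qed
  have "outer_normal K F = n"
    unfolding outer_normal_def
  proof (rule the_equality)
    show "norm n = 1 \<and> (\<forall>x\<in>K. \<forall>y\<in>F. n \<bullet> (x - y) \<le> 0)"
      using n le Feq by (auto simp: inner_diff)
    fix m assume m: "norm m = 1 \<and> (\<forall>x\<in>K. \<forall>y\<in>F. m \<bullet> (x - y) \<le> 0)"
    obtain y where y: "y \<in> F" using F by (auto simp: facet_of_def)
    obtain z where z: "z \<in> interior K" using K by auto
    have "affine hull F \<subseteq> {z. m \<bullet> z = m \<bullet> y}"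
    proof (rule hull_minimal)
      show "F \<subseteq> {z. m \<bullet> z = m \<bullet> y}"
      proof clarify
        fix x assume "x \<in> F"
        then have "m \<bullet> (x - y) \<le> 0" "m \<bullet> (y - x) \<le> 0" using m y Feq by blast+
        then show "m \<bullet> x = m \<bullet> y" by (simp add: inner_diff)
      qed
    qed (rule affine_hyperplane)
    then have "m = n \<or> m = - n"
      unfolding hull using m n hyperplane_subset_imp_parallel by blast
    moreover have "m \<noteq> - n"
    proof
      assume "m = - n"
      then have "- n \<bullet> (z - y) \<le> 0" using m y z interior_subset by blast
      then show False using int[OF z] y Feq by (simp add: inner_diff)
    qed
    ultimately show "m = n" by blast
  qed
  then show thesis using that n le Feq hull int by metis
qed

text \<open>A point \<open>y\<close> of the half ball is a convex combination of \<open>w\<close> and a point of \<open>F\<close> close to \<open>z\<close>.\<close>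

lemma half_ball_subset:
  fixes K :: "'a::euclidean_space set"
  assumes K: "convex K" and F: "F \<subseteq> K" and n: "norm n = 1" and hull: "affine hull F = {z. n \<bullet> z = \<beta>}"
    and z: "z \<in> rel_interior F" and w: "w \<in> K" "n \<bullet> w < \<beta>"
  obtains r where "r > 0" "ball z r \<inter> {y. n \<bullet> y \<le> \<beta>} \<subseteq> K"
proof -
  obtain e where e: "e > 0" "ball z e \<inter> affine hull F \<subseteq> F"
    using z by (auto simp: mem_rel_interior_ball)
  have "z \<in> F" using z rel_interior_subset by blast
  then have nz: "n \<bullet> z = \<beta>" using hull_inc[of z F affine] hull by simp
  define c where "c = \<beta> - n \<bullet> w"
  define D where "D = norm (w - z)"
  \<comment> \<open>The bound \<open>c / 2\<close> keeps the weight \<open>l\<close> of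
    \<open>w\<close> below one half, so dividing by \<open>1 - l\<close> costs at most a factor 2;
    the second bound then places \<open>y'\<close> within \<open>e\<close> of
    \<open>z\<close>.\<close>
  define r where "r = min (c / 2) (e / (2 * (1 + D / c)))"
  have c: "c > 0" using w by (simp add: c_def)
  have D: "D \<ge> 0" by (simp add: D_def)
  have r: "r > 0" using c D e by (simp add: r_def add_pos_nonneg)
  have "y \<in> K" if y: "dist z y < r" "n \<bullet> y \<le> \<beta>" for y
  proof -
    define s where "s = \<beta> - n \<bullet> y"
    define l where "l = s / c"
    have d: "norm (y - z) < r" using y by (simp add: dist_norm norm_minus_commute)
    have "s = - (n \<bullet> (y - z))" using nz by (simp add: s_def inner_diff)
    then have "\<bar>s\<bar> \<le> norm (y - z)" using Cauchy_Schwarz_ineq2[of n "y - z"] n by simp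
    then have s: "0 \<le> s" "s < r" using y d by (auto simp: s_def)
    have l: "0 \<le> l" "l < 1/2" "l < r / c" using s c by (auto simp: l_def r_def field_simps)
    \<comment> \<open>The point where the ray from \<open>w\<close> through \<open>y\<close> hits
      the hyperplane.\<close>
    define y' where "y' = (y - l *\<^sub>R w) /\<^sub>R (1 - l)"
    have yy: "y = l *\<^sub>R w + (1 - l) *\<^sub>R y'" using l by (simp add: y'_def)
    have lc: "l * c = s" using c by (simp add: l_def)
    have "n \<bullet> (y - l *\<^sub>R w) = (1 - l) * \<beta>"
      using lc by (simp add: inner_diff s_def c_def algebra_simps)
    then have "n \<bullet> y' = \<beta>" using l by (simp add: y'_def)
    then have h: "y' \<in> affine hull F" by (simp add: hull)
    have "(1 - l) *\<^sub>R y' = y - l *\<^sub>R w" using l by (simp add: y'_def)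
    then have "(1 - l) *\<^sub>R (y' - z) = (y - z) - l *\<^sub>R (w - z)"
      by (simp add: scaleR_diff_right scaleR_diff_left)
    moreover have "norm ((1 - l) *\<^sub>R (y' - z)) = norm (y' - z) * (1 - l)"
      using l by simp
    ultimately have "norm (y' - z) * (1 - l) \<le> norm (y - z) + l * D"
      using l norm_triangle_ineq4[of "y - z" "l *\<^sub>R (w - z)"] by (simp add: D_def)
    then have "norm (y' - z) \<le> (norm (y - z) + l * D) / (1 - l)"
      using l by (simp add: pos_le_divide_eq)
    also have "\<dots> \<le> (norm (y - z) + l * D) / (1/2)"
      using l D by (intro divide_left_mono) auto
    also have "\<dots> < 2 * (r * (1 + D / c))"
    proof -
      have "l * D \<le> r / c * D" using l D by (intro mult_right_mono) auto
      then have "norm (y - z) + l * D < r * (1 + D / c)" using d by (simp add: distrib_left)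
      then show ?thesis by simp
    qed
    also have "\<dots> \<le> 2 * (e / (2 * (1 + D / c)) * (1 + D / c))"
      using c D by (intro mult_left_mono mult_right_mono) (auto simp: r_def)
    also have "\<dots> = e"
    proof -
      have "2 * (e / (2 * q) * q) = e" if "q > 0" for q using that by simp
      moreover have "1 + D / c > 0" using c D by (simp add: add_pos_nonneg)
      ultimately show ?thesis by blast
    qed
    finally have "y' \<in> ball z e" by (simp add: dist_norm norm_minus_commute)
    then have "y' \<in> K" using e h F by blast
    then show ?thesis using convexD[OF K w(1), of y' l "1 - l"] l yy by simp
  qed
  then have "ball z r \<inter> {y. n \<bullet> y \<le> \<beta>} \<subseteq> K" by auto
  then show thesis by (rule that[OF r])
qed

lemma facet_half_ball:
  fixes K :: "'a::euclidean_space set"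
  assumes K: "polyhedron K" "interior K \<noteq> {}" and F: "F facet_of K" and z: "z \<in> rel_interior F"
  obtains r where "r > 0" "ball z r \<inter> {y. outer_normal K F \<bullet> y \<le> outer_normal K F \<bullet> z} \<subseteq> K"
proof -
  obtain \<beta> where \<beta>: "norm (outer_normal K F) = 1"
    "F = K \<inter> {z. outer_normal K F \<bullet> z = \<beta>}"
    "affine hull F = {z. outer_normal K F \<bullet> z = \<beta>}"
    "\<And>z. z \<in> interior K \<Longrightarrow> outer_normal K F \<bullet> z < \<beta>"
    using facet_hyperplane[OF K F] by metis
  obtain w where w: "w \<in> interior K" using K by auto
  have "outer_normal K F \<bullet> z = \<beta>" using z rel_interior_subset \<beta>(2) by blast
  moreover obtain r where "r > 0" "ball z r \<inter> {y. outer_normal K F \<bullet> y \<le> \<beta>} \<subseteq> K"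
    using half_ball_subset[OF polyhedron_imp_convex[OF K(1)] facet_of_imp_subset[OF F] \<beta>(1,3) z _ \<beta>(4)[OF w]]
      w interior_subset by blast
  ultimately show thesis using that by simp
qed

text \<open>Equal normals at a common relative interior point give two half balls on the same side,
  and the smaller open one lies in both polyhedra. In a conforming mesh this excludes a second
  element on the same side of a facet.\<close>

lemma same_side_facets_interior_Int:
  fixes K :: "'a::euclidean_space set"
  assumes K: "polyhedron K" "interior K \<noteq> {}" "F facet_of K" "z \<in> rel_interior F"
    and K': "polyhedron K'" "interior K' \<noteq> {}" "F' facet_of K'" "z \<in> rel_interior F'"
    and eq: "outer_normal K F = outer_normal K' F'"
  shows "interior (K \<inter> K') \<noteq> {}"
proof -
  define n where "n = outer_normal K F"
  obtain r where r: "r > 0" "ball z r \<inter> {y. n \<bullet> y \<le> n \<bullet> z} \<subseteq> K"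
    using facet_half_ball[OF K] by (metis n_def)
  obtain r' where r': "r' > 0" "ball z r' \<inter> {y. n \<bullet> y \<le> n \<bullet> z} \<subseteq> K'"
    using facet_half_ball[OF K'] eq by (metis n_def)
  have n: "norm n = 1" using facet_hyperplane[OF K(1-3)] by (metis n_def)
  define s where "s = min r r' / 2"
  have s: "s > 0" "s < r" "s < r'" using r r' by (auto simp: s_def min_def)
  define U where "U = ball z (min r r') \<inter> {y. n \<bullet> y < n \<bullet> z}"
  have "open U" unfolding U_def by (intro open_Int open_ball open_halfspace_lt)
  moreover have "U \<subseteq> K \<inter> K'" using r r' by (force simp: U_def)
  moreover have "z - s *\<^sub>R n \<in> U"
    using s n by (auto simp: U_def dist_norm inner_diff dot_square_norm)
  ultimately show ?thesis by (metis empty_iff interior_maximal subsetD)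
qed

lemma outer_normal_opposite_or_same:
  fixes K :: "'a::euclidean_space set"
  assumes K: "polyhedron K" "interior K \<noteq> {}" "F facet_of K"
    and K': "polyhedron K'" "interior K' \<noteq> {}" "F facet_of K'"
  shows "outer_normal K' F = outer_normal K F \<or> outer_normal K' F = - outer_normal K F"
proof -
  obtain \<beta> where 1: "norm (outer_normal K F) = 1" "affine hull F = {z. outer_normal K F \<bullet> z = \<beta>}"
    using facet_hyperplane[OF K] by metis
  obtain \<gamma> where 2: "norm (outer_normal K' F) = 1" "affine hull F = {z. outer_normal K' F \<bullet> z = \<gamma>}"
    using facet_hyperplane[OF K'] by metis
  show ?thesis
    using hyperplane_subset_imp_parallel[OF 2(1) 1(1), of \<beta> \<gamma>] 1(2) 2(2) by simp
qed

section \<open>Divergence theorem in the time variable\<close>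

lemma negligible_convex_lowdim:
  fixes S :: "'a::euclidean_space set"
  assumes "convex S" "aff_dim S < DIM('a)"
  shows "negligible S"
  using assms aff_dim_nonempty_interior[of S] by (auto simp: negligible_convex_interior)

lemma facets_eq_if_subset:
  assumes "convex K" "F facet_of K" "F' facet_of K" "F \<subseteq> F'"
  shows "F = F'"
proof (rule ccontr)
  assume "F \<noteq> F'"
  moreover have "F face_of F'"
    using assms by (meson face_of_subset facet_of_imp_face_of facet_of_imp_subset)
  moreover have "convex F'" using assms by (meson face_of_imp_convex facet_of_imp_face_of)
  ultimately have "aff_dim F < aff_dim F'" by (intro face_of_aff_dim_lt) auto
  then show False using assms by (simp add: facet_of_def)
qed

lemma aff_dim_facets_Int:
  assumes K: "convex K" "F facet_of K" "F' facet_of K" and ne: "F \<noteq> F'"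
  shows "aff_dim (F \<inter> F') < aff_dim F"
proof (rule face_of_aff_dim_lt)
  show "convex F" using K by (meson face_of_imp_convex facet_of_imp_face_of)
  show "F \<inter> F' face_of F"
    using K by (meson face_of_Int face_of_subset facet_of_imp_face_of facet_of_imp_subset inf_le1)
  show "F \<inter> F' \<noteq> F" using facets_eq_if_subset[OF K] ne by blast
qed

lemma AE_not_negligible: "negligible N \<Longrightarrow> AE x in lborel. x \<notin> N"
  using AE_completion_iff[of "\<lambda>x. x \<notin> N" lborel]
  by (simp add: negligible_iff_null_sets AE_not_in)

text \<open>
  For almost every \<open>x\<close> the line over \<open>x\<close> meets \<open>K\<close> in a segment whose upper end lies on exactly one
  facet, one with \<open>n\<^sub>t > 0\<close>, and whose lower end lies on exactly one facet, one with \<open>n\<^sub>t < 0\<close>.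
\<close>

lemma sum_facets_over_vertical_line:
  fixes K :: "((real^'d) \<times> real) set" and g :: "_ \<Rightarrow> real"
  assumes K: "polytope K" "interior K \<noteq> {}"
    and x: "x \<notin> frontier (fst ` K)"
      "\<And>F F'. F facet_of K \<Longrightarrow> F' facet_of K \<Longrightarrow> F \<noteq> F' \<Longrightarrow> x \<notin> fst ` (F \<inter> F')"
    and \<beta>: "\<And>F. F facet_of K \<Longrightarrow> affine hull F = {z. outer_normal K F \<bullet> z = \<beta> F}"
    and g: "\<And>t. ((\<lambda>s. g (x, s)) has_real_derivative g' (x, t)) (at t)" "continuous_on UNIV (\<lambda>t. g' (x, t))"
  shows "(LINT t|lborel. indicator K (x, t) *\<^sub>R g' (x, t)) =
    (\<Sum>F | F facet_of K. sgn (snd (outer_normal K F)) *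
       (indicator (fst ` F) x *\<^sub>R g (x, (\<beta> F - fst (outer_normal K F) \<bullet> x) / snd (outer_normal K F))))"
proof (cases "x \<in> fst ` K")
  case False
  then have "x \<notin> fst ` F" if "F facet_of K" for F using that facet_of_imp_subset by blast
  moreover have "(x, t) \<notin> K" for t using False by force
  ultimately show ?thesis by simp
next
  case True
  note poly = polytope_imp_polyhedron[OF K(1)]
  note conv = polytope_imp_convex[OF K(1)]
  \<comment> \<open>\<open>\<beta>\<close> is specified only through affine hulls; evaluating at a
    point of \<open>F\<close> shows that it is the offset of the supporting hyperplane.\<close>
  have fp: "norm (outer_normal K F) = 1 \<and> (\<forall>z \<in> K. outer_normal K F \<bullet> z \<le> \<beta> F) \<and>
      F = K \<inter> {z. outer_normal K F \<bullet> z = \<beta> F} \<and> (\<forall>z \<in> interior K. outer_normal K F \<bullet> z < \<beta> F)"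
    if F: "F facet_of K" for F
  proof -
    obtain \<gamma> where \<gamma>: "norm (outer_normal K F) = 1"
      "\<And>z. z \<in> K \<Longrightarrow> outer_normal K F \<bullet> z \<le> \<gamma>"
      "F = K \<inter> {z. outer_normal K F \<bullet> z = \<gamma>}"
      "affine hull F = {z. outer_normal K F \<bullet> z = \<gamma>}"
      "\<And>z. z \<in> interior K \<Longrightarrow> outer_normal K F \<bullet> z < \<gamma>"
      using facet_hyperplane[OF poly K(2) F] by metis
    obtain y where "y \<in> F" using F by (auto simp: facet_of_def)
    then have y: "y \<in> affine hull F" by (rule hull_inc)
    have "outer_normal K F \<bullet> y = \<beta> F" using y unfolding \<beta>[OF F] by simp
    moreover have "outer_normal K F \<bullet> y = \<gamma>" using y unfolding \<gamma>(4) by simp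
    ultimately have "\<gamma> = \<beta> F" by simp
    then show ?thesis using \<gamma> by auto
  qed
  have int_img: "fst ` interior K = interior (fst ` K)"
    using rel_interior_convex_linear_image[OF linear_fst conv] K(2)
    by (metis (no_types, lifting) image_is_empty interior_rel_interior_gen interior_maximal
        interior_subset image_mono open_image_fst open_interior rel_interior_interior
        rel_interior_nonempty_interior subset_empty)
  have "x \<in> interior (fst ` K)"
    using x(1) True subsetD[OF closure_subset, of x "fst ` K"] by (auto simp only: frontier_def)
  \<comment> \<open>Since \<open>x\<close> is off the frontier of the projection, the line over it
    passes through the interior of \<open>K\<close>. The point at \<open>t0\<close> lies strictly
    inside every facet hyperplane, which later decides which end a facet can contain.\<close>
  then obtain t0 where t0: "(x, t0) \<in> interior K" unfolding int_img[symmetric] by auto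
  define S where "S = {t. (x, t) \<in> K}"
  have "compact S"
  proof -
    have "S = snd ` (K \<inter> {x} \<times> UNIV)" by (force simp: S_def)
    moreover have "compact (K \<inter> {x} \<times> UNIV)"
      using polytope_imp_compact[OF K(1)] by (intro compact_Int_closed closed_Times) auto
    ultimately show ?thesis by (simp add: compact_continuous_image continuous_on_snd continuous_on_id)
  qed
  moreover have "convex S"
    unfolding S_def convex_def
  proof (intro ballI allI impI, clarify)
    fix s t u v assume "(x, s) \<in> K" "(x, t) \<in> K" "0 \<le> u" "0 \<le> v" "u + v = (1::real)"
    then have "u *\<^sub>R (x, s) + v *\<^sub>R (x, t) \<in> K" using conv by (intro convexD) auto
    then show "(x, u *\<^sub>R s + v *\<^sub>R t) \<in> K"
      using \<open>u + v = 1\<close> by (simp add: scaleR_add_left[symmetric])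
  qed
  ultimately obtain a b where ab: "S = {a..b}"
    by (metis convex_connected connected_compact_interval_1)
  have S: "(x, t) \<in> K \<longleftrightarrow> a \<le> t \<and> t \<le> b" for t using ab by (auto simp: S_def)
  obtain e where e: "e > 0" "cball (x, t0) e \<subseteq> K"
    using t0 by (meson mem_interior_cball)
  have "(x, t0 + e) \<in> K" "(x, t0 - e) \<in> K"
    using e by (auto intro!: subsetD[OF e(2)] simp: dist_Pair_Pair dist_norm)
  then have lt: "a < t0" "t0 < b" using S e(1) by auto
  have end_unique: "\<exists>G. G facet_of K \<and> {F. F facet_of K \<and> (x, s) \<in> F} = {G}" if s: "s = a \<or> s = b" for s
  proof -
    have "(x, s) \<notin> interior K"
    proof
      assume "(x, s) \<in> interior K"
      then obtain e' where e': "e' > 0" "cball (x, s) e' \<subseteq> K"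
        by (meson mem_interior_cball)
      have "(x, s + e') \<in> K" "(x, s - e') \<in> K"
        using e' by (auto intro!: subsetD[OF e'(2)] simp: dist_Pair_Pair dist_norm)
      then show False using S e'(1) s by auto
    qed
    moreover have "(x, s) \<in> K" unfolding S using s lt by linarith
    moreover have "(x, s) \<in> closure K"
      using calculation(2) by (rule subsetD[OF closure_subset])
    ultimately have "(x, s) \<in> rel_frontier K"
      using K(2) by (simp add: rel_frontier_nonempty_interior frontier_def)
    then obtain G where G: "G facet_of K" "(x, s) \<in> G"
      unfolding rel_frontier_of_polyhedron[OF poly] by auto
    have "F = G" if "F facet_of K" "(x, s) \<in> F" for F
      using x(2)[OF that(1) G(1)] that(2) G(2) by (force simp: image_iff)
    then show ?thesis using G by blast
  qed
  \<comment> \<open>For a vertical facet the quotient is a division by zero, but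
    \<open>sgn 0 = 0\<close> removes the term; on the right the line misses the facet, as its normal
    functional is constant along the line and strictly smaller at \<open>t0\<close>.\<close>
  have term_eq: "sgn (snd (outer_normal K F)) *
       (indicator (fst ` F) x *\<^sub>R g (x, (\<beta> F - fst (outer_normal K F) \<bullet> x) / snd (outer_normal K F)))
     = (if (x, b) \<in> F then g (x, b) else 0) - (if (x, a) \<in> F then g (x, a) else 0)" (is "?l = ?r")
    if F: "F facet_of K" for F
  proof -
    define n where "n = outer_normal K F"
    have ip: "n \<bullet> (x, t) = fst n \<bullet> x + snd n * t" for t by (cases n) simp
    note fp' = fp[OF F, folded n_def]
    have le: "fst n \<bullet> x + snd n * t \<le> \<beta> F" if "(x, t) \<in> K" for t
      unfolding ip[symmetric] using fp' that by blast
    have eq: "fst n \<bullet> x + snd n * t = \<beta> F" if "(x, t) \<in> F" for t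
      unfolding ip[symmetric] using fp' that by blast
    have lt0: "fst n \<bullet> x + snd n * t0 < \<beta> F"
      unfolding ip[symmetric] using fp' t0 by blast
    have FK: "(x, t) \<in> K" if "(x, t) \<in> F" for t using that F facet_of_imp_subset by blast
    consider (pos) "snd n > 0" | (neg) "snd n < 0" | (zero) "snd n = 0" by linarith
    then show ?thesis
    proof cases
      case pos
      have other: "(x, a) \<notin> F"
      proof
        assume "(x, a) \<in> F"
        from eq[OF this] lt0 have "snd n * t0 < snd n * a" by simp
        then show False using pos lt by simp
      qed
      have tb: "t = b" if "(x, t) \<in> F" for t
      proof -
        have "snd n * b \<le> snd n * t" using eq[OF that] le[of b] S lt by simp
        then show ?thesis using pos FK[OF that] S by auto
      qed
      have tau: "(\<beta> F - fst n \<bullet> x) / snd n = b" if "(x, b) \<in> F"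
        using eq[OF that] pos by (simp add: field_simps)
      have img: "x \<in> fst ` F \<longleftrightarrow> (x, b) \<in> F" using tb by force
      show ?thesis using other tau img pos unfolding n_def[symmetric]
        by (cases "(x, b) \<in> F") simp_all
    next
      case neg
      have other: "(x, b) \<notin> F"
      proof
        assume "(x, b) \<in> F"
        from eq[OF this] lt0 have "snd n * t0 < snd n * b" by simp
        then show False using neg lt by simp
      qed
      have ta: "t = a" if "(x, t) \<in> F" for t
      proof -
        have "snd n * a \<le> snd n * t" using eq[OF that] le[of a] S lt by simp
        then show ?thesis using neg FK[OF that] S by auto
      qed
      have tau: "(\<beta> F - fst n \<bullet> x) / snd n = a" if "(x, a) \<in> F"
        using eq[OF that] neg by (simp add: field_simps)
      have img: "x \<in> fst ` F \<longleftrightarrow> (x, a) \<in> F" using ta by force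
      show ?thesis using other tau img neg unfolding n_def[symmetric]
        by (cases "(x, a) \<in> F") simp_all
    next
      case zero
      then have "(x, t) \<notin> F" for t using eq[of t] lt0 by auto
      then show ?thesis using zero by (simp add: n_def[symmetric])
    qed
  qed
  have fin: "finite {F. F facet_of K}" using K(1) by (rule finite_polytope_facets)
  have sum_end: "(\<Sum>F | F facet_of K. if (x, s) \<in> F then g (x, s) else 0) = g (x, s)" if s: "s = a \<or> s = b" for s
  proof -
    obtain G where G: "{F. F facet_of K \<and> (x, s) \<in> F} = {G}" using end_unique[OF s] by blast
    have "(\<Sum>F | F facet_of K. if (x, s) \<in> F then g (x, s) else 0) = (\<Sum>F | F facet_of K \<and> (x, s) \<in> F. g (x, s))"
      using fin by (subst sum.inter_filter[symmetric]) auto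
    then show ?thesis by (simp add: G)
  qed
  have "(LINT t|lborel. indicator K (x, t) *\<^sub>R g' (x, t)) = (LINT t|lborel. indicator {a..b} t *\<^sub>R g' (x, t))"
    by (rule Bochner_Integration.integral_cong) (auto simp: S indicator_def)
  also have "\<dots> = g (x, b) - g (x, a)"
  proof (rule integral_FTC_atLeastAtMost)
    show "a \<le> b" using lt by simp
    show "((\<lambda>t. g (x, t)) has_vector_derivative g' (x, t)) (at t within {a..b})" for t
      using g(1)[of t] has_real_derivative_iff_has_vector_derivative has_vector_derivative_at_within by blast
    show "continuous_on {a..b} (\<lambda>t. g' (x, t))" using g(2) continuous_on_subset by blast
  qed
  also have "\<dots> = (\<Sum>F | F facet_of K. (if (x, b) \<in> F then g (x, b) else 0) - (if (x, a) \<in> F then g (x, a) else 0))"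
    by (simp add: sum_subtractf sum_end)
  also have "\<dots> = (\<Sum>F | F facet_of K. sgn (snd (outer_normal K F)) *
       (indicator (fst ` F) x *\<^sub>R g (x, (\<beta> F - fst (outer_normal K F) \<bullet> x) / snd (outer_normal K F))))"
    by (rule sum.cong[OF refl]) (use term_eq in simp)
  finally show ?thesis .
qed

text \<open>This is the divergence theorem for the field \<open>(0, g)\<close>. The fundamental
  theorem of calculus on vertical segments yields the sign of \<open>n\<^sub>t\<close>, and the
  projection formula for facets supplies its absolute value.\<close>

theorem divergence_theorem_time:
  fixes K :: "((real^'d) \<times> real) set" and g :: "_ \<Rightarrow> real"
  assumes K: "polytope K" "interior K \<noteq> {}"
    and g: "\<And>x t. ((\<lambda>s. g (x, s)) has_real_derivative g' (x, t)) (at t)"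
    and cont: "continuous_on UNIV g" "continuous_on UNIV g'"
  shows "(LINT z:K|lebesgue. g' z) =
    (\<Sum>F | F facet_of K. snd (outer_normal K F) * (LINT z:F|flat_measure F. g z))"
proof -
  note poly = polytope_imp_polyhedron[OF K(1)]
  note conv = polytope_imp_convex[OF K(1)]
  have cK: "compact K" by (rule polytope_imp_compact[OF K(1)])
  have fin: "finite {F. F facet_of K}" using K(1) by (rule finite_polytope_facets)
  have dimK: "aff_dim K = DIM((real^'d) \<times> real)" using K(2) by (rule aff_dim_nonempty_interior)
  have dimF: "aff_dim F = CARD('d)" if "F facet_of K" for F
    using that dimK by (simp add: facet_of_def)
  have cF: "compact F" if "F facet_of K" for F
    using that cK conv by (meson face_of_imp_compact facet_of_imp_face_of)
  have "\<forall>F. \<exists>\<beta>. F facet_of K \<longrightarrow> affine hull F = {z. outer_normal K F \<bullet> z = \<beta>} \<and> norm (outer_normal K F) = 1"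
    using facet_hyperplane[OF poly K(2)] by metis
  then obtain \<beta> where \<beta>: "\<And>F. F facet_of K \<Longrightarrow> affine hull F = {z. outer_normal K F \<bullet> z = \<beta> F}"
      "\<And>F. F facet_of K \<Longrightarrow> norm (outer_normal K F) = 1"
    by metis
  define h where "h = (\<lambda>F x. indicator (fst ` F) x *\<^sub>R
      g (x, (\<beta> F - fst (outer_normal K F) \<bullet> x) / snd (outer_normal K F)))"
  have inth: "integrable lborel (\<lambda>x. sgn (snd (outer_normal K F)) * h F x)" if "F facet_of K" for F
  \<comment> \<open>On a vertical facet the integrand is zero because of the factor
    \<open>sgn\<close>; elsewhere the facet is a continuous graph over its compact
    projection.\<close>
  proof (cases "snd (outer_normal K F) = 0")
    case False
    have "integrable lborel (h F)"
      unfolding h_def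
    proof (rule borel_integrable_compact)
      show "compact (fst ` F)" using cF[OF that] by (intro compact_continuous_image continuous_intros)
      show "continuous_on (fst ` F) (\<lambda>x. g (x, (\<beta> F - fst (outer_normal K F) \<bullet> x) / snd (outer_normal K F)))"
        by (rule continuous_on_compose2[OF cont(1)]) (use False in \<open>auto intro!: continuous_intros\<close>)
    qed
    then show ?thesis by simp
  qed simp
  have fubini: "integrable (lborel \<Otimes>\<^sub>M lborel) (\<lambda>z. indicator K z *\<^sub>R g' z)"
    unfolding lborel_prod
    by (rule borel_integrable_compact[OF cK continuous_on_subset[OF cont(2)]]) simp
  have "(LINT z:K|lebesgue. g' z) = (LINT z|(lborel \<Otimes>\<^sub>M lborel). indicator K z *\<^sub>R g' z)"
    unfolding lborel_prod set_lebesgue_integral_def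
    by (rule integral_completion)
      (use borel_measurable_indicator_continuous[OF compact_imp_closed[OF cK] continuous_on_subset[OF cont(2)]] in simp)
  also have "\<dots> = (LINT x|lborel. LINT t|lborel. indicator K (x, t) *\<^sub>R g' (x, t))"
    by (rule lborel_pair.integral_fst'[OF fubini, symmetric])
  also have "\<dots> = (LINT x|lborel. (\<Sum>F | F facet_of K. sgn (snd (outer_normal K F)) * h F x))"
  proof (rule integral_cong_AE)
    show "(\<lambda>x. LINT t|lborel. indicator K (x, t) *\<^sub>R g' (x, t)) \<in> borel_measurable lborel"
      using lborel_pair.integrable_fst'[OF fubini] by (rule borel_measurable_integrable)
    show "(\<lambda>x. \<Sum>F | F facet_of K. sgn (snd (outer_normal K F)) * h F x) \<in> borel_measurable lborel"
      by (intro borel_measurable_sum borel_measurable_integrable inth) auto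
    have "AE x in lborel. x \<notin> frontier (fst ` K)"
      by (intro AE_not_negligible negligible_convex_frontier convex_linear_image linear_fst conv)
    moreover have "AE x in lborel. \<forall>F\<in>{F. F facet_of K}. \<forall>F'\<in>{F. F facet_of K}. F \<noteq> F' \<longrightarrow> x \<notin> fst ` (F \<inter> F')"
    proof (intro AE_finite_allI fin)
      fix F F' assume "F \<in> {F. F facet_of K}" "F' \<in> {F. F facet_of K}"
      then have F: "F facet_of K" "F' facet_of K" by auto
      \<comment> \<open>Two facets meet in dimension at most \<open>d - 1\<close>, and projecting to
        the \<open>d\<close>-dimensional space does not raise dimension.\<close>
      have "negligible (fst ` (F \<inter> F'))" if "F \<noteq> F'"
      proof (rule negligible_convex_lowdim)
        show "convex (fst ` (F \<inter> F'))"
          using F conv by (intro convex_linear_image linear_fst convex_Int)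
            (auto intro: face_of_imp_convex facet_of_imp_face_of)
        show "aff_dim (fst ` (F \<inter> F')) < int DIM(real^'d)"
          using aff_dim_facets_Int[OF conv F that] dimF[OF F(1)]
            aff_dim_linear_image_le[OF linear_fst, of "F \<inter> F'"] by simp
      qed
      then show "AE x in lborel. F \<noteq> F' \<longrightarrow> x \<notin> fst ` (F \<inter> F')"
        using AE_not_negligible by (cases "F = F'") auto
    qed
    ultimately show "AE x in lborel. (LINT t|lborel. indicator K (x, t) *\<^sub>R g' (x, t)) =
        (\<Sum>F | F facet_of K. sgn (snd (outer_normal K F)) * h F x)"
    proof eventually_elim
      case (elim x)
      have "continuous_on UNIV (\<lambda>t. g' (x, t))"
        by (rule continuous_on_compose2[OF cont(2)]) (auto intro!: continuous_intros)
      then show ?case unfolding h_def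
        by (intro sum_facets_over_vertical_line[OF K _ _ \<beta>(1) g]) (use elim in auto)
    qed
  qed
  also have "\<dots> = (\<Sum>F | F facet_of K. (LINT x|lborel. sgn (snd (outer_normal K F)) * h F x))"
    by (rule Bochner_Integration.integral_sum) (use inth in auto)
  also have "\<dots> = (\<Sum>F | F facet_of K. snd (outer_normal K F) * (LINT z:F|flat_measure F. g z))"
  proof (rule sum.cong[OF refl])
    fix F assume "F \<in> {F. F facet_of K}"
    then have F: "F facet_of K" by simp
    show "(LINT x|lborel. sgn (snd (outer_normal K F)) * h F x) = snd (outer_normal K F) * (LINT z:F|flat_measure F. g z)"
    proof (cases "snd (outer_normal K F) = 0")
      case False
      have "(LINT x|lborel. h F x) = \<bar>snd (outer_normal K F)\<bar> * (LINT z:F|flat_measure F. g z)"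
        using flat_measure_projection[OF dimF[OF F] \<beta>(1)[OF F] \<beta>(2)[OF F] False cF[OF F]
            continuous_on_subset[OF cont(1)]]
        by (simp add: h_def set_lebesgue_integral_def)
      then show ?thesis by (simp add: mult.assoc[symmetric] sgn_mult_abs)
    qed simp
  qed
  finally show ?thesis .
qed

section \<open>Meshes\<close>

text \<open>A domain that is locally an epigraph has no slits. The mesh is tied to \<open>Q\<close>
  only through its closure, so this is what places the interiors of the elements inside
  \<open>Q\<close>.\<close>

lemma interior_closure_lipschitz_domain:
  fixes Q :: "'a::euclidean_space set"
  assumes Q: "bounded_lipschitz_domain Q"
  shows "interior (closure Q) = Q"
proof
  have "open Q" using Q by (simp add: bounded_lipschitz_domain_def)
  then show "Q \<subseteq> interior (closure Q)" by (simp add: interior_maximal closure_subset)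
  show "interior (closure Q) \<subseteq> Q"
  proof (rule subsetI, rule ccontr)
    fix z assume z: "z \<in> interior (closure Q)" "z \<notin> Q"
    then have "z \<in> frontier Q" using \<open>open Q\<close> interior_subset by (auto simp: frontier_def interior_open)
    then obtain e r L g where e: "norm e = 1" "0 < r" and g: "L-lipschitz_on {w. w \<bullet> e = 0} g"
      and epi: "\<And>y. y \<in> ball z r \<Longrightarrow> y \<in> Q \<longleftrightarrow> g (y - (y \<bullet> e) *\<^sub>R e) < y \<bullet> e"
      using Q unfolding bounded_lipschitz_domain_def by meson
    define G where "G = (\<lambda>y. g (y - (y \<bullet> e) *\<^sub>R e) - y \<bullet> e)"
    have ee: "e \<bullet> e = 1" using e by (simp add: dot_square_norm)
    have "continuous_on UNIV (\<lambda>y. g (y - (y \<bullet> e) *\<^sub>R e))"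
      by (rule continuous_on_compose2[OF lipschitz_on_continuous_on[OF g]])
        (auto intro!: continuous_intros simp: inner_diff_left ee)
    then have G: "continuous_on UNIV G" unfolding G_def by (intro continuous_intros)
    obtain d where d: "d > 0" "ball z d \<subseteq> closure Q" using z(1) by (auto simp: mem_interior)
    define s where "s = min d r / 2"
    \<comment> \<open>Moving from \<open>z\<close> against \<open>e\<close> goes strictly below the
      graph, so a whole neighbourhood of \<open>y\<close> misses \<open>Q\<close>, although
      \<open>y\<close> still lies in its closure.\<close>
    define y where "y = z - s *\<^sub>R e"
    have s: "s > 0" "s < d" "s < r" using d e by (auto simp: s_def min_def)
    have dy: "dist z y = s" using s e by (simp add: y_def dist_norm)
    have "G z \<ge> 0" using epi[of z] z e by (simp add: G_def)
    moreover have yP: "y - (y \<bullet> e) *\<^sub>R e = z - (z \<bullet> e) *\<^sub>R e"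
      by (simp add: y_def inner_diff_left ee algebra_simps)
    moreover have ye: "y \<bullet> e = z \<bullet> e - s" by (simp add: y_def inner_diff_left ee)
    moreover have "G y = G z + s" unfolding G_def yP by (simp add: ye)
    ultimately have Gy: "G y > 0" using s by simp
    define U where "U = ball z r \<inter> G -` {0<..}"
    have "open U" unfolding U_def
      by (intro open_Int open_ball open_vimage G open_greaterThan)
    moreover have "y \<in> U" using Gy dy s by (simp add: U_def)
    moreover have "U \<inter> Q = {}" using epi by (auto simp: U_def G_def)
    moreover have "y \<in> closure Q" using d dy s by auto
    ultimately show False using open_Int_closure_eq_empty by blast
  qed
qed

text \<open>Measurability of \<open>g\<close> comes from completeness of Lebesgue measure. This
  suits the derivatives of \<open>v\<close>, whose values on the element boundaries are not
  controlled.\<close>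

lemma lebesgue_integral_spike:
  fixes f g :: "'a::euclidean_space \<Rightarrow> real"
  assumes f: "integrable lebesgue f" and N: "negligible N" and eq: "\<And>x. x \<notin> N \<Longrightarrow> g x = f x"
  shows "integrable lebesgue g" and "integral\<^sup>L lebesgue g = integral\<^sup>L lebesgue f"
proof -
  have "f absolutely_integrable_on UNIV" using f by (simp add: set_integrable_def)
  then have "g absolutely_integrable_on UNIV"
    by (rule absolutely_integrable_spike[OF _ N]) (use eq in auto)
  then show g: "integrable lebesgue g" by (simp add: set_integrable_def)
  have "AE x in lebesgue. x \<notin> N"
    using N by (simp add: negligible_iff_null_sets AE_not_in)
  then show "integral\<^sup>L lebesgue g = integral\<^sup>L lebesgue f"
    using f g eq by (intro integral_cong_AE) auto
qed

section \<open>Elements and faces of a conforming mesh\<close>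

context
  fixes Q :: "'a::euclidean_space set" and \<K> :: "'a set set"
  assumes mesh: "mesh_of Q \<K>"
begin

lemma mesh_finite: "finite \<K>"
  using mesh by (simp add: mesh_of_def triangulation_def)

lemma mesh_Union: "\<Union>\<K> = closure Q"
  using mesh by (simp add: mesh_of_def)

lemma mesh_aff_dim: "K \<in> \<K> \<Longrightarrow> aff_dim K = DIM('a)"
  using mesh aff_dim_simplex by (auto simp: mesh_of_def)

lemma mesh_polytope: "K \<in> \<K> \<Longrightarrow> polytope K"
  using mesh simplex_imp_polytope by (auto simp: mesh_of_def)

lemma mesh_polyhedron: "K \<in> \<K> \<Longrightarrow> polyhedron K"
  by (simp add: mesh_polytope polytope_imp_polyhedron)

lemma mesh_convex: "K \<in> \<K> \<Longrightarrow> convex K"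
  by (simp add: mesh_polytope polytope_imp_convex)

lemma mesh_compact: "K \<in> \<K> \<Longrightarrow> compact K"
  by (simp add: mesh_polytope polytope_imp_compact)

lemma mesh_closed: "K \<in> \<K> \<Longrightarrow> closed K"
  by (simp add: mesh_compact compact_imp_closed)

lemma mesh_interior: "K \<in> \<K> \<Longrightarrow> interior K \<noteq> {}"
  by (metis aff_dim_eq_full_gen mesh_aff_dim mesh_convex interior_rel_interior_gen rel_interior_eq_empty
      aff_dim_empty_eq aff_dim_negative_iff le_minus_one_simps(3) of_nat_0_le_iff order_less_le_trans not_less)

lemma mesh_closure_interior: "K \<in> \<K> \<Longrightarrow> closure (interior K) = K"
  by (simp add: convex_closure_interior mesh_convex mesh_interior mesh_closed)

lemma mesh_subset_closure: "K \<in> \<K> \<Longrightarrow> K \<subseteq> closure Q"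
  using mesh_Union by blast

lemma mesh_Int_face: "K \<in> \<K> \<Longrightarrow> K' \<in> \<K> \<Longrightarrow> K \<inter> K' face_of K"
  using mesh by (simp add: mesh_of_def triangulation_def)

text \<open>By conformity the intersection is a face of both elements, and a proper face contains no
  interior point of the element.\<close>

lemma mesh_eq_if_overlap:
  assumes K: "K \<in> \<K>" "K' \<in> \<K>" and i: "interior (K \<inter> K') \<noteq> {}"
  shows "K = K'"
proof -
  have sub: "A \<subseteq> B" if AB: "A \<in> \<K>" "B \<in> \<K>" "interior (A \<inter> B) \<noteq> {}" for A B
  proof -
    have "A \<inter> B = A"
      using face_of_disjoint_interior[OF mesh_Int_face[OF AB(1,2)]] AB(3) interior_subset interior_mono
      by (metis disjoint_iff_not_equal ex_in_conv inf_le1 subsetD)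
    then show ?thesis by blast
  qed
  show ?thesis using sub[of K K'] sub[of K' K] K i by (simp add: Int_commute subset_antisym)
qed

lemma mesh_facet_aff_dim: "K \<in> \<K> \<Longrightarrow> F facet_of K \<Longrightarrow> aff_dim F = int DIM('a) - 1"
  by (simp add: facet_of_def mesh_aff_dim)

lemma mesh_facet_convex: "K \<in> \<K> \<Longrightarrow> F facet_of K \<Longrightarrow> convex F"
  by (meson face_of_imp_convex facet_of_imp_face_of mesh_convex)

lemma mesh_facet_compact: "K \<in> \<K> \<Longrightarrow> F facet_of K \<Longrightarrow> compact F"
  by (meson face_of_imp_compact facet_of_imp_face_of mesh_convex mesh_compact)

lemma mesh_facet_rel_interior: "K \<in> \<K> \<Longrightarrow> F facet_of K \<Longrightarrow> rel_interior F \<noteq> {}"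
  using mesh_facet_convex rel_interior_eq_empty by (auto simp: facet_of_def)

lemma mesh_finite_facets: "K \<in> \<K> \<Longrightarrow> finite {F. F facet_of K}"
  by (simp add: mesh_polytope finite_polytope_facets)

text \<open>Elements on the same side overlap and hence agree; then \<open>F'\<close> is a face that
  meets the relative interior of \<open>F\<close> and must contain it. Besides shared facets, this
  also covers distinct facets in the top plane, where all normals agree.\<close>

lemma mesh_same_normal_imp_eq:
  assumes K: "K \<in> \<K>" "F facet_of K" "z \<in> rel_interior F"
    and K': "K' \<in> \<K>" "F' facet_of K'" "z \<in> rel_interior F'"
    and eq: "outer_normal K F = outer_normal K' F'"
  shows "K = K'" "F = F'"
proof -
  show KK: "K = K'"
    using same_side_facets_interior_Int[OF mesh_polyhedron[OF K(1)] mesh_interior[OF K(1)] K(2,3)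
        mesh_polyhedron[OF K'(1)] mesh_interior[OF K'(1)] K'(2,3) eq]
    by (rule mesh_eq_if_overlap[OF K(1) K'(1)])
  have "F \<subseteq> F'"
    using K K' KK by (intro subset_of_face_of[of F' K]) (auto simp: facet_of_imp_face_of facet_of_imp_subset
        dest: subsetD[OF rel_interior_subset])
  then show "F = F'" using facets_eq_if_subset[of K F F'] K K' KK mesh_convex by blast
qed

section \<open>Interior facets and boundary facets\<close>

lemma finite_interior_facets: "finite (interior_facets \<K>)"
proof (rule finite_subset)
  show "interior_facets \<K> \<subseteq> (\<lambda>(K, K'). K \<inter> K') ` (\<K> \<times> \<K>)"
    by (auto simp: interior_facets_def)
qed (simp add: mesh_finite)

text \<open>The pair chosen by \<open>facet_elems\<close> need not be the one that witnesses
  \<open>interior_facets\<close>, and its description does not mention facets. Conformity makes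
  \<open>F\<close> a face of the chosen elements, and its dimension makes it a facet.\<close>

lemma interior_facet_elems:
  assumes F: "F \<in> interior_facets \<K>"
  shows "elem_i \<K> F \<in> \<K>" "elem_j \<K> F \<in> \<K>" "elem_i \<K> F \<noteq> elem_j \<K> F"
    "F facet_of elem_i \<K> F" "F facet_of elem_j \<K> F"
proof -
  obtain A B where AB: "A \<in> \<K>" "B \<in> \<K>" "A \<noteq> B" "F = A \<inter> B"
    using F by (auto simp: interior_facets_def)
  have *: "(\<lambda>(K, K'). K \<in> \<K> \<and> K' \<in> \<K> \<and> K \<noteq> K' \<and> F = K \<inter> K') (facet_elems \<K> F)"
    unfolding facet_elems_def by (rule someI[where x = "(A, B)"]) (use AB in simp)
  then show K: "elem_i \<K> F \<in> \<K>" "elem_j \<K> F \<in> \<K>" "elem_i \<K> F \<noteq> elem_j \<K> F"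
    by (auto simp: elem_i_def elem_j_def split: prod.splits)
  have FK: "F = elem_i \<K> F \<inter> elem_j \<K> F"
    using * by (auto simp: elem_i_def elem_j_def split: prod.splits)
  obtain A where A: "A \<in> \<K>" "F facet_of A" using F by (auto simp: interior_facets_def)
  have d: "F \<noteq> {}" "aff_dim F = int DIM('a) - 1"
    using A mesh_facet_aff_dim by (auto simp: facet_of_def)
  show "F facet_of elem_i \<K> F"
    using mesh_Int_face[OF K(1,2)] FK d mesh_aff_dim[OF K(1)] by (simp add: facet_of_def)
  show "F facet_of elem_j \<K> F"
    using mesh_Int_face[OF K(2,1)] FK d mesh_aff_dim[OF K(2)] by (simp add: facet_of_def Int_commute)
qed

text \<open>Equal normals would put both elements on the same side. This confirms that
  \<open>normal_j\<close> is the outer normal of the second element.\<close>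

lemma mesh_shared_facet_normal:
  assumes "K \<in> \<K>" "K' \<in> \<K>" "K \<noteq> K'" "F facet_of K" "F facet_of K'"
  shows "outer_normal K' F = - outer_normal K F"
  using outer_normal_opposite_or_same[of K F K'] mesh_same_normal_imp_eq(1)[of K F _ K' F] assms
    mesh_polyhedron mesh_interior mesh_facet_rel_interior by (metis ex_in_conv)

text \<open>A third element would have a normal opposite to that of \<open>elem_i\<close>, thus
  equal to that of \<open>elem_j\<close>, and would coincide with the latter.\<close>

lemma interior_facet_only_elems:
  assumes F: "F \<in> interior_facets \<K>" and K: "K \<in> \<K>" "F facet_of K"
  shows "K = elem_i \<K> F \<or> K = elem_j \<K> F"
proof (rule ccontr)
  note e = interior_facet_elems[OF F]
  assume *: "\<not> (K = elem_i \<K> F \<or> K = elem_j \<K> F)"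
  obtain z where z: "z \<in> rel_interior F" using mesh_facet_rel_interior[OF K] by blast
  have "outer_normal K F = - outer_normal (elem_i \<K> F) F"
    using mesh_shared_facet_normal[of "elem_i \<K> F" K F] e K * by blast
  also have "\<dots> = outer_normal (elem_j \<K> F) F"
    using mesh_shared_facet_normal[of "elem_i \<K> F" "elem_j \<K> F" F] e by simp
  finally show False using mesh_same_normal_imp_eq(1)[OF K z e(2,5) z] * by blast
qed


text \<open>Double counting: exchanging the sums, every interior facet is met exactly twice, so its
  two fluxes can be compared. Boundary facets stay grouped by element, as the inverse inequality
  requires.\<close>

lemma sum_elements_facets:
  fixes G :: "'a set \<Rightarrow> 'a set \<Rightarrow> real"
  shows "(\<Sum>K\<in>\<K>. \<Sum>F | F facet_of K. G K F) =
    (\<Sum>F\<in>interior_facets \<K>. G (elem_i \<K> F) F + G (elem_j \<K> F) F) +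
    (\<Sum>K\<in>\<K>. \<Sum>F | F facet_of K \<and> F \<notin> interior_facets \<K>. G K F)"
proof -
  have "(\<Sum>K\<in>\<K>. \<Sum>F | F facet_of K. G K F) =
    (\<Sum>K\<in>\<K>. (\<Sum>F | F facet_of K \<and> F \<in> interior_facets \<K>. G K F)
           + (\<Sum>F | F facet_of K \<and> F \<notin> interior_facets \<K>. G K F))"
  proof (rule sum.cong[OF refl])
    fix K assume "K \<in> \<K>"
    then show "(\<Sum>F | F facet_of K. G K F) = (\<Sum>F | F facet_of K \<and> F \<in> interior_facets \<K>. G K F)
           + (\<Sum>F | F facet_of K \<and> F \<notin> interior_facets \<K>. G K F)"
      using mesh_finite_facets by (subst sum.union_disjoint[symmetric]) (auto intro!: sum.cong)
  qed
  also have "\<dots> = (\<Sum>K\<in>\<K>. \<Sum>F | F facet_of K \<and> F \<in> interior_facets \<K>. G K F)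
      + (\<Sum>K\<in>\<K>. \<Sum>F | F facet_of K \<and> F \<notin> interior_facets \<K>. G K F)"
    by (rule sum.distrib)
  also have "(\<Sum>K\<in>\<K>. \<Sum>F | F facet_of K \<and> F \<in> interior_facets \<K>. G K F) =
      (\<Sum>K\<in>\<K>. \<Sum>F | F \<in> interior_facets \<K> \<and> F facet_of K. G K F)"
    by (simp add: conj_commute)
  also have "\<dots> = (\<Sum>F\<in>interior_facets \<K>. \<Sum>K | K \<in> \<K> \<and> F facet_of K. G K F)"
    by (rule sum.swap_restrict[OF mesh_finite finite_interior_facets])
  also have "\<dots> = (\<Sum>F\<in>interior_facets \<K>. G (elem_i \<K> F) F + G (elem_j \<K> F) F)"
  proof (rule sum.cong[OF refl])
    fix F assume F: "F \<in> interior_facets \<K>"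
    have "{K. K \<in> \<K> \<and> F facet_of K} = {elem_i \<K> F, elem_j \<K> F}"
      using interior_facet_elems[OF F] interior_facet_only_elems[OF F] by auto
    then show "(\<Sum>K | K \<in> \<K> \<and> F facet_of K. G K F) = G (elem_i \<K> F) F + G (elem_j \<K> F) F"
      using interior_facet_elems(3)[OF F] by simp
  qed
  finally show ?thesis .
qed

text \<open>
  If a relative interior point of the facet had a neighbourhood covered by the mesh, then, the points
  beyond the facet being outside \<open>K\<close>, it would lie in a second element by closedness.
\<close>

lemma boundary_facet_subset_frontier:
  assumes Q: "open Q" and K: "K \<in> \<K>" "F facet_of K" and F: "F \<notin> interior_facets \<K>"
  shows "F \<subseteq> frontier Q"
proof -
  have "rel_interior F \<subseteq> frontier Q"
  proof (rule subsetI, rule ccontr)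
    fix z assume z: "z \<in> rel_interior F" "z \<notin> frontier Q"
    define n where "n = outer_normal K F"
    have zF: "z \<in> F" using z rel_interior_subset by blast
    then have zK: "z \<in> K" using K facet_of_imp_subset by blast
    then have "z \<in> Q"
      using z(2) Q mesh_subset_closure[OF K(1)] by (auto simp: frontier_def interior_open)
    then obtain r where r: "r > 0" "ball z r \<subseteq> Q" using Q open_contains_ball by blast
    obtain \<beta> where \<beta>: "norm n = 1" "\<And>z. z \<in> K \<Longrightarrow> n \<bullet> z \<le> \<beta>" "F = K \<inter> {z. n \<bullet> z = \<beta>}"
      using facet_hyperplane[OF mesh_polyhedron mesh_interior, OF K(1) K(1) K(2)] unfolding n_def by metis
    \<comment> \<open>Points beyond the facet tending to \<open>z\<close>. With denominators
      starting at 2 even the first one is strictly inside the ball of radius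
      \<open>r\<close>.\<close>
    define y where "y = (\<lambda>m::nat. z + (r / real (m + 2)) *\<^sub>R n)"
    define C where "C = \<Union>(\<K> - {K})"
    have "y m \<in> C" for m
    proof -
      have "r / (real (m + 2)) < r" 
        using r divide_strict_left_mono[of 1 "real (m + 2)" r] by simp
      then have "y m \<in> ball z r" using \<beta>(1) r(1) by (simp add: y_def dist_norm)
      then have "y m \<in> \<Union>\<K>" using r(2) closure_subset mesh_Union by blast
      moreover have "y m \<notin> K"
      proof
        assume "y m \<in> K"
        then have "n \<bullet> y m \<le> \<beta>" by (rule \<beta>(2))
        moreover have "n \<bullet> z = \<beta>" using zF \<beta>(3) by blast
        ultimately have "r / (real (m + 2)) \<le> 0"
          using \<beta>(1) by (simp add: y_def inner_add dot_square_norm)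
        then show False using r(1) by (simp add: divide_le_0_iff)
      qed
      ultimately show ?thesis by (auto simp: C_def)
    qed
    moreover have "y \<longlonglongrightarrow> z + 0 *\<^sub>R n"
      unfolding y_def
      by (intro tendsto_add tendsto_const tendsto_scaleR LIMSEQ_ignore_initial_segment[OF lim_const_over_n])
    moreover have "closed C" unfolding C_def using mesh_finite mesh_closed by (intro closed_Union) auto
    ultimately have "z \<in> C" using closed_sequentially by (metis add.right_neutral scaleR_zero_left)
    then obtain K' where K': "K' \<in> \<K>" "K' \<noteq> K" "z \<in> K'" by (auto simp: C_def)
    have face: "K \<inter> K' face_of K" "K \<inter> K' face_of K'"
      using mesh_Int_face[OF K(1) K'(1)] mesh_Int_face[OF K'(1) K(1)] by (simp_all add: Int_commute)
    have sub: "F \<subseteq> K \<inter> K'"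
      using face(1) facet_of_imp_subset[OF K(2)] by (rule subset_of_face_of) (use z zK K' in blast)
    have ne: "K \<inter> K' \<noteq> K"
    proof
      assume "K \<inter> K' = K"
      then have "interior (K \<inter> K') \<noteq> {}" using mesh_interior[OF K(1)] by simp
      then show False using mesh_eq_if_overlap[OF K(1) K'(1)] K' by blast
    qed
    have "F = K \<inter> K'"
    proof (rule ccontr)
      \<comment> \<open>No face fits strictly between \<open>F\<close> and \<open>K\<close>, since
        their dimensions differ by one.\<close>
      assume "F \<noteq> K \<inter> K'"
      moreover have "F face_of K \<inter> K'"
        using sub facet_of_imp_face_of[OF K(2)] by (rule_tac face_of_subset) auto
      moreover have "convex (K \<inter> K')" using face(1) by (rule face_of_imp_convex)
      ultimately have "aff_dim F < aff_dim (K \<inter> K')" by (intro face_of_aff_dim_lt) auto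
      moreover have "aff_dim (K \<inter> K') < aff_dim K"
        by (rule face_of_aff_dim_lt[OF mesh_convex[OF K(1)] face(1) ne])
      ultimately show False using K(2) by (simp add: facet_of_def)
    qed
    moreover from this have "F facet_of K'"
      using face(2) K mesh_facet_aff_dim[OF K] mesh_aff_dim[OF K'(1)] by (simp add: facet_of_def)
    ultimately have "F \<in> interior_facets \<K>"
      using K K' unfolding interior_facets_def by blast
    then show False using F by simp
  qed
  then have "closure (rel_interior F) \<subseteq> frontier Q" by (simp add: closure_minimal)
  then show ?thesis
    using convex_closure_rel_interior[OF mesh_facet_convex[OF K]] closure_subset by blast
qed

section \<open>Volume integrals as sums over elements\<close>

context
  assumes Q: "bounded_lipschitz_domain Q"
begin

lemma mesh_interior_subset: "K \<in> \<K> \<Longrightarrow> interior K \<subseteq> Q"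
  using interior_mono[OF mesh_subset_closure] interior_closure_lipschitz_domain[OF Q] by blast

text \<open>The integrand has to be known only on the interiors of the elements: the union of their
  frontiers is negligible, and off it each point of \<open>Q\<close> lies in exactly one
  element.\<close>

lemma set_integral_mesh:
  fixes f :: "'a \<Rightarrow> real" and g :: "'a set \<Rightarrow> 'a \<Rightarrow> real"
  assumes f: "\<And>K z. K \<in> \<K> \<Longrightarrow> z \<in> interior K \<Longrightarrow> f z = g K z"
    and g: "\<And>K. K \<in> \<K> \<Longrightarrow> continuous_on K (g K)"
  shows "(LINT z:Q|lebesgue. f z) = (\<Sum>K\<in>\<K>. LINT z:K|lebesgue. g K z)"
proof -
  have int: "integrable lebesgue (\<lambda>z. indicator K z *\<^sub>R g K z)" if "K \<in> \<K>" for K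
    using borel_integrable_compact[OF mesh_compact[OF that] g[OF that]]
    by (simp add: integrable_completion)
  define N where "N = (\<Union>K\<in>\<K>. frontier K)"
  have "negligible N"
    unfolding N_def using mesh_finite negligible_convex_frontier[OF mesh_convex]
    by (intro negligible_Union) auto
  moreover have "indicator Q z *\<^sub>R f z = (\<Sum>K\<in>\<K>. indicator K z *\<^sub>R g K z)" if z: "z \<notin> N" for z
  proof -
    have iff: "z \<in> K \<longleftrightarrow> z \<in> interior K" if "K \<in> \<K>" for K
      using z that mesh_closed[OF that] interior_subset
      by (auto simp: N_def frontier_def)
    show ?thesis
    proof (cases "z \<in> Q")
      case True
      then have "z \<in> \<Union>\<K>" using mesh_Union closure_subset by blast
      then obtain K where K: "K \<in> \<K>" "z \<in> K" by blast
      have "z \<notin> K'" if K': "K' \<in> \<K>" "K' \<noteq> K" for K'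
      proof
        assume "z \<in> K'"
        then have "z \<in> interior (K \<inter> K')" using K K' iff by simp
        then show False using mesh_eq_if_overlap[OF K(1) K'(1)] K' by blast
      qed
      then have "(\<Sum>K'\<in>\<K>. indicator K' z *\<^sub>R g K' z) = (\<Sum>K'\<in>\<K>. if K' = K then g K z else 0)"
        using K by (intro sum.cong) (auto simp: indicator_def)
      also have "\<dots> = g K z" using K mesh_finite by simp
      finally show ?thesis using True f[OF K(1)] iff K by simp
    next
      case False
      then have "z \<notin> K" if "K \<in> \<K>" for K using mesh_interior_subset that iff by blast
      then show ?thesis using False by simp
    qed
  qed
  ultimately have "integral\<^sup>L lebesgue (\<lambda>z. indicator Q z *\<^sub>R f z) =
      integral\<^sup>L lebesgue (\<lambda>z. \<Sum>K\<in>\<K>. indicator K z *\<^sub>R g K z)"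
    using int by (intro lebesgue_integral_spike(2)) auto
  also have "\<dots> = (\<Sum>K\<in>\<K>. integral\<^sup>L lebesgue (\<lambda>z. indicator K z *\<^sub>R g K z))"
    using int by (rule Bochner_Integration.integral_sum)
  finally show ?thesis by (simp add: set_lebesgue_integral_def)
qed

end

lemma set_integral_element:
  fixes f g :: "'a \<Rightarrow> real"
  assumes K: "K \<in> \<K>" and f: "\<And>z. z \<in> interior K \<Longrightarrow> f z = g z" and g: "continuous_on K g"
  shows "(LINT z:K|lebesgue. f z) = (LINT z:K|lebesgue. g z)"
  unfolding set_lebesgue_integral_def
proof (rule lebesgue_integral_spike(2))
  show "integrable lebesgue (\<lambda>z. indicator K z *\<^sub>R g z)"
    using borel_integrable_compact[OF mesh_compact[OF K] g] by (simp add: integrable_completion)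
  show "negligible (frontier K)" by (rule negligible_convex_frontier[OF mesh_convex[OF K]])
  show "indicator K z *\<^sub>R f z = indicator K z *\<^sub>R g z" if "z \<notin> frontier K" for z
    using that f mesh_closed[OF K] by (auto simp: frontier_def indicator_def)
qed

end

section \<open>Polynomials and their derivatives\<close>

lemma finite_poly_indices:
  "finite {\<alpha>. \<alpha> \<in> (Basis :: 'a::euclidean_space set) \<rightarrow>\<^sub>E {..p} \<and> (\<Sum>b\<in>Basis. \<alpha> b) \<le> (p::nat)}"
  by (rule finite_subset[OF _ finite_PiE[of Basis "\<lambda>_. {..p}"]]) auto

lemma poly_fun_cmult:
  assumes "q \<in> poly_fun p"
  shows "(\<lambda>z. a * q z) \<in> poly_fun p"
proof -
  obtain c where "\<And>z. q z = (\<Sum>\<alpha> | \<alpha> \<in> Basis \<rightarrow>\<^sub>E {..p} \<and> (\<Sum>b\<in>Basis. \<alpha> b) \<le> p. c \<alpha> * (\<Prod>b\<in>Basis. (z \<bullet> b) ^ \<alpha> b))"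
    using assms by (auto simp: poly_fun_def)
  then show ?thesis unfolding poly_fun_def mem_Collect_eq
    by (intro exI[of _ "\<lambda>\<alpha>. a * c \<alpha>"]) (simp add: sum_distrib_left mult.assoc)
qed

lemma poly_fun_sum:
  assumes "finite I" "\<And>i. i \<in> I \<Longrightarrow> f i \<in> poly_fun p"
  shows "(\<lambda>z. \<Sum>i\<in>I. f i z) \<in> poly_fun p"
proof -
  have "\<forall>i\<in>I. \<exists>c. \<forall>z. f i z = (\<Sum>\<alpha> | \<alpha> \<in> Basis \<rightarrow>\<^sub>E {..p} \<and> (\<Sum>b\<in>Basis. \<alpha> b) \<le> p. c \<alpha> * (\<Prod>b\<in>Basis. (z \<bullet> b) ^ \<alpha> b))"
    using assms(2) by (auto simp: poly_fun_def)
  then obtain c where c: "\<And>i z. i \<in> I \<Longrightarrow> f i z = (\<Sum>\<alpha> | \<alpha> \<in> Basis \<rightarrow>\<^sub>E {..p} \<and> (\<Sum>b\<in>Basis. \<alpha> b) \<le> p. c i \<alpha> * (\<Prod>b\<in>Basis. (z \<bullet> b) ^ \<alpha> b))"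
    unfolding bchoice_iff by blast
  show ?thesis unfolding poly_fun_def mem_Collect_eq
  proof (intro exI[of _ "\<lambda>\<alpha>. \<Sum>i\<in>I. c i \<alpha>"] allI)
    fix z
    have "(\<Sum>i\<in>I. f i z) = (\<Sum>i\<in>I. \<Sum>\<alpha> | \<alpha> \<in> Basis \<rightarrow>\<^sub>E {..p} \<and> (\<Sum>b\<in>Basis. \<alpha> b) \<le> p. c i \<alpha> * (\<Prod>b\<in>Basis. (z \<bullet> b) ^ \<alpha> b))"
      by (rule sum.cong[OF refl c])
    also have "\<dots> = (\<Sum>\<alpha> | \<alpha> \<in> Basis \<rightarrow>\<^sub>E {..p} \<and> (\<Sum>b\<in>Basis. \<alpha> b) \<le> p. \<Sum>i\<in>I. c i \<alpha> * (\<Prod>b\<in>Basis. (z \<bullet> b) ^ \<alpha> b))"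
      by (rule sum.swap)
    finally show "(\<Sum>i\<in>I. f i z) = (\<Sum>\<alpha> | \<alpha> \<in> Basis \<rightarrow>\<^sub>E {..p} \<and> (\<Sum>b\<in>Basis. \<alpha> b) \<le> p. (\<Sum>i\<in>I. c i \<alpha>) * (\<Prod>b\<in>Basis. (z \<bullet> b) ^ \<alpha> b))"
      by (simp add: sum_distrib_right)
  qed
qed

lemma monomial_in_poly_fun:
  fixes \<beta> :: "'a::euclidean_space \<Rightarrow> nat"
  assumes "(\<Sum>b\<in>Basis. \<beta> b) \<le> p"
  shows "(\<lambda>z. \<Prod>b\<in>Basis. (z \<bullet> b) ^ \<beta> b) \<in> poly_fun p"
proof -
  \<comment> \<open>The exponents indexing \<open>poly_fun\<close> are extensional functions on
    \<open>Basis\<close>, so \<open>\<beta>\<close> is restricted first.\<close>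
  define \<gamma> where "\<gamma> = restrict \<beta> Basis"
  have "\<beta> b \<le> p" if "b \<in> Basis" for b
    using member_le_sum[of b Basis \<beta>] that assms by simp
  then have \<gamma>: "\<gamma> \<in> {\<alpha>. \<alpha> \<in> Basis \<rightarrow>\<^sub>E {..p} \<and> (\<Sum>b\<in>Basis. \<alpha> b) \<le> p}"
    using assms by (auto simp: \<gamma>_def)
  show ?thesis unfolding poly_fun_def mem_Collect_eq
  proof (intro exI[of _ "\<lambda>\<alpha>. if \<alpha> = \<gamma> then 1 else 0"] allI)
    fix z :: 'a
    have "(\<Sum>\<alpha> | \<alpha> \<in> Basis \<rightarrow>\<^sub>E {..p} \<and> (\<Sum>b\<in>Basis. \<alpha> b) \<le> p. (if \<alpha> = \<gamma> then 1 else 0) * (\<Prod>b\<in>Basis. (z \<bullet> b) ^ \<alpha> b))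
      = (\<Sum>\<alpha> | \<alpha> \<in> Basis \<rightarrow>\<^sub>E {..p} \<and> (\<Sum>b\<in>Basis. \<alpha> b) \<le> p. if \<alpha> = \<gamma> then (\<Prod>b\<in>Basis. (z \<bullet> b) ^ \<gamma> b) else 0)"
      by (rule sum.cong) auto
    also have "\<dots> = (\<Prod>b\<in>Basis. (z \<bullet> b) ^ \<beta> b)"
      using \<gamma> by (simp add: sum.delta[OF finite_poly_indices]) (simp add: \<gamma>_def)
    finally show "(\<Prod>b\<in>Basis. (z \<bullet> b) ^ \<beta> b) = (\<Sum>\<alpha> | \<alpha> \<in> Basis \<rightarrow>\<^sub>E {..p} \<and> (\<Sum>b\<in>Basis. \<alpha> b) \<le> p. (if \<alpha> = \<gamma> then 1 else 0) * (\<Prod>b\<in>Basis. (z \<bullet> b) ^ \<alpha> b))"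
      by simp
  qed
qed

text \<open>When \<open>\<alpha> b = 0\<close> the truncated exponent \<open>\<alpha> b - 1\<close>
  is again 0, which is harmless because the factor \<open>real (\<alpha> b)\<close>
  vanishes.\<close>

lemma has_derivative_monomial:
  fixes \<alpha> :: "'a::euclidean_space \<Rightarrow> nat"
  shows "((\<lambda>z. \<Prod>b\<in>Basis. (z \<bullet> b) ^ \<alpha> b) has_derivative
    (\<lambda>h. \<Sum>b\<in>Basis. (h \<bullet> b) * (real (\<alpha> b) * (\<Prod>c\<in>Basis. (z \<bullet> c) ^ (\<alpha>(b := \<alpha> b - 1)) c)))) (at z)"
proof -
  have "((\<lambda>z. \<Prod>b\<in>Basis. (z \<bullet> b) ^ \<alpha> b) has_derivative
    (\<lambda>h. \<Sum>b\<in>Basis. (real (\<alpha> b) * (h \<bullet> b) * (z \<bullet> b) ^ (\<alpha> b - 1)) * (\<Prod>c\<in>Basis - {b}. (z \<bullet> c) ^ \<alpha> c))) (at z)"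
    by (rule has_derivative_prod) (auto intro!: derivative_eq_intros)
  moreover have "(real (\<alpha> b) * (h \<bullet> b) * (z \<bullet> b) ^ (\<alpha> b - 1)) * (\<Prod>c\<in>Basis - {b}. (z \<bullet> c) ^ \<alpha> c)
    = (h \<bullet> b) * (real (\<alpha> b) * (\<Prod>c\<in>Basis. (z \<bullet> c) ^ (\<alpha>(b := \<alpha> b - 1)) c))" if "b \<in> Basis" for b h
  proof -
    have "(\<Prod>c\<in>Basis - {b}. (z \<bullet> c) ^ (\<alpha>(b := \<alpha> b - 1)) c) = (\<Prod>c\<in>Basis - {b}. (z \<bullet> c) ^ \<alpha> c)"
      by (rule prod.cong) auto
    then show ?thesis using that by (simp add: prod.remove[of Basis b])
  qed
  then have "(\<lambda>h. \<Sum>b\<in>Basis. (real (\<alpha> b) * (h \<bullet> b) * (z \<bullet> b) ^ (\<alpha> b - 1)) * (\<Prod>c\<in>Basis - {b}. (z \<bullet> c) ^ \<alpha> c))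
    = (\<lambda>h. \<Sum>b\<in>Basis. (h \<bullet> b) * (real (\<alpha> b) * (\<Prod>c\<in>Basis. (z \<bullet> c) ^ (\<alpha>(b := \<alpha> b - 1)) c)))"
    by (intro ext sum.cong refl)
  ultimately show ?thesis by (simp only:)
qed

text \<open>The degree bound stays at \<open>p\<close> rather than dropping to \<open>p - 1\<close>:
  the statement can then be iterated for mixed derivatives, and components of the gradient stay in
  the space of the inverse inequality.\<close>

lemma poly_fun_has_derivative:
  fixes q :: "'a::euclidean_space \<Rightarrow> real"
  assumes "q \<in> poly_fun p"
  obtains D where "\<And>b. b \<in> Basis \<Longrightarrow> D b \<in> poly_fun p"
    "\<And>z. (q has_derivative (\<lambda>h. \<Sum>b\<in>Basis. (h \<bullet> b) * D b z)) (at z)"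
proof -
  define A where "A = {\<alpha>. \<alpha> \<in> (Basis :: 'a set) \<rightarrow>\<^sub>E {..p} \<and> (\<Sum>b\<in>Basis. \<alpha> b) \<le> p}"
  obtain c where c: "q = (\<lambda>z. \<Sum>\<alpha>\<in>A. c \<alpha> * (\<Prod>b\<in>Basis. (z \<bullet> b) ^ \<alpha> b))"
    using assms by (auto simp: poly_fun_def A_def)
  define D where "D = (\<lambda>b z. \<Sum>\<alpha>\<in>A. c \<alpha> * (real (\<alpha> b) * (\<Prod>c\<in>Basis. (z \<bullet> c) ^ (\<alpha>(b := \<alpha> b - 1)) c)))"
  show thesis
  proof
    fix b :: 'a assume b: "b \<in> Basis"
    show "D b \<in> poly_fun p"
      unfolding D_def
    proof (intro poly_fun_sum poly_fun_cmult monomial_in_poly_fun)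
      show "finite A" unfolding A_def by (rule finite_poly_indices)
      fix \<alpha> assume "\<alpha> \<in> A"
      then have "(\<Sum>b\<in>Basis. \<alpha> b) \<le> p" by (simp add: A_def)
      moreover have "(\<Sum>c\<in>Basis. (\<alpha>(b := \<alpha> b - 1)) c) \<le> (\<Sum>b\<in>Basis. \<alpha> b)"
        by (rule sum_mono) auto
      ultimately show "(\<Sum>c\<in>Basis. (\<alpha>(b := \<alpha> b - 1)) c) \<le> p" by simp
    qed
  next
    fix z
    have "(q has_derivative (\<lambda>h. \<Sum>\<alpha>\<in>A. c \<alpha> * (\<Sum>b\<in>Basis. (h \<bullet> b) * (real (\<alpha> b) * (\<Prod>c\<in>Basis. (z \<bullet> c) ^ (\<alpha>(b := \<alpha> b - 1)) c))))) (at z)"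
      unfolding c by (intro has_derivative_sum has_derivative_mult_right has_derivative_monomial)
    also have "(\<lambda>h. \<Sum>\<alpha>\<in>A. c \<alpha> * (\<Sum>b\<in>Basis. (h \<bullet> b) * (real (\<alpha> b) * (\<Prod>c\<in>Basis. (z \<bullet> c) ^ (\<alpha>(b := \<alpha> b - 1)) c))))
      = (\<lambda>h. \<Sum>b\<in>Basis. (h \<bullet> b) * D b z)"
      unfolding D_def sum_distrib_left by (subst sum.swap) (simp add: mult.left_commute)
    finally show "(q has_derivative (\<lambda>h. \<Sum>b\<in>Basis. (h \<bullet> b) * D b z)) (at z)" .
  qed
qed

lemma poly_fun_continuous:
  assumes "q \<in> poly_fun p"
  shows "continuous_on S q"
proof -
  obtain D where D: "\<And>z. (q has_derivative (\<lambda>h. \<Sum>b\<in>Basis. (h \<bullet> b) * D b z)) (at z)"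
    by (rule poly_fun_has_derivative[OF assms]) blast
  show ?thesis
    by (intro continuous_at_imp_continuous_on ballI has_derivative_continuous[OF D])
qed

section \<open>Partial derivatives in space and time\<close>

lemma poly_fun_space_time_derivative:
  fixes q :: "(real^'d) \<times> real \<Rightarrow> real"
  assumes "q \<in> poly_fun p"
  obtains gx gt where "\<And>i. (\<lambda>z. gx z $ i) \<in> poly_fun p" "gt \<in> poly_fun p"
    "\<And>z. (q has_derivative (\<lambda>h. fst h \<bullet> gx z + snd h * gt z)) (at z)"
proof -
  obtain D where D: "\<And>b. b \<in> Basis \<Longrightarrow> D b \<in> poly_fun p"
    "\<And>z. (q has_derivative (\<lambda>h. \<Sum>b\<in>Basis. (h \<bullet> b) * D b z)) (at z)"
    by (rule poly_fun_has_derivative[OF assms]) blast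
  define gx where "gx = (\<lambda>z. \<chi> i. D (axis i 1, 0) z)"
  have ax: "(axis i 1, 0) \<in> (Basis :: ((real^'d) \<times> real) set)" for i
    by (simp add: Basis_prod_def axis_in_Basis_iff)
  show thesis
  proof
    show "(\<lambda>z. gx z $ i) \<in> poly_fun p" for i using D(1)[OF ax[of i]] by (simp add: gx_def)
    show "D (0, 1) \<in> poly_fun p" by (rule D(1)) (simp add: Basis_prod_def)
    fix z
    have "(\<Sum>b\<in>Basis. (h \<bullet> b) * D b z) = fst h \<bullet> gx z + snd h * D (0, 1) z" for h
    proof -
      have "(\<Sum>b\<in>Basis. (h \<bullet> b) * D b z) = (\<Sum>u\<in>Basis. (fst h \<bullet> u) * D (u, 0) z) + snd h * D (0, 1) z"
        unfolding Basis_prod_def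
        by (subst sum.union_disjoint) (auto simp: sum.reindex inj_on_def inner_prod_def)
      also have "(\<Sum>u\<in>Basis. (fst h \<bullet> u) * D (u, 0) z) = fst h \<bullet> gx z"
      proof -
        have "(\<Sum>u\<in>Basis. (fst h \<bullet> u) * D (u, 0) z) = (\<Sum>i\<in>UNIV. fst h $ i * D (axis i 1, 0) z)"
          by (simp add: Basis_vec_def UNION_singleton_eq_range sum.reindex inj_on_def axis_eq_axis
              inner_axis)
        then show ?thesis by (simp add: gx_def inner_vec_def)
      qed
      finally show ?thesis .
    qed
    then show "(q has_derivative (\<lambda>h. fst h \<bullet> gx z + snd h * D (0, 1) z)) (at z)"
      using D(2)[of z] by simp
  qed
qed

lemma has_derivative_space_time_partials:
  fixes q :: "(real^'d) \<times> real \<Rightarrow> real"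
  assumes "(q has_derivative (\<lambda>h. fst h \<bullet> g + snd h * a)) (at z)"
  shows "GDERIV (\<lambda>x. q (x, snd z)) (fst z) :> g"
    and "((\<lambda>s. q (fst z, s)) has_real_derivative a) (at (snd z))"
proof -
  have z: "(q has_derivative (\<lambda>h. fst h \<bullet> g + snd h * a)) (at (fst z, snd z))" using assms by simp
  have "((\<lambda>x. (x, snd z)) has_derivative (\<lambda>h. (h, 0))) (at (fst z))"
    by (auto intro!: derivative_eq_intros)
  from has_derivative_compose[OF this z]
  show "GDERIV (\<lambda>x. q (x, snd z)) (fst z) :> g" by (simp add: gderiv_def)
  have "((\<lambda>s. (fst z, s)) has_derivative (\<lambda>h. (0, h))) (at (snd z))"
    by (auto intro!: derivative_eq_intros)
  from has_derivative_compose[OF this z]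
  show "((\<lambda>s. q (fst z, s)) has_real_derivative a) (at (snd z))"
    by (simp add: has_field_derivative_def mult_commute_abs)
qed

lemma poly_fun_partials:
  fixes q :: "(real^'d) \<times> real \<Rightarrow> real"
  assumes q: "q \<in> poly_fun p"
  obtains gx gt gxt where "\<And>i. (\<lambda>z. gx z $ i) \<in> poly_fun p"
    "continuous_on UNIV gx" "continuous_on UNIV gt" "continuous_on UNIV gxt"
    "\<And>z. GDERIV (\<lambda>x. q (x, snd z)) (fst z) :> gx z"
    "\<And>z. ((\<lambda>s. q (fst z, s)) has_real_derivative gt z) (at (snd z))"
    "\<And>z. ((\<lambda>s. gx (fst z, s)) has_vector_derivative gxt z) (at (snd z))"
proof -
  obtain gx gt where g: "\<And>i. (\<lambda>z. gx z $ i) \<in> poly_fun p" "gt \<in> poly_fun p"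
    "\<And>z. (q has_derivative (\<lambda>h. fst h \<bullet> gx z + snd h * gt z)) (at z)"
    by (rule poly_fun_space_time_derivative[OF q]) blast
  have "\<exists>b. b \<in> poly_fun p \<and> (\<forall>z. ((\<lambda>s. gx (fst z, s) $ i) has_real_derivative b z) (at (snd z)))" for i
  proof -
    obtain hx ht where h: "ht \<in> poly_fun p"
      "\<And>z. ((\<lambda>z. gx z $ i) has_derivative (\<lambda>h. fst h \<bullet> hx z + snd h * ht z)) (at z)"
      by (rule poly_fun_space_time_derivative[OF g(1)[of i]]) blast
    show ?thesis using h(1) has_derivative_space_time_partials(2)[OF h(2)] by blast
  qed
  then have "\<exists>b. \<forall>i. b i \<in> poly_fun p \<and> (\<forall>z. ((\<lambda>s. gx (fst z, s) $ i) has_real_derivative b i z) (at (snd z)))"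
    by (intro choice allI)
  then obtain b where b: "\<And>i. b i \<in> poly_fun p"
    "\<And>i z. ((\<lambda>s. gx (fst z, s) $ i) has_real_derivative b i z) (at (snd z))"
    by blast
  show thesis
  proof (rule that)
    show "continuous_on UNIV gx"
    proof -
      have "continuous_on UNIV (\<lambda>z. \<chi> i. gx z $ i)"
        by (rule continuous_on_vec_lambda[OF poly_fun_continuous[OF g(1)]])
      then show ?thesis by simp
    qed
    show "continuous_on UNIV gt" by (rule poly_fun_continuous[OF g(2)])
    show "continuous_on UNIV (\<lambda>z. \<chi> i. b i z)"
      by (rule continuous_on_vec_lambda[OF poly_fun_continuous[OF b(1)]])
    show "GDERIV (\<lambda>x. q (x, snd z)) (fst z) :> gx z" for z
      by (rule has_derivative_space_time_partials(1)[OF g(3)])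
    show "((\<lambda>s. q (fst z, s)) has_real_derivative gt z) (at (snd z))" for z
      by (rule has_derivative_space_time_partials(2)[OF g(3)])
    show "((\<lambda>s. gx (fst z, s)) has_vector_derivative (\<chi> i. b i z)) (at (snd z))" for z
      unfolding has_vector_derivative_def
    proof (subst has_derivative_componentwise_within, intro ballI)
      fix u :: "real^'d" assume "u \<in> Basis"
      then obtain i where u: "u = axis i 1" by (auto simp: Basis_vec_def)
      show "((\<lambda>s. gx (fst z, s) \<bullet> u) has_derivative (\<lambda>h. (h *\<^sub>R (\<chi> i. b i z)) \<bullet> u)) (at (snd z))"
        using b(2)[where i = i and z = z]
        by (simp add: u inner_axis has_field_derivative_def mult_commute_abs)
    qed
  qed (rule g(1))
qed

lemma GDERIV_unique:
  assumes "GDERIV f x :> a" "GDERIV f x :> b"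
  shows "a = b"
proof -
  have "(\<lambda>h. h \<bullet> a) = (\<lambda>h. h \<bullet> b)"
    using assms unfolding gderiv_def by (rule has_derivative_unique)
  then have "h \<bullet> a = h \<bullet> b" for h by (rule fun_cong)
  then show ?thesis using vector_eq_ldot[of a b] by blast
qed

lemma nabla_x_eq:
  assumes U: "open U" "z \<in> U" and eq: "\<And>y. y \<in> U \<Longrightarrow> v y = q y"
    and q: "GDERIV (\<lambda>x. q (x, snd z)) (fst z) :> g"
  shows "nabla_x v z = g"
proof -
  have op: "open ((\<lambda>x. (x, snd z)) -` U)" by (intro open_vimage U continuous_intros)
  have "GDERIV (\<lambda>x. v (x, snd z)) (fst z) :> g"
    unfolding gderiv_def
    by (rule has_derivative_transform_within_open[OF q[unfolded gderiv_def] op]) (use U eq in auto)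
  then show ?thesis unfolding nabla_x_def by (blast intro: GDERIV_unique)
qed

lemma dt_eq:
  assumes U: "open U" "z \<in> U" and eq: "\<And>y. y \<in> U \<Longrightarrow> v y = q y"
    and q: "((\<lambda>s. q (fst z, s)) has_vector_derivative g) (at (snd z))"
  shows "dt v z = g"
proof -
  have op: "open ((\<lambda>s. (fst z, s)) -` U)" by (intro open_vimage U continuous_intros)
  have "((\<lambda>s. v (fst z, s)) has_vector_derivative g) (at (snd z))"
    by (rule has_vector_derivative_transform_within_open[OF q op]) (use U eq in auto)
  then show ?thesis unfolding dt_def by (rule vector_derivative_at)
qed

section \<open>Traces\<close>

lemma islimpt_open_closure:
  fixes z :: "'a::euclidean_space"
  assumes "open G" "z \<in> closure G"
  shows "z islimpt G"
  using assms interior_limit_point[of z G] by (auto simp: closure_def interior_open)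

text \<open>\<open>Lim\<close> is determined only along a nontrivial filter, which is available
  because every closure point of an open set is a limit point of it.\<close>

lemma trace_from_eq:
  fixes f :: "'a::euclidean_space \<Rightarrow> 'b::t2_space"
  assumes G: "open G" "z \<in> closure G" and r: "r > 0" "\<And>y. y \<in> G \<Longrightarrow> dist y z < r \<Longrightarrow> f y = q y"
    and q: "continuous (at z within G) q"
  shows "trace_from G f z = q z"
  unfolding trace_from_def
proof (rule tendsto_Lim)
  show "at z within G \<noteq> bot"
    using islimpt_open_closure[OF G] trivial_limit_within by blast
  have "eventually (\<lambda>y. q y = f y) (at z within G)"
    unfolding eventually_at using r by auto
  then show "(f \<longlongrightarrow> q z) (at z within G)"
    using q unfolding continuous_within by (rule Lim_transform_eventually[rotated])
qed

text \<open>
  The points of \<open>S\<close> where the limit exists form a relative \<open>G\<^sub>\<delta>\<close> set, by the Cauchy criterion, and the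
  limit depends continuously on them. At the other points \<open>trace_from\<close> is one fixed junk value.
\<close>

lemma borel_measurable_trace_from:
  fixes f :: "'a::euclidean_space \<Rightarrow> 'b::euclidean_space"
  assumes G: "open G" and S: "S \<in> sets borel" "S \<subseteq> frontier G"
  shows "(\<lambda>z. indicator S z *\<^sub>R trace_from G f z) \<in> borel_measurable borel"
proof -
  have SG: "z \<notin> G" "z \<in> closure G" if "z \<in> S" for z
    using that S(2) G by (auto simp: frontier_def interior_open)
  have ntriv: "at z within G \<noteq> bot" if "z \<in> S" for z
    using islimpt_open_closure[OF G SG(2)[OF that]] trivial_limit_within by blast
  \<comment> \<open>The oscillation of \<open>f\<close> over \<open>G\<close> near \<open>z\<close>
    is below \<open>1 / real (Suc n)\<close>; lying in all \<open>U n\<close> is the Cauchy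
    criterion at \<open>z\<close>.\<close>
  define U where "U = (\<lambda>n::nat. {z. \<exists>d>0. \<forall>y\<in>G. \<forall>y'\<in>G. dist y z < d \<longrightarrow> dist y' z < d \<longrightarrow> dist (f y) (f y') < 1 / real (Suc n)})"
  define C where "C = {z \<in> S. \<exists>l. (f \<longlongrightarrow> l) (at z within G)}"
  have opU: "open (U n)" for n
    unfolding open_dist
  proof
    fix z assume "z \<in> U n"
    then obtain d where d: "d > 0" "\<And>y y'. y \<in> G \<Longrightarrow> y' \<in> G \<Longrightarrow> dist y z < d \<Longrightarrow> dist y' z < d \<Longrightarrow> dist (f y) (f y') < 1 / real (Suc n)"
      unfolding U_def by blast
    have "z' \<in> U n" if z': "dist z' z < d / 2" for z'
    proof -
      have "dist y z < d" if "dist y z' < d / 2" for y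
        using dist_triangle[of y z z'] that z' by simp
      then show ?thesis unfolding U_def using d by (intro CollectI exI[of _ "d / 2"]) auto
    qed
    then show "\<exists>e>0. \<forall>y. dist y z < e \<longrightarrow> y \<in> U n" using d(1) by (intro exI[of _ "d / 2"]) auto
  qed
  have CU: "C = S \<inter> (\<Inter>n. U n)"
  proof (intro set_eqI iffI)
    fix z assume "z \<in> C"
    then obtain l where z: "z \<in> S" and l: "(f \<longlongrightarrow> l) (at z within G)" by (auto simp: C_def)
    have "z \<in> U n" for n
    proof -
      have "1 / real (Suc n) / 2 > 0" by simp
      then have "eventually (\<lambda>y. dist (f y) l < 1 / real (Suc n) / 2) (at z within G)"
        using l tendstoD by blast
      then obtain d where d: "d > 0" "\<And>y. y \<in> G \<Longrightarrow> y \<noteq> z \<Longrightarrow> dist y z < d \<Longrightarrow> dist (f y) l < 1 / real (Suc n) / 2"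
        unfolding eventually_at by blast
      have "dist (f y) (f y') < 1 / real (Suc n)" if "y \<in> G" "y' \<in> G" "dist y z < d" "dist y' z < d" for y y'
      proof (rule dist_triangle_half_l)
        show "dist (f y) l < 1 / real (Suc n) / 2" "dist (f y') l < 1 / real (Suc n) / 2"
          using d(2) that SG(1)[OF z] by metis+
      qed
      then show ?thesis unfolding U_def using d(1) by blast
    qed
    then show "z \<in> S \<inter> (\<Inter>n. U n)" using z by blast
  next
    fix z assume z: "z \<in> S \<inter> (\<Inter>n. U n)"
    have "z \<in> closure G" using SG(2) z by simp
    then obtain x where x: "\<And>k. x k \<in> G" "x \<longlonglongrightarrow> z"
      unfolding closure_sequential by blast
    have osc: "\<exists>d>0. \<forall>y\<in>G. \<forall>y'\<in>G. dist y z < d \<longrightarrow> dist y' z < d \<longrightarrow> dist (f y) (f y') < e" if e: "e > 0" for e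
    proof -
      obtain n where n: "inverse (real (Suc n)) < e" using reals_Archimedean[OF e] by blast
      have "z \<in> U n" using z by blast
      then obtain d where "d > 0" "\<forall>y\<in>G. \<forall>y'\<in>G. dist y z < d \<longrightarrow> dist y' z < d \<longrightarrow> dist (f y) (f y') < 1 / real (Suc n)"
        unfolding U_def by blast
      then show ?thesis using n by (intro exI[of _ d]) (force simp: inverse_eq_divide)
    qed
    have "Cauchy (\<lambda>k. f (x k))"
    proof (rule metric_CauchyI)
      fix e :: real assume "e > 0"
      then obtain d where d: "d > 0" "\<forall>y\<in>G. \<forall>y'\<in>G. dist y z < d \<longrightarrow> dist y' z < d \<longrightarrow> dist (f y) (f y') < e"
        using osc by blast
      obtain M where "\<forall>k\<ge>M. dist (x k) z < d" using x(2) d(1) metric_LIMSEQ_D by blast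
      then show "\<exists>M. \<forall>m\<ge>M. \<forall>n\<ge>M. dist (f (x m)) (f (x n)) < e" using d x(1) by blast
    qed
    then obtain l where l: "(\<lambda>k. f (x k)) \<longlonglongrightarrow> l" using Cauchy_convergent convergent_def by blast
    have "(f \<longlongrightarrow> l) (at z within G)"
    proof (rule tendstoI)
      fix e :: real assume "e > 0"
      then have e2: "e / 2 > 0" by simp
      then obtain d where d: "d > 0" "\<forall>y\<in>G. \<forall>y'\<in>G. dist y z < d \<longrightarrow> dist y' z < d \<longrightarrow> dist (f y) (f y') < e / 2"
        using osc by blast
      obtain M where M: "\<forall>k\<ge>M. dist (x k) z < d" using x(2) d(1) metric_LIMSEQ_D by blast
      obtain M' where M': "\<forall>k\<ge>M'. dist (f (x k)) l < e / 2" using l e2 metric_LIMSEQ_D by blast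
      have "dist (f y) l < e" if "y \<in> G" "dist y z < d" for y
      proof (rule dist_triangle_half_r)
        show "dist (f (x (max M M'))) (f y) < e / 2" using d(2) M x(1) that by auto
        show "dist (f (x (max M M'))) l < e / 2" using M' by auto
      qed
      then show "eventually (\<lambda>y. dist (f y) l < e) (at z within G)"
        unfolding eventually_at using d(1) by blast
    qed
    then show "z \<in> C" using z by (auto simp: C_def)
  qed
  have Cb: "C \<in> sets borel" unfolding CU using opU S(1) by auto
  have lim: "(f \<longlongrightarrow> trace_from G f z) (at z within G)" if "z \<in> C" for z
    using that ntriv tendsto_Lim unfolding trace_from_def C_def by fastforce
  have "continuous_on C (trace_from G f)"
    unfolding continuous_on_iff
  proof (intro ballI allI impI)
    fix z and e :: real assume z: "z \<in> C" and "e > 0"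
    then have "eventually (\<lambda>y. dist (f y) (trace_from G f z) < e / 2) (at z within G)"
      using lim[OF z] by (intro tendstoD) auto
    then obtain d where d: "d > 0" "\<And>y. y \<in> G \<Longrightarrow> y \<noteq> z \<Longrightarrow> dist y z < d \<Longrightarrow> dist (f y) (trace_from G f z) < e / 2"
      unfolding eventually_at by blast
    have zG: "z \<notin> G" using z SG(1) by (auto simp: C_def)
    have "dist (trace_from G f z') (trace_from G f z) < e" if z': "z' \<in> C" "dist z' z < d" for z'
    proof -
      have "((\<lambda>y. dist (f y) (trace_from G f z)) \<longlongrightarrow> dist (trace_from G f z') (trace_from G f z)) (at z' within G)"
        by (intro tendsto_dist lim[OF z'(1)] tendsto_const)
      moreover have "eventually (\<lambda>y. dist (f y) (trace_from G f z) \<le> e / 2) (at z' within G)"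
        unfolding eventually_at
      proof (intro exI[of _ "d - dist z' z"] conjI ballI impI)
        show "d - dist z' z > 0" using z' by simp
        fix y assume y: "y \<in> G" "y \<noteq> z' \<and> dist y z' < d - dist z' z"
        then have "dist y z < d" using dist_triangle[of y z z'] by simp
        then show "dist (f y) (trace_from G f z) \<le> e / 2" using d(2)[of y] y zG by fastforce
      qed
      moreover have "at z' within G \<noteq> bot" using z' ntriv by (auto simp: C_def)
      ultimately have "dist (trace_from G f z') (trace_from G f z) \<le> e / 2"
        by (rule tendsto_upperbound)
      then show ?thesis using \<open>e > 0\<close> by simp
    qed
    then show "\<exists>d>0. \<forall>x'\<in>C. dist x' z < d \<longrightarrow> dist (trace_from G f x') (trace_from G f z) < e"
      using d(1) by blast
  qed
  then have m1: "(\<lambda>z. indicator C z *\<^sub>R trace_from G f z) \<in> borel_measurable borel"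
    by (intro borel_measurable_continuous_on_indicator Cb)
  have m2: "(\<lambda>z. indicator (S - C) z *\<^sub>R (THE l. False) :: 'b) \<in> borel_measurable borel"
    using Cb S(1) by (intro borel_measurable_scaleR borel_measurable_indicator) auto
  have "indicator S z *\<^sub>R trace_from G f z =
      indicator C z *\<^sub>R trace_from G f z + indicator (S - C) z *\<^sub>R (THE l. False)" for z
  proof (cases "z \<in> S - C")
    case True
    then have "\<not> (f \<longlongrightarrow> l) (at z within G)" for l by (auto simp: C_def)
    then have "trace_from G f z = (THE l. False)" by (simp add: trace_from_def t2_space_class.Lim_def)
    then show ?thesis using True by simp
  next
    case False
    then show ?thesis by (auto simp: indicator_def C_def)
  qed
  then show ?thesis using borel_measurable_add[OF m1 m2] by simp
qed

text \<open>If \<open>v z\<close> were nonzero, continuity would keep the absolute value of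
  \<open>v\<close> above half of that at \<open>z\<close>, so the averages could not tend to 0. This
  converts the boundary condition in \<open>H11_00\<close> into pointwise zeros.\<close>

lemma has_trace_0_imp_eq_0:
  fixes v :: "'a::euclidean_space \<Rightarrow> real"
  assumes Q: "open Q" "bounded Q" and z: "z \<in> closure Q" and v: "continuous_on (closure Q) v"
    and tr: "has_trace Q v z 0"
  shows "v z = 0"
proof (rule ccontr)
  assume "v z \<noteq> 0"
  define e where "e = \<bar>v z\<bar> / 2"
  have e: "e > 0" using \<open>v z \<noteq> 0\<close> by (simp add: e_def)
  obtain d where d: "d > 0" "\<And>y. y \<in> closure Q \<Longrightarrow> dist y z < d \<Longrightarrow> dist (v y) (v z) < e"
    using v z e unfolding continuous_on_iff by blast
  have comp: "compact (closure Q)" using Q by simp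
  have "set_integrable lborel (closure Q) (\<lambda>y. \<bar>v y\<bar>)"
    unfolding set_integrable_def by (intro borel_integrable_compact comp continuous_intros v)
  then have int: "set_integrable lebesgue (Q \<inter> ball z r) (\<lambda>y. \<bar>v y\<bar>)" for r
  proof -
    assume a: "set_integrable lborel (closure Q) (\<lambda>y. \<bar>v y\<bar>)"
    have "set_integrable lebesgue (closure Q) (\<lambda>y. \<bar>v y\<bar>)"
      using a unfolding set_integrable_def by (simp add: integrable_completion borel_measurable_integrable)
    then show ?thesis
      by (rule set_integrable_subset) (use Q closure_subset in auto)
  qed
  have ge: "e \<le> (LINT y:Q \<inter> ball z r|lebesgue. \<bar>v y - 0\<bar>) / measure lebesgue (Q \<inter> ball z r)"
    if r: "0 < r" "r < d" for r
  proof -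
    have op: "open (Q \<inter> ball z r)" using Q by auto
    have lm: "Q \<inter> ball z r \<in> lmeasurable" using op Q by (intro lmeasurable_open) (auto intro: bounded_Int)
    have "Q \<inter> ball z r \<noteq> {}" 
    proof -
      have "z \<in> ball z r \<inter> closure Q" using z r by simp
      then show ?thesis
        using open_Int_closure_eq_empty[of "ball z r" Q] by (metis Int_commute empty_iff open_ball)
    qed
    then have pos: "measure lebesgue (Q \<inter> ball z r) > 0"
      using op lm open_not_negligible[OF op] negligible_iff_measure0[OF lm]
      by (metis less_eq_real_def measure_nonneg)
    have "(LINT y:Q \<inter> ball z r|lebesgue. e) \<le> (LINT y:Q \<inter> ball z r|lebesgue. \<bar>v y\<bar>)"
    proof (rule set_integral_mono)
      show "set_integrable lebesgue (Q \<inter> ball z r) (\<lambda>y. e)"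
      proof -
        have "integrable lebesgue (indicat_real (Q \<inter> ball z r))"
          using lm by (intro integrable_real_indicator) (auto simp: fmeasurable_def)
        then show ?thesis by (simp add: set_integrable_def)
      qed
      show "e \<le> \<bar>v y\<bar>" if "y \<in> Q \<inter> ball z r" for y
      proof -
        have "dist (v y) (v z) < e"
          using d(2)[of y] that r closure_subset by (auto simp: dist_commute)
        then show ?thesis unfolding e_def dist_real_def by linarith
      qed
    qed (rule int)
    moreover have "(LINT y:Q \<inter> ball z r|lebesgue. e) = e * measure lebesgue (Q \<inter> ball z r)"
      using lm by (simp add: set_lebesgue_integral_def)
    ultimately show ?thesis using pos by (simp add: pos_le_divide_eq)
  qed
  have "((\<lambda>r. (LINT y:Q \<inter> ball z r|lebesgue. \<bar>v y - 0\<bar>) / measure lebesgue (Q \<inter> ball z r)) \<longlongrightarrow> 0) (at_right 0)"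
    using tr by (simp add: has_trace_def)
  then have "eventually (\<lambda>r. (LINT y:Q \<inter> ball z r|lebesgue. \<bar>v y - 0\<bar>) / measure lebesgue (Q \<inter> ball z r) < e) (at_right 0)"
    using e by (rule order_tendstoD(2))
  moreover have "eventually (\<lambda>r. r \<in> {0<..<d}) (at_right (0::real))"
    using d(1) by (rule eventually_at_right_real)
  ultimately have "eventually (\<lambda>r::real. False) (at_right 0)"
    by eventually_elim (use ge in force)
  then show False by simp
qed

section \<open>Discrete functions on a mesh\<close>

lemma aff_dim_Int_affine_less:
  fixes F :: "'a::euclidean_space set"
  assumes "affine H" "\<not> F \<subseteq> H"
  shows "aff_dim (F \<inter> H) < aff_dim F"
proof (rule aff_dim_psubset)
  have "affine hull (F \<inter> H) \<subseteq> H" by (rule hull_minimal) (use assms in auto)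
  moreover have "affine hull (F \<inter> H) \<subseteq> affine hull F" by (rule hull_mono) auto
  ultimately show "affine hull (F \<inter> H) \<subset> affine hull F"
    using assms(2) hull_subset[of F affine] by blast
qed

lemma L2_norm_on_squared: "(L2_norm_on M A f)\<^sup>2 = (LINT z:A|M. (norm (f z))\<^sup>2)"
proof -
  have "0 \<le> (LINT z:A|M. (norm (f z))\<^sup>2)"
    unfolding set_lebesgue_integral_def by (rule Bochner_Integration.integral_nonneg) auto
  then show ?thesis by (simp add: L2_norm_on_def)
qed

text \<open>
  The functions \<open>q K\<close>, \<open>gx K\<close>, \<open>gt K\<close>, \<open>gxt K\<close> are the polynomial extensions of \<open>v\<close>, \<open>\<nabla>\<^sub>x v\<close>, \<open>\<partial>\<^sub>t v\<close> and
  \<open>\<partial>\<^sub>t \<nabla>\<^sub>x v\<close> from the element \<open>K\<close>.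
\<close>

locale mesh_function =
  fixes \<Omega> :: "real \<Rightarrow> (real^'d) set" and T :: real
    and \<K> :: "((real^'d) \<times> real) set set" and p :: nat
    and v :: "(real^'d) \<times> real \<Rightarrow> real"
    and q gt :: "((real^'d) \<times> real) set \<Rightarrow> (real^'d) \<times> real \<Rightarrow> real"
    and gx gxt :: "((real^'d) \<times> real) set \<Rightarrow> (real^'d) \<times> real \<Rightarrow> real^'d"
  assumes T: "T > 0" and dom: "space_time_domain \<Omega> T"
    and mesh: "mesh_of (st_domain \<Omega> T) \<K>" and v: "v \<in> V0h \<Omega> T p \<K>"
    and vq: "\<And>K z. K \<in> \<K> \<Longrightarrow> z \<in> K \<Longrightarrow> v z = q K z"
    and cont: "\<And>K. K \<in> \<K> \<Longrightarrow> continuous_on UNIV (q K)" "\<And>K. K \<in> \<K> \<Longrightarrow> continuous_on UNIV (gx K)"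
      "\<And>K. K \<in> \<K> \<Longrightarrow> continuous_on UNIV (gt K)" "\<And>K. K \<in> \<K> \<Longrightarrow> continuous_on UNIV (gxt K)"
    and poly: "\<And>K i. K \<in> \<K> \<Longrightarrow> (\<lambda>z. gx K z $ i) \<in> poly_fun p"
    and deriv_x: "\<And>K z. K \<in> \<K> \<Longrightarrow> GDERIV (\<lambda>x. q K (x, snd z)) (fst z) :> gx K z"
    and deriv_t: "\<And>K z. K \<in> \<K> \<Longrightarrow> ((\<lambda>s. q K (fst z, s)) has_real_derivative gt K z) (at (snd z))"
    and deriv_xt: "\<And>K z. K \<in> \<K> \<Longrightarrow> ((\<lambda>s. gx K (fst z, s)) has_vector_derivative gxt K z) (at (snd z))"
begin

abbreviation Q :: "((real^'d) \<times> real) set" where "Q \<equiv> st_domain \<Omega> T"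
abbreviation top_plane :: "((real^'d) \<times> real) set" where "top_plane \<equiv> {z. snd z = T}"
abbreviation facet_int :: "((real^'d) \<times> real) set \<Rightarrow> ((real^'d) \<times> real \<Rightarrow> real) \<Rightarrow> real" where
  "facet_int F g \<equiv> LINT z:F|flat_measure F. g z"

section \<open>Space-time geometry of the domain and its top\<close>

lemma lipschitz: "bounded_lipschitz_domain Q"
  using dom by (simp add: space_time_domain_def)

lemma open_Q: "open Q" and bounded_Q: "bounded Q"
  using lipschitz by (auto simp: bounded_lipschitz_domain_def)

lemma Q_times: "z \<in> Q \<Longrightarrow> 0 < snd z \<and> snd z < T"
  by (auto simp: st_domain_def)

lemma closure_Q_times: "z \<in> closure Q \<Longrightarrow> snd z \<le> T"
proof -
  have "closure Q \<subseteq> {z. snd z \<le> T}"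
  proof (rule closure_minimal)
    show "Q \<subseteq> {z. snd z \<le> T}" using Q_times by force
    show "closed {z :: (real^'d) \<times> real. snd z \<le> T}"
      by (intro closed_Collect_le continuous_intros)
  qed
  then show "z \<in> closure Q \<Longrightarrow> snd z \<le> T" by blast
qed

lemma top_plane_hyperplane: "top_plane = {z. (0, 1) \<bullet> z = T}"
  by (auto simp: inner_prod_def)

lemma affine_top_plane: "affine top_plane"
  unfolding top_plane_hyperplane by (rule affine_hyperplane)

lemma top_open: "open (\<Omega> T)" "\<Omega> T \<noteq> {}"
  using dom T by (auto simp: space_time_domain_def)

lemma top_frontier: "top_bd \<Omega> T \<subseteq> frontier Q"
  using dom by (simp add: space_time_domain_def)

lemma top_borel: "top_bd \<Omega> T \<in> sets borel"
proof -
  have "top_bd \<Omega> T = fst -` \<Omega> T \<inter> snd -` {T}" by (auto simp: top_bd_def)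
  moreover have "open (fst -` \<Omega> T :: ((real^'d) \<times> real) set)"
    by (intro open_vimage top_open continuous_intros)
  moreover have "closed (snd -` {T} :: ((real^'d) \<times> real) set)"
    by (intro closed_vimage continuous_intros)
  ultimately show ?thesis by auto
qed

text \<open>The top is a nonempty relatively open part of the plane and therefore spans it.
  Consequently \<open>\<Sigma>\<^sub>T\<close> and the facets in that plane share one surface
  measure.\<close>

lemma affine_hull_top: "affine hull (top_bd \<Omega> T) = top_plane"
proof
  show "affine hull (top_bd \<Omega> T) \<subseteq> top_plane"
    by (rule hull_minimal) (auto simp: top_bd_def affine_top_plane)
  have lin: "bounded_linear (\<lambda>x. (x, 0) :: (real^'d) \<times> real)"
    by (intro bounded_linear_Pair bounded_linear_ident bounded_linear_zero)
  have "top_bd \<Omega> T = (+) (0, T) ` (\<lambda>x. (x, 0)) ` \<Omega> T" by (force simp: top_bd_def)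
  then have "affine hull (top_bd \<Omega> T) = (+) (0, T) ` (\<lambda>x. (x, 0)) ` (affine hull \<Omega> T)"
    by (simp only: affine_hull_translation affine_hull_linear_image[OF lin])
  also have "affine hull \<Omega> T = UNIV" by (rule affine_hull_open[OF top_open])
  finally show "top_plane \<subseteq> affine hull (top_bd \<Omega> T)" by force
qed

lemma aff_dim_top: "aff_dim (top_bd \<Omega> T) = CARD('d)"
proof -
  have "aff_dim (top_bd \<Omega> T) = aff_dim top_plane"
    by (metis aff_dim_affine_hull affine_hull_top)
  also have "\<dots> = CARD('d)"
    unfolding top_plane_hyperplane by (subst aff_dim_hyperplane) (auto simp: zero_prod_def)
  finally show ?thesis .
qed

lemma facet_aff_dim: "K \<in> \<K> \<Longrightarrow> F facet_of K \<Longrightarrow> aff_dim F = CARD('d)"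
  using mesh_facet_aff_dim[OF mesh] by simp

lemma facet_subset_closure: "K \<in> \<K> \<Longrightarrow> F facet_of K \<Longrightarrow> F \<subseteq> closure Q"
  using mesh_subset_closure[OF mesh] facet_of_imp_subset by blast

lemma facet_norm: "K \<in> \<K> \<Longrightarrow> F facet_of K \<Longrightarrow> norm (outer_normal K F) = 1"
  using facet_hyperplane mesh_polyhedron[OF mesh] mesh_interior[OF mesh] by metis

lemma facet_normal_time: "K \<in> \<K> \<Longrightarrow> F facet_of K \<Longrightarrow> \<bar>snd (outer_normal K F)\<bar> \<le> 1"
  using facet_norm norm_snd_le[of "snd (outer_normal K F)" "fst (outer_normal K F)"] by simp

lemma facet_set_integrable:
  fixes g :: "_ \<Rightarrow> real"
  shows "K \<in> \<K> \<Longrightarrow> F facet_of K \<Longrightarrow> continuous_on F g \<Longrightarrow> set_integrable (flat_measure F) F g"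
  using set_integrable_flat_measure[OF facet_aff_dim mesh_facet_compact[OF mesh]] by blast

text \<open>Parallelism leaves only the normals \<open>(0, 1)\<close> and \<open>(0, -1)\<close>;
  the second would put interior points of \<open>K\<close> later than \<open>T\<close>. Two elements
  sharing such a facet would both have the first normal, contrary to opposite normals.\<close>

lemma top_facet:
  assumes K: "K \<in> \<K>" "F facet_of K" and F: "F \<subseteq> top_plane"
  shows "outer_normal K F = (0, 1)" "affine hull F = top_plane" "F \<notin> interior_facets \<K>"
proof -
  have normal: "outer_normal K F = (0, 1)" if K: "K \<in> \<K>" "F facet_of K" for K
  proof -
    obtain \<beta> where \<beta>: "norm (outer_normal K F) = 1"
      "F = K \<inter> {z. outer_normal K F \<bullet> z = \<beta>}" "affine hull F = {z. outer_normal K F \<bullet> z = \<beta>}"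
      "\<And>z. z \<in> interior K \<Longrightarrow> outer_normal K F \<bullet> z < \<beta>"
      using facet_hyperplane[OF mesh_polyhedron[OF mesh] mesh_interior[OF mesh], OF K(1) K(1) K(2)] by metis
    have "affine hull F \<subseteq> top_plane" by (rule hull_minimal[of F top_plane]) (use F affine_top_plane in auto)
    then have "(0, 1) = outer_normal K F \<or> (0, 1) = - outer_normal K F"
      unfolding \<beta>(3) top_plane_hyperplane using \<beta>(1)
      by (intro hyperplane_subset_imp_parallel) (auto simp: norm_Pair)
    moreover have "(0, 1) \<noteq> - outer_normal K F"
    proof
      assume "(0, 1) = - outer_normal K F"
      from arg_cong[OF this, of uminus] have n: "outer_normal K F = (0, -1)" by simp
      obtain w where w: "w \<in> interior K" using mesh_interior[OF mesh K(1)] by blast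
      obtain z where z: "z \<in> F" using K(2) by (auto simp: facet_of_def)
      have "snd z = T" using z F by blast
      moreover have "outer_normal K F \<bullet> z = \<beta>" using z \<beta>(2) by blast
      ultimately have "\<beta> = - T" by (simp add: n inner_prod_def)
      then have "snd w > T" using \<beta>(4)[OF w] by (simp add: n inner_prod_def)
      moreover have "w \<in> closure Q" using w interior_subset mesh_subset_closure[OF mesh K(1)] by blast
      ultimately show False using closure_Q_times[of w] by simp
    qed
    ultimately show ?thesis by simp
  qed
  show n: "outer_normal K F = (0, 1)" by (rule normal[OF K])
  show "F \<notin> interior_facets \<K>"
  proof
    assume "F \<in> interior_facets \<K>"
    note e = interior_facet_elems[OF mesh this]
    show False
      using mesh_shared_facet_normal[OF mesh e] normal[OF e(1,4)] normal[OF e(2,5)] by simp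
  qed
  obtain \<beta> where \<beta>: "F = K \<inter> {z. outer_normal K F \<bullet> z = \<beta>}" "affine hull F = {z. outer_normal K F \<bullet> z = \<beta>}"
    using facet_hyperplane[OF mesh_polyhedron[OF mesh] mesh_interior[OF mesh], OF K(1) K(1) K(2)] by metis
  obtain z where z: "z \<in> F" using K(2) by (auto simp: facet_of_def)
  have "snd z = T" using z F by blast
  moreover have "outer_normal K F \<bullet> z = \<beta>" using z \<beta>(1) by blast
  ultimately have "\<beta> = T" by (simp add: n inner_prod_def)
  then show "affine hull F = top_plane" using \<beta>(2) by (simp add: n inner_prod_def)
qed

section \<open>Derivatives and fluxes on the elements\<close>

lemma element_derivatives:
  assumes K: "K \<in> \<K>" and z: "z \<in> interior K"
  shows "v z = q K z" "nabla_x v z = gx K z" "dt v z = gt K z" "dt (nabla_x v) z = gxt K z"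
proof -
  have vK: "v y = q K y" if "y \<in> interior K" for y using vq[OF K] that interior_subset by blast
  then show "v z = q K z" using z by blast
  have gxK: "nabla_x v y = gx K y" if "y \<in> interior K" for y
    by (rule nabla_x_eq[OF open_interior that vK deriv_x[OF K]])
  then show "nabla_x v z = gx K z" using z by blast
  show "dt v z = gt K z"
    by (rule dt_eq[OF open_interior z vK])
      (use deriv_t[OF K] has_real_derivative_iff_has_vector_derivative in blast)+
  show "dt (nabla_x v) z = gxt K z"
    by (rule dt_eq[OF open_interior z gxK deriv_xt[OF K]])
qed

lemma element_divergence:
  assumes K: "K \<in> \<K>"
  shows "(LINT z:K|lebesgue. gt K z * q K z) =
      1/2 * (\<Sum>F | F facet_of K. snd (outer_normal K F) * facet_int F (\<lambda>z. (q K z)\<^sup>2))"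
    and "(LINT z:K|lebesgue. gxt K z \<bullet> gx K z) =
      1/2 * (\<Sum>F | F facet_of K. snd (outer_normal K F) * facet_int F (\<lambda>z. (norm (gx K z))\<^sup>2))"
proof -
  note P = mesh_polytope[OF mesh K] mesh_interior[OF mesh K]
  have "(LINT z:K|lebesgue. 2 * (gt K z * q K z)) =
      (\<Sum>F | F facet_of K. snd (outer_normal K F) * facet_int F (\<lambda>z. (q K z)\<^sup>2))"
  proof (rule divergence_theorem_time[OF P])
    show "((\<lambda>s. (q K (x, s))\<^sup>2) has_real_derivative 2 * (gt K (x, t) * q K (x, t))) (at t)" for x t
      using deriv_t[OF K, of "(x, t)"] by (auto intro!: derivative_eq_intros)
  qed (intro continuous_intros cont K)+
  then show "(LINT z:K|lebesgue. gt K z * q K z) =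
      1/2 * (\<Sum>F | F facet_of K. snd (outer_normal K F) * facet_int F (\<lambda>z. (q K z)\<^sup>2))"
    by simp
  have "(LINT z:K|lebesgue. 2 * (gxt K z \<bullet> gx K z)) =
      (\<Sum>F | F facet_of K. snd (outer_normal K F) * facet_int F (\<lambda>z. (norm (gx K z))\<^sup>2))"
  proof (rule divergence_theorem_time[OF P])
    show "((\<lambda>s. (norm (gx K (x, s)))\<^sup>2) has_real_derivative 2 * (gxt K (x, t) \<bullet> gx K (x, t))) (at t)" for x t
    proof -
      have d: "((\<lambda>s. gx K (x, s)) has_derivative (\<lambda>h. h *\<^sub>R gxt K (x, t))) (at t)"
        using deriv_xt[OF K, of "(x, t)"] by (simp add: has_vector_derivative_def)
      have "((\<lambda>s. gx K (x, s) \<bullet> gx K (x, s)) has_derivative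
          (\<lambda>h. gx K (x, t) \<bullet> (h *\<^sub>R gxt K (x, t)) + (h *\<^sub>R gxt K (x, t)) \<bullet> gx K (x, t))) (at t)"
        by (rule has_derivative_inner[OF d d])
      also have "(\<lambda>h. gx K (x, t) \<bullet> (h *\<^sub>R gxt K (x, t)) + (h *\<^sub>R gxt K (x, t)) \<bullet> gx K (x, t)) =
          (*) (2 * (gxt K (x, t) \<bullet> gx K (x, t)))"
        by (auto simp: inner_commute)
      finally show ?thesis by (simp add: has_field_derivative_def power2_norm_eq_inner)
    qed
  qed (intro continuous_intros cont K)+
  then show "(LINT z:K|lebesgue. gxt K z \<bullet> gx K z) =
      1/2 * (\<Sum>F | F facet_of K. snd (outer_normal K F) * facet_int F (\<lambda>z. (norm (gx K z))\<^sup>2))"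
    by simp
qed

lemma cont_on: "K \<in> \<K> \<Longrightarrow> continuous_on S (q K)" "K \<in> \<K> \<Longrightarrow> continuous_on S (gx K)"
  "K \<in> \<K> \<Longrightarrow> continuous_on S (gt K)" "K \<in> \<K> \<Longrightarrow> continuous_on S (gxt K)"
  using cont continuous_on_subset by blast+

lemma cont_at: "K \<in> \<K> \<Longrightarrow> continuous (at z within S) (q K)" "K \<in> \<K> \<Longrightarrow> continuous (at z within S) (gx K)"
  "K \<in> \<K> \<Longrightarrow> continuous (at z within S) (gt K)"
  by (meson cont UNIV_I continuous_on_eq_continuous_within continuous_within_subset subset_UNIV)+

text \<open>Prepares the volume part of \<open>a_h\<close> with \<open>a\<close> as
  \<open>\<theta> * h\<close>: the product of \<open>v\<close> and its time derivative stays an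
  element sum for the divergence theorem, the squares become norms.\<close>

lemma volume_terms:
  shows "(LINT z:Q|lebesgue. dt v z * (v z + a * dt v z) + nabla_x v z \<bullet> nabla_x v z) =
    (\<Sum>K\<in>\<K>. LINT z:K|lebesgue. gt K z * q K z) + a * (L2_norm_on lebesgue Q (dt v))\<^sup>2
      + (L2_norm_on lebesgue Q (nabla_x v))\<^sup>2"
    and "(L2_norm_on lebesgue Q (nabla_x v))\<^sup>2 = (\<Sum>K\<in>\<K>. LINT z:K|lebesgue. (norm (gx K z))\<^sup>2)"
    and "(\<Sum>K\<in>\<K>. LINT z:K|lebesgue. dt (nabla_x v) z \<bullet> nabla_x v z) =
      (\<Sum>K\<in>\<K>. LINT z:K|lebesgue. gxt K z \<bullet> gx K z)"
proof -
  have int: "set_integrable lebesgue K f" if "K \<in> \<K>" "continuous_on K f" for K and f :: "_ \<Rightarrow> real"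
    using borel_integrable_compact[OF mesh_compact[OF mesh that(1)] that(2)]
    by (simp add: set_integrable_def integrable_completion)
  show x: "(L2_norm_on lebesgue Q (nabla_x v))\<^sup>2 = (\<Sum>K\<in>\<K>. LINT z:K|lebesgue. (norm (gx K z))\<^sup>2)"
    unfolding L2_norm_on_squared
    by (rule set_integral_mesh[OF mesh lipschitz])
      (auto simp: element_derivatives intro!: continuous_intros cont_on)
  have t: "(L2_norm_on lebesgue Q (dt v))\<^sup>2 = (\<Sum>K\<in>\<K>. LINT z:K|lebesgue. (norm (gt K z))\<^sup>2)"
    unfolding L2_norm_on_squared
    by (rule set_integral_mesh[OF mesh lipschitz])
      (auto simp: element_derivatives intro!: continuous_intros cont_on)
  have "(LINT z:Q|lebesgue. dt v z * (v z + a * dt v z) + nabla_x v z \<bullet> nabla_x v z) =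
    (\<Sum>K\<in>\<K>. LINT z:K|lebesgue. (gt K z * q K z + a * (norm (gt K z))\<^sup>2) + (norm (gx K z))\<^sup>2)"
    by (rule set_integral_mesh[OF mesh lipschitz])
      (auto simp: element_derivatives power2_norm_eq_inner distrib_left mult.left_commute
        power2_eq_square[of "gt K z" for K z] intro!: continuous_intros cont_on)
  also have "\<dots> = (\<Sum>K\<in>\<K>. (LINT z:K|lebesgue. gt K z * q K z)
      + a * (LINT z:K|lebesgue. (norm (gt K z))\<^sup>2) + (LINT z:K|lebesgue. (norm (gx K z))\<^sup>2))"
  proof (rule sum.cong[OF refl])
    fix K assume K: "K \<in> \<K>"
    have 1: "set_integrable lebesgue K (\<lambda>z. gt K z * q K z)"
      "set_integrable lebesgue K (\<lambda>z. a * (norm (gt K z))\<^sup>2)"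
      "set_integrable lebesgue K (\<lambda>z. (norm (gx K z))\<^sup>2)"
      using K by (auto intro!: int continuous_intros cont_on)
    show "(LINT z:K|lebesgue. (gt K z * q K z + a * (norm (gt K z))\<^sup>2) + (norm (gx K z))\<^sup>2) =
      (LINT z:K|lebesgue. gt K z * q K z)
      + a * (LINT z:K|lebesgue. (norm (gt K z))\<^sup>2) + (LINT z:K|lebesgue. (norm (gx K z))\<^sup>2)"
      using set_integral_add(2)[OF set_integral_add(1)[OF 1(1,2)] 1(3)] set_integral_add(2)[OF 1(1,2)]
      by simp
  qed
  finally show "(LINT z:Q|lebesgue. dt v z * (v z + a * dt v z) + nabla_x v z \<bullet> nabla_x v z) =
    (\<Sum>K\<in>\<K>. LINT z:K|lebesgue. gt K z * q K z) + a * (L2_norm_on lebesgue Q (dt v))\<^sup>2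
      + (L2_norm_on lebesgue Q (nabla_x v))\<^sup>2"
    by (simp add: x t sum.distrib sum_distrib_left)
  show "(\<Sum>K\<in>\<K>. LINT z:K|lebesgue. dt (nabla_x v) z \<bullet> nabla_x v z) =
      (\<Sum>K\<in>\<K>. LINT z:K|lebesgue. gxt K z \<bullet> gx K z)"
    by (intro sum.cong refl set_integral_element[OF mesh])
      (auto simp: element_derivatives intro!: continuous_intros cont_on)
qed

end

section \<open>Interior facets and upwinding\<close>

text \<open>Polarisation: \<open>a \<bullet> (a - b)\<close> is half of the difference of squared
  norms plus half the squared norm of \<open>a - b\<close>, while \<open>b \<bullet> (a - b)\<close>
  has the last term with a minus sign. Taking \<open>b\<close> exactly when \<open>n < 0\<close>
  turns the factor of that term into the absolute value of \<open>n\<close>.\<close>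

lemma upwind_jump_bound:
  fixes a b :: "'a::real_inner"
  assumes "\<bar>n\<bar> \<le> 1"
  shows "1/2 * (n * (norm a)\<^sup>2 - n * (norm b)\<^sup>2) + 1/2 * (norm (n *\<^sub>R (a - b)))\<^sup>2
    \<le> (if 0 \<le> n then a else b) \<bullet> (n *\<^sub>R (a - b))"
proof -
  define D where "D = (norm (a - b))\<^sup>2"
  have D: "D = (norm a)\<^sup>2 - 2 * (a \<bullet> b) + (norm b)\<^sup>2"
    unfolding D_def power2_norm_eq_inner by (simp add: inner_diff inner_commute)
  have "n\<^sup>2 \<le> \<bar>n\<bar>" using assms by (metis abs_ge_zero mult_left_le power2_abs power2_eq_square)
  then have "n\<^sup>2 * D \<le> \<bar>n\<bar> * D" by (intro mult_right_mono) (simp_all add: D_def)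
  moreover have "(norm (n *\<^sub>R (a - b)))\<^sup>2 = n\<^sup>2 * D" by (simp add: D_def power_mult_distrib)
  moreover have "(if 0 \<le> n then a else b) \<bullet> (n *\<^sub>R (a - b)) =
     1/2 * (n * (norm a)\<^sup>2 - n * (norm b)\<^sup>2) + 1/2 * (\<bar>n\<bar> * D)"
    unfolding D power2_norm_eq_inner
    by (cases "0 \<le> n") (simp_all add: inner_diff inner_commute algebra_simps)
  ultimately show ?thesis by simp
qed

context mesh_function
begin

lemma trace_interior:
  assumes K: "K \<in> \<K>" "z \<in> K"
  shows "trace_from (interior K) (nabla_x v) z = gx K z" "trace_from (interior K) (dt v) z = gt K z"
proof -
  have z: "z \<in> closure (interior K)" using K mesh_closure_interior[OF mesh] by simp
  show "trace_from (interior K) (nabla_x v) z = gx K z"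
    by (rule trace_from_eq[OF open_interior z zero_less_one])
      (use K cont_at element_derivatives in auto)
  show "trace_from (interior K) (dt v) z = gt K z"
    by (rule trace_from_eq[OF open_interior z zero_less_one])
      (use K cont_at element_derivatives in auto)
qed

text \<open>The pointwise upwind estimate for the two one-sided gradients, integrated over the
  facet. The two cancelling average terms are written out because \<open>a_h\<close> produces them
  in this form when its arguments coincide.\<close>

lemma interior_facet_term:
  assumes F: "F \<in> interior_facets \<K>"
  shows "1/2 * (snd (outer_normal (elem_i \<K> F) F) * facet_int F (\<lambda>z. (norm (gx (elem_i \<K> F) z))\<^sup>2)
        + snd (outer_normal (elem_j \<K> F) F) * facet_int F (\<lambda>z. (norm (gx (elem_j \<K> F) z))\<^sup>2))
      + 1/2 * (L2_norm_on (flat_measure F) F (jump_t \<K> F (nabla_x v)))\<^sup>2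
      + \<delta> * (L2_norm_on (flat_measure F) F (jump_x \<K> F (dt v)))\<^sup>2
    \<le> facet_int F (\<lambda>z. avg_up \<K> F (nabla_x v) z \<bullet> jump_t \<K> F (nabla_x v) z
         - avg \<K> F (nabla_x v) z \<bullet> jump_x \<K> F (dt v) z
         + avg \<K> F (nabla_x v) z \<bullet> jump_x \<K> F (dt v) z
         + \<delta> * (jump_x \<K> F (dt v) z \<bullet> jump_x \<K> F (dt v) z))"
proof -
  define Ki Kj where "Ki = elem_i \<K> F" and "Kj = elem_j \<K> F"
  note e = interior_facet_elems[OF mesh F, folded Ki_def Kj_def]
  define n m where "n = snd (outer_normal Ki F)" and "m = fst (outer_normal Ki F)"
  have nj: "outer_normal Kj F = - outer_normal Ki F" by (rule mesh_shared_facet_normal[OF mesh e])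
  have n1: "\<bar>n\<bar> \<le> 1" unfolding n_def by (rule facet_normal_time[OF e(1,4)])
  have FK: "z \<in> Ki" "z \<in> Kj" if "z \<in> F" for z
    using that e(4,5) facet_of_imp_subset by blast+
  define J where "J = (\<lambda>z. n *\<^sub>R (gx Ki z - gx Kj z))"
  define X where "X = (\<lambda>z. (gt Ki z - gt Kj z) *\<^sub>R m)"
  define U where "U = (\<lambda>z. if 0 \<le> n then gx Ki z else gx Kj z)"
  have jt: "jump_t \<K> F (nabla_x v) z = J z" if "z \<in> F" for z
    using FK[OF that] e
    by (simp add: jump_t_def J_def normal_j_def normal_i_def trace_i_def trace_j_def trace_interior
        Ki_def[symmetric] Kj_def[symmetric] n_def scaleR_diff_right)
  have jx: "jump_x \<K> F (dt v) z = X z" if "z \<in> F" for z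
    using FK[OF that] e
    by (simp add: jump_x_def X_def normal_j_def normal_i_def trace_i_def trace_j_def trace_interior
        Ki_def[symmetric] Kj_def[symmetric] m_def scaleR_diff_left)
  have up: "avg_up \<K> F (nabla_x v) z = U z" if "z \<in> F" for z
    using FK[OF that] e
    by (simp add: avg_up_def U_def normal_i_def trace_i_def trace_j_def trace_interior
        Ki_def[symmetric] Kj_def[symmetric] n_def)
  have Fb: "F \<in> sets (flat_measure F)"
    using borel_closed[OF compact_imp_closed[OF mesh_facet_compact[OF mesh e(1,4)]]] by simp
  note si = facet_set_integrable[OF e(1,4)]
  have int: "set_integrable (flat_measure F) F (\<lambda>z. (norm (gx Ki z))\<^sup>2)"
      "set_integrable (flat_measure F) F (\<lambda>z. (norm (gx Kj z))\<^sup>2)"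
      "set_integrable (flat_measure F) F (\<lambda>z. (norm (J z))\<^sup>2)"
      "set_integrable (flat_measure F) F (\<lambda>z. (norm (X z))\<^sup>2)"
    unfolding J_def X_def by (intro si continuous_intros cont_on e)+
  have intU: "set_integrable (flat_measure F) F (\<lambda>z. U z \<bullet> J z + \<delta> * (norm (X z))\<^sup>2)"
    unfolding J_def X_def U_def by (cases "0 \<le> n") (auto intro!: si continuous_intros cont_on e)
  define f1 where "f1 = (\<lambda>z. n/2 * (norm (gx Ki z))\<^sup>2 - n/2 * (norm (gx Kj z))\<^sup>2)"
  define f2 where "f2 = (\<lambda>z. 1/2 * (norm (J z))\<^sup>2 + \<delta> * (norm (X z))\<^sup>2)"
  have f1: "set_integrable (flat_measure F) F f1"
    "facet_int F f1 = n/2 * facet_int F (\<lambda>z. (norm (gx Ki z))\<^sup>2) - n/2 * facet_int F (\<lambda>z. (norm (gx Kj z))\<^sup>2)"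
    unfolding f1_def using int(1,2) by (simp_all add: set_integral_diff)
  have f2: "set_integrable (flat_measure F) F f2"
    "facet_int F f2 = 1/2 * facet_int F (\<lambda>z. (norm (J z))\<^sup>2) + \<delta> * facet_int F (\<lambda>z. (norm (X z))\<^sup>2)"
    unfolding f2_def using int(3,4) by (simp_all add: set_integral_add)
  have "facet_int F (\<lambda>z. f1 z + f2 z) \<le> facet_int F (\<lambda>z. U z \<bullet> J z + \<delta> * (norm (X z))\<^sup>2)"
  proof (rule set_integral_mono[OF set_integral_add(1)[OF f1(1) f2(1)] intU])
    fix z
    show "f1 z + f2 z \<le> U z \<bullet> J z + \<delta> * (norm (X z))\<^sup>2"
      using upwind_jump_bound[OF n1, of "gx Ki z" "gx Kj z"]
      by (simp add: f1_def f2_def U_def J_def algebra_simps)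
  qed
  also have "\<dots> = facet_int F (\<lambda>z. avg_up \<K> F (nabla_x v) z \<bullet> jump_t \<K> F (nabla_x v) z
         - avg \<K> F (nabla_x v) z \<bullet> jump_x \<K> F (dt v) z
         + avg \<K> F (nabla_x v) z \<bullet> jump_x \<K> F (dt v) z
         + \<delta> * (jump_x \<K> F (dt v) z \<bullet> jump_x \<K> F (dt v) z))"
    by (rule set_lebesgue_integral_cong[OF Fb]) (simp add: jt jx up power2_norm_eq_inner)
  finally have *: "facet_int F f1 + facet_int F f2 \<le> facet_int F (\<lambda>z. avg_up \<K> F (nabla_x v) z \<bullet> jump_t \<K> F (nabla_x v) z
         - avg \<K> F (nabla_x v) z \<bullet> jump_x \<K> F (dt v) z
         + avg \<K> F (nabla_x v) z \<bullet> jump_x \<K> F (dt v) z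
         + \<delta> * (jump_x \<K> F (dt v) z \<bullet> jump_x \<K> F (dt v) z))"
    by (simp add: set_integral_add(2)[OF f1(1) f2(1)])
  have Jn: "(L2_norm_on (flat_measure F) F (jump_t \<K> F (nabla_x v)))\<^sup>2 = facet_int F (\<lambda>z. (norm (J z))\<^sup>2)"
    unfolding L2_norm_on_squared by (rule set_lebesgue_integral_cong[OF Fb]) (simp add: jt)
  have Xn: "(L2_norm_on (flat_measure F) F (jump_x \<K> F (dt v)))\<^sup>2 = facet_int F (\<lambda>z. (norm (X z))\<^sup>2)"
    unfolding L2_norm_on_squared by (rule set_lebesgue_integral_cong[OF Fb]) (simp add: jx)
  show ?thesis
    unfolding Jn Xn Ki_def[symmetric] Kj_def[symmetric] nj
    using * by (simp add: f1(2) f2(2) n_def algebra_simps)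
qed

section \<open>Boundary facets and traces on the top\<close>

definition frontier_rest :: "((real^'d) \<times> real) set" where
  "frontier_rest = frontier Q - (lateral_bd \<Omega> T \<union> bottom_bd \<Omega> \<union> top_bd \<Omega> T)"

lemma surface_null_frontier_rest: "surface_null frontier_rest"
  using dom by (simp add: space_time_domain_def frontier_rest_def)

text \<open>The facet meets the top plane in lower dimension. Almost every point of it thus lies on
  the lateral or bottom part and has zero Sobolev trace, so continuity gives
  \<open>v z = 0\<close>.\<close>

lemma boundary_facet_vanish:
  assumes K: "K \<in> \<K>" "F facet_of K" and F: "F \<notin> interior_facets \<K>" "\<not> F \<subseteq> top_plane"
  shows "facet_int F (\<lambda>z. (q K z)\<^sup>2) = 0"
proof -
  have sub: "F \<subseteq> frontier Q" by (rule boundary_facet_subset_frontier[OF mesh open_Q K F(1)])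
  have vc: "continuous_on (closure Q) v" using v by (simp add: V0h_def Vh_def)
  have tr: "surface_null {z \<in> lateral_bd \<Omega> T. \<not> has_trace Q v z 0}"
    "surface_null {z \<in> bottom_bd \<Omega>. \<not> has_trace Q v z 0}"
    using v by (auto simp: V0h_def H11_00_def zero_trace_on_def)
  note dF = facet_aff_dim[OF K]
  have low: "aff_dim (F \<inter> top_plane) < CARD('d)"
    using aff_dim_Int_affine_less[OF affine_top_plane F(2)] dF by simp
  have "AE z in flat_measure F. indicator F z *\<^sub>R (q K z)\<^sup>2 = 0"
    using AE_flat_measure_surface_null[OF dF surface_null_frontier_rest]
      AE_flat_measure_surface_null[OF dF tr(1)] AE_flat_measure_surface_null[OF dF tr(2)]
      AE_flat_measure_lowdim[OF dF low]
  proof eventually_elim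
    case (elim z)
    show ?case
    proof (cases "z \<in> F")
      case True
      then have zf: "z \<in> frontier Q" using sub by blast
      have "z \<notin> top_bd \<Omega> T" using elim(4) True by (auto simp: top_bd_def)
      then have "z \<in> lateral_bd \<Omega> T \<or> z \<in> bottom_bd \<Omega>"
        using zf elim(1) by (auto simp: frontier_rest_def)
      then have "has_trace Q v z 0" using elim(2,3) by blast
      moreover have "z \<in> closure Q" using zf by (simp add: frontier_def)
      ultimately have "v z = 0" using has_trace_0_imp_eq_0[OF open_Q bounded_Q _ vc] by blast
      moreover have "z \<in> K" using True K(2) facet_of_imp_subset by blast
      ultimately show ?thesis using vq[OF K(1)] by simp
    qed simp
  qed
  then show ?thesis unfolding set_lebesgue_integral_def by (rule integral_eq_zero_AE)
qed

text \<open>Below a relative interior point the half ball before time \<open>T\<close> lies in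
  \<open>K\<close>, and \<open>Q\<close> lies before \<open>T\<close>. Near \<open>z\<close> the
  whole of \<open>Q\<close> is therefore inside one element, and the trace sees a single
  polynomial.\<close>

lemma top_facet_traces:
  assumes K: "K \<in> \<K>" "F facet_of K" and F: "F \<subseteq> top_plane" and z: "z \<in> rel_interior F"
  shows "trace_from Q (nabla_x v) z = gx K z" "trace_from Q v z = q K z"
proof -
  note n = top_facet(1)[OF K F]
  obtain r where r: "r > 0" "ball z r \<inter> {y. outer_normal K F \<bullet> y \<le> outer_normal K F \<bullet> z} \<subseteq> K"
    using facet_half_ball[OF mesh_polyhedron[OF mesh K(1)] mesh_interior[OF mesh K(1)] K(2) z] by blast
  have zF: "z \<in> F" using z rel_interior_subset by blast
  then have zT: "snd z = T" using F by blast
  have zQ: "z \<in> closure Q" using zF facet_subset_closure[OF K] by blast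
  have "open {y :: (real^'d) \<times> real. snd y < T}"
    by (intro open_Collect_less continuous_intros)
  then have "open (ball z r \<inter> {y. snd y < T})" by (intro open_Int open_ball)
  moreover have "ball z r \<inter> {y. snd y < T} \<subseteq> K"
    using r(2) zT by (auto simp: n inner_prod_def)
  ultimately have "ball z r \<inter> {y. snd y < T} \<subseteq> interior K" by (rule interior_maximal[rotated])
  then have int: "y \<in> interior K" if "y \<in> Q" "dist y z < r" for y
    using that Q_times[OF that(1)] by (auto simp: dist_commute)
  show "trace_from Q (nabla_x v) z = gx K z"
    by (rule trace_from_eq[OF open_Q zQ r(1)]) (use K(1) cont_at element_derivatives int in auto)
  show "trace_from Q v z = q K z"
    by (rule trace_from_eq[OF open_Q zQ r(1)]) (use K(1) cont_at element_derivatives int in auto)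
qed

text \<open>Almost every point of \<open>\<Sigma>\<^sub>T\<close> lies in the relative interior of exactly one boundary facet.\<close>

lemma top_integral:
  fixes g :: "((real^'d) \<times> real) set \<Rightarrow> (real^'d) \<times> real \<Rightarrow> real"
  assumes meas: "(\<lambda>z. indicator (top_bd \<Omega> T) z *\<^sub>R G z) \<in> borel_measurable borel"
    and Gg: "\<And>K F z. K \<in> \<K> \<Longrightarrow> F facet_of K \<Longrightarrow> F \<subseteq> top_plane \<Longrightarrow> z \<in> rel_interior F \<Longrightarrow> G z = g K z"
    and g: "\<And>K. K \<in> \<K> \<Longrightarrow> continuous_on UNIV (g K)"
  shows "(LINT z:top_bd \<Omega> T|flat_measure (top_bd \<Omega> T). G z) =
    (\<Sum>K\<in>\<K>. \<Sum>F | F facet_of K \<and> F \<notin> interior_facets \<K>. if F \<subseteq> top_plane then facet_int F (g K) else 0)"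
proof -
  define M where "M = flat_measure (top_bd \<Omega> T)"
  define h where "h = (\<lambda>K F z. if F \<subseteq> top_plane then indicator F z *\<^sub>R g K z else 0)"
  have fin: "finite {F. F facet_of K \<and> F \<notin> interior_facets \<K>}" if "K \<in> \<K>" for K
    using mesh_finite_facets[OF mesh that] by simp
  \<comment> \<open>All facets in the top plane carry the measure of
    \<open>\<Sigma>\<^sub>T\<close>, which allows summing their integrands before
    integrating.\<close>
  have M: "flat_measure F = M" if "K \<in> \<K>" "F facet_of K" "F \<subseteq> top_plane" for K F
    unfolding M_def by (rule flat_measure_cong_hull) (simp add: top_facet(2)[OF that] affine_hull_top)
  have inth: "integrable M (h K F)" if K: "K \<in> \<K>" "F facet_of K" for K F
  proof (cases "F \<subseteq> top_plane")
    case True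
    then show ?thesis
      using facet_set_integrable[OF K continuous_on_subset[OF g[OF K(1)]]]
      by (simp add: h_def set_integrable_def M[OF K True])
  qed (simp add: h_def)
  \<comment> \<open>Removes the relative boundaries of top facets and the points where other facets
    merely touch the top plane.\<close>
  have AE0: "AE z in M. \<forall>K\<in>\<K>. \<forall>F\<in>{F. F facet_of K}. z \<in> F \<and> snd z = T \<longrightarrow> F \<subseteq> top_plane \<and> z \<in> rel_interior F"
  proof (intro AE_finite_allI mesh_finite[OF mesh] mesh_finite_facets[OF mesh])
    fix K F assume K: "K \<in> \<K>" "F \<in> {F. F facet_of K}"
    then have F: "F facet_of K" by simp
    show "AE z in M. z \<in> F \<and> snd z = T \<longrightarrow> F \<subseteq> top_plane \<and> z \<in> rel_interior F"
    proof (cases "F \<subseteq> top_plane")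
      case True
      have pF: "polytope F"
        using F mesh_polytope[OF mesh K(1)] face_of_polytope_polytope facet_of_imp_face_of by blast
      have "AE z in M. \<forall>E\<in>{E. E facet_of F}. z \<notin> E"
      proof (intro AE_finite_allI finite_polytope_facets pF)
        fix E assume "E \<in> {E. E facet_of F}"
        then have "aff_dim E < CARD('d)" using facet_aff_dim[OF K(1) F] by (simp add: facet_of_def)
        then show "AE z in M. z \<notin> E" unfolding M_def by (rule AE_flat_measure_lowdim[OF aff_dim_top])
      qed
      then show ?thesis
      proof eventually_elim
        case (elim z)
        have "z \<in> rel_interior F" if zF: "z \<in> F"
        proof (rule ccontr)
          assume "z \<notin> rel_interior F"
          then have "z \<in> rel_frontier F" using zF closure_subset by (auto simp: rel_frontier_def)
          then show False
            using elim rel_frontier_of_polyhedron[OF polytope_imp_polyhedron[OF pF]] by auto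
        qed
        then show ?case using True by blast
      qed
    next
      case False
      have "aff_dim (F \<inter> top_plane) < CARD('d)"
        using aff_dim_Int_affine_less[OF affine_top_plane False] facet_aff_dim[OF K(1) F] by simp
      from AE_flat_measure_lowdim[OF aff_dim_top this]
      have "AE z in M. z \<notin> F \<inter> top_plane" unfolding M_def .
      then show ?thesis by eventually_elim auto
    qed
  qed
  have AE1: "AE z in M. z \<notin> frontier_rest"
    unfolding M_def by (rule AE_flat_measure_surface_null[OF aff_dim_top surface_null_frontier_rest])
  have eq: "indicator (top_bd \<Omega> T) z *\<^sub>R G z = (\<Sum>K\<in>\<K>. \<Sum>F | F facet_of K \<and> F \<notin> interior_facets \<K>. h K F z)"
    if good: "\<forall>K\<in>\<K>. \<forall>F\<in>{F. F facet_of K}. z \<in> F \<and> snd z = T \<longrightarrow> F \<subseteq> top_plane \<and> z \<in> rel_interior F"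
      and rest: "z \<notin> frontier_rest" for z
  proof (cases "z \<in> top_bd \<Omega> T")
    case True
    then have zT: "snd z = T" by (auto simp: top_bd_def)
    have zf: "z \<in> frontier Q" using True top_frontier by blast
    then have "z \<in> \<Union>\<K>" using mesh_Union[OF mesh] by (simp add: frontier_def)
    then obtain K0 where K0: "K0 \<in> \<K>" "z \<in> K0" by blast
    have "z \<notin> Q" using zf open_Q by (simp add: frontier_def interior_open)
    then have "z \<notin> interior K0" using mesh_interior_subset[OF mesh lipschitz K0(1)] by blast
    then have "z \<in> rel_frontier K0"
      using K0 mesh_interior[OF mesh K0(1)] subsetD[OF closure_subset K0(2)]
      by (simp add: rel_frontier_nonempty_interior frontier_def)
    then obtain F0 where F0: "F0 facet_of K0" "z \<in> F0"
      unfolding rel_frontier_of_polyhedron[OF mesh_polyhedron[OF mesh K0(1)]] by auto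
    have F0': "F0 \<subseteq> top_plane" "z \<in> rel_interior F0" using good K0(1) F0 zT by auto
    \<comment> \<open>All facets in the top plane have normal \<open>(0, 1)\<close>, so two of them
      with a common relative interior point belong to the same element and agree.\<close>
    have uniq: "K = K0 \<and> F = F0" if K: "K \<in> \<K>" "F facet_of K" and zF: "z \<in> F" for K F
    proof -
      have F: "F \<subseteq> top_plane" "z \<in> rel_interior F" using good K zF zT by auto
      have "outer_normal K F = outer_normal K0 F0"
        using top_facet(1)[OF K F(1)] top_facet(1)[OF K0(1) F0(1) F0'(1)] by simp
      then show ?thesis
        using mesh_same_normal_imp_eq[OF mesh K F(2) K0(1) F0(1) F0'(2)] by blast
    qed
    have "(\<Sum>K\<in>\<K>. \<Sum>F | F facet_of K \<and> F \<notin> interior_facets \<K>. h K F z) =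
      (\<Sum>K\<in>\<K>. if K = K0 then (\<Sum>F | F facet_of K0 \<and> F \<notin> interior_facets \<K>. if F = F0 then g K0 z else 0) else 0)"
    proof (rule sum.cong[OF refl])
      fix K assume K: "K \<in> \<K>"
      show "(\<Sum>F | F facet_of K \<and> F \<notin> interior_facets \<K>. h K F z) =
        (if K = K0 then (\<Sum>F | F facet_of K0 \<and> F \<notin> interior_facets \<K>. if F = F0 then g K0 z else 0) else 0)"
      proof (cases "K = K0")
        case True
        have "h K0 F z = (if F = F0 then g K0 z else 0)" if "F facet_of K0" for F
        proof (cases "F = F0")
          case False
          then have "z \<notin> F" using uniq[OF K0(1) that] by blast
          then show ?thesis using False by (simp add: h_def)
        qed (use F0(2) F0'(1) in \<open>simp add: h_def\<close>)
        then show ?thesis using True by (auto intro!: sum.cong)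
      next
        case False
        then have "h K F z = 0" if "F facet_of K" for F
        proof -
          have "z \<notin> F" using uniq[OF K that] False by blast
          then show ?thesis by (simp add: h_def)
        qed
        then show ?thesis using False by (auto intro!: sum.neutral)
      qed
    qed
    also have "\<dots> = g K0 z"
      using K0(1) F0(1) top_facet(3)[OF K0(1) F0(1) F0'(1)] mesh_finite[OF mesh] fin[OF K0(1)] by simp
    also have "\<dots> = G z" by (rule Gg[OF K0(1) F0(1) F0', symmetric])
    finally show ?thesis using True by simp
  next
    case False
    \<comment> \<open>A top facet lies in the frontier of \<open>Q\<close> and can leave
      \<open>\<Sigma>\<^sub>T\<close> only through the exceptional set, as the other two parts have
      times below \<open>T\<close>.\<close>
    have "h K F z = 0" if K: "K \<in> \<K>" "F facet_of K" for K F
    proof (rule ccontr)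
      assume "h K F z \<noteq> 0"
      then have F: "F \<subseteq> top_plane" "z \<in> F" by (auto simp: h_def indicator_def split: if_splits)
      then have zT: "snd z = T" by blast
      then have "z \<notin> Q" using Q_times[of z] by auto
      moreover have "z \<in> closure Q" using F(2) facet_subset_closure[OF K] by blast
      ultimately have "z \<in> frontier Q" using open_Q by (simp add: frontier_def interior_open)
      moreover have "z \<notin> lateral_bd \<Omega> T" "z \<notin> bottom_bd \<Omega>"
        using zT T by (auto simp: lateral_bd_def bottom_bd_def)
      ultimately show False using rest False by (auto simp: frontier_rest_def)
    qed
    then show ?thesis using False by simp
  qed
  have "(LINT z:top_bd \<Omega> T|flat_measure (top_bd \<Omega> T). G z) =
      (LINT z|M. (\<Sum>K\<in>\<K>. \<Sum>F | F facet_of K \<and> F \<notin> interior_facets \<K>. h K F z))"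
    unfolding set_lebesgue_integral_def M_def[symmetric]
  proof (rule integral_cong_AE)
    show "(\<lambda>z. indicator (top_bd \<Omega> T) z *\<^sub>R G z) \<in> borel_measurable M"
      using meas by (simp add: M_def measurable_cong_sets[OF sets_flat_measure refl])
    show "(\<lambda>z. \<Sum>K\<in>\<K>. \<Sum>F | F facet_of K \<and> F \<notin> interior_facets \<K>. h K F z) \<in> borel_measurable M"
      by (intro borel_measurable_sum borel_measurable_integrable inth) auto
    show "AE z in M. indicator (top_bd \<Omega> T) z *\<^sub>R G z = (\<Sum>K\<in>\<K>. \<Sum>F | F facet_of K \<and> F \<notin> interior_facets \<K>. h K F z)"
      using AE0 AE1 by eventually_elim (rule eq)
  qed
  also have "\<dots> = (\<Sum>K\<in>\<K>. \<Sum>F | F facet_of K \<and> F \<notin> interior_facets \<K>. (LINT z|M. h K F z))"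
    using inth by (subst Bochner_Integration.integral_sum) (auto intro!: sum.cong Bochner_Integration.integral_sum)
  also have "\<dots> = (\<Sum>K\<in>\<K>. \<Sum>F | F facet_of K \<and> F \<notin> interior_facets \<K>. if F \<subseteq> top_plane then facet_int F (g K) else 0)"
    by (intro sum.cong refl) (auto simp: h_def set_lebesgue_integral_def M)
  finally show ?thesis .
qed

section \<open>The inverse inequality applied to the gradient\<close>

lemma diameter_pos: "K \<in> \<K> \<Longrightarrow> diameter K > 0"
proof -
  assume K: "K \<in> \<K>"
  obtain z where "z \<in> interior K" using mesh_interior[OF mesh K] by blast
  then obtain e where e: "e > 0" "cball z e \<subseteq> K" by (meson mem_interior_cball)
  have "diameter (cball z e) \<le> diameter K"
    by (intro diameter_subset e compact_imp_bounded mesh_compact[OF mesh K])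
  then show "diameter K > 0" using e(1) by (simp add: diameter_cball)
qed

text \<open>The partial derivatives of \<open>q K\<close> are global polynomials, hence members of \<open>V\<^sub>h\<close>.\<close>

lemma boundary_gradient_bound:
  assumes inv: "inverse_inequality C Q p \<K>" and K: "K \<in> \<K>"
  shows "(\<Sum>F | F facet_of K. facet_int F (\<lambda>z. (norm (gx K z))\<^sup>2)) \<le>
    C\<^sup>2 / diameter K * (LINT z:K|lebesgue. (norm (gx K z))\<^sup>2)"
proof -
  have nsq: "(norm (gx K z))\<^sup>2 = (\<Sum>i\<in>UNIV. (gx K z $ i)\<^sup>2)" for z
    unfolding power2_norm_eq_inner inner_vec_def by (simp add: power2_eq_square)
  have ci: "continuous_on S (\<lambda>z. gx K z $ i)" for S i by (rule poly_fun_continuous[OF poly[OF K]])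
  \<comment> \<open>The inverse inequality is scalar, so it is applied to each component; squaring
    turns the exponent \<open>-1/2\<close> of the diameter into \<open>-1\<close>.\<close>
  have bd: "(\<Sum>F | F facet_of K. facet_int F (\<lambda>z. (gx K z $ i)\<^sup>2)) \<le>
      C\<^sup>2 / diameter K * (LINT z:K|lebesgue. (gx K z $ i)\<^sup>2)" for i
  proof -
    define f where "f = (\<lambda>z. gx K z $ i)"
    have "f \<in> Vh Q p \<K>"
      using poly[OF K, of i] ci by (auto simp: Vh_def f_def)
    then have le: "L2_norm_bd K f \<le> C * diameter K powr (-1/2) * L2_norm_on lebesgue K f"
      using inv K by (auto simp: inverse_inequality_def)
    have nonneg: "0 \<le> (\<Sum>F | F facet_of K. (L2_norm_on (flat_measure F) F f)\<^sup>2)"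
      by (intro sum_nonneg) auto
    have "(L2_norm_bd K f)\<^sup>2 \<le> (C * diameter K powr (-1/2) * L2_norm_on lebesgue K f)\<^sup>2"
      using le nonneg by (intro power_mono) (auto simp: L2_norm_bd_def)
    moreover have "(L2_norm_bd K f)\<^sup>2 = (\<Sum>F | F facet_of K. facet_int F (\<lambda>z. (f z)\<^sup>2))"
      using nonneg by (simp add: L2_norm_bd_def L2_norm_on_squared)
    moreover have "(C * diameter K powr (-1/2) * L2_norm_on lebesgue K f)\<^sup>2 =
        C\<^sup>2 / diameter K * (LINT z:K|lebesgue. (f z)\<^sup>2)"
    proof -
      have "(diameter K powr (-1/2))\<^sup>2 = 1 / diameter K"
        using diameter_pos[OF K] by (simp add: powr_minus_divide powr_half_sqrt power_divide)
      then show ?thesis by (simp add: power_mult_distrib L2_norm_on_squared)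
    qed
    ultimately show ?thesis by (simp add: f_def)
  qed
  have "(\<Sum>F | F facet_of K. facet_int F (\<lambda>z. (norm (gx K z))\<^sup>2)) =
      (\<Sum>F | F facet_of K. \<Sum>i\<in>UNIV. facet_int F (\<lambda>z. (gx K z $ i)\<^sup>2))"
  proof (rule sum.cong[OF refl])
    fix F assume "F \<in> {F. F facet_of K}"
    then have F: "F facet_of K" by simp
    have "set_integrable (flat_measure F) F (\<lambda>z. (gx K z $ i)\<^sup>2)" for i
      by (intro facet_set_integrable[OF K F] continuous_on_power ci)
    then show "facet_int F (\<lambda>z. (norm (gx K z))\<^sup>2) = (\<Sum>i\<in>UNIV. facet_int F (\<lambda>z. (gx K z $ i)\<^sup>2))"
      unfolding nsq set_lebesgue_integral_def scaleR_sum_right set_integrable_def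
      by (intro Bochner_Integration.integral_sum) auto
  qed
  also have "\<dots> = (\<Sum>i\<in>UNIV. \<Sum>F | F facet_of K. facet_int F (\<lambda>z. (gx K z $ i)\<^sup>2))"
    by (rule sum.swap)
  also have "\<dots> \<le> (\<Sum>i\<in>UNIV. C\<^sup>2 / diameter K * (LINT z:K|lebesgue. (gx K z $ i)\<^sup>2))"
    by (intro sum_mono bd)
  also have "\<dots> = C\<^sup>2 / diameter K * (LINT z:K|lebesgue. (norm (gx K z))\<^sup>2)"
  proof -
    have "set_integrable lebesgue K (\<lambda>z. (gx K z $ i)\<^sup>2)" for i
      using borel_integrable_compact[OF mesh_compact[OF mesh K], of "\<lambda>z. (gx K z $ i)\<^sup>2"] ci
      by (simp add: set_integrable_def integrable_completion continuous_on_power)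
    then have "(LINT z:K|lebesgue. (norm (gx K z))\<^sup>2) = (\<Sum>i\<in>UNIV. LINT z:K|lebesgue. (gx K z $ i)\<^sup>2)"
      unfolding nsq set_lebesgue_integral_def scaleR_sum_right set_integrable_def
      by (intro Bochner_Integration.integral_sum) auto
    then show ?thesis by (simp add: sum_distrib_left)
  qed
  finally show ?thesis .
qed

text \<open>Brings the norms on \<open>\<Sigma>\<^sub>T\<close> into the same shape as the boundary
  flux sums, for comparison facet by facet.\<close>

lemma top_norms:
  "(L2_norm_on (flat_measure (top_bd \<Omega> T)) (top_bd \<Omega> T) (trace_from Q v))\<^sup>2 =
    (\<Sum>K\<in>\<K>. \<Sum>F | F facet_of K \<and> F \<notin> interior_facets \<K>.
      if F \<subseteq> top_plane then facet_int F (\<lambda>z. (q K z)\<^sup>2) else 0)"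
  "(L2_norm_on (flat_measure (top_bd \<Omega> T)) (top_bd \<Omega> T) (trace_from Q (nabla_x v)))\<^sup>2 =
    (\<Sum>K\<in>\<K>. \<Sum>F | F facet_of K \<and> F \<notin> interior_facets \<K>.
      if F \<subseteq> top_plane then facet_int F (\<lambda>z. (norm (gx K z))\<^sup>2) else 0)"
proof -
  have ind: "indicator (top_bd \<Omega> T) z *\<^sub>R (norm w)\<^sup>2 = (norm (indicator (top_bd \<Omega> T) z *\<^sub>R w))\<^sup>2"
    for z and w :: "'b::real_normed_vector"
    by (simp add: indicator_def)
  have m: "(\<lambda>z. indicator (top_bd \<Omega> T) z *\<^sub>R (norm (trace_from Q f z))\<^sup>2) \<in> borel_measurable borel"
    for f :: "_ \<Rightarrow> 'b::euclidean_space"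
    unfolding ind
    by (intro borel_measurable_power measurable_compose[OF _ borel_measurable_norm]
        borel_measurable_trace_from[OF open_Q top_borel top_frontier])
  show "(L2_norm_on (flat_measure (top_bd \<Omega> T)) (top_bd \<Omega> T) (trace_from Q v))\<^sup>2 =
    (\<Sum>K\<in>\<K>. \<Sum>F | F facet_of K \<and> F \<notin> interior_facets \<K>.
      if F \<subseteq> top_plane then facet_int F (\<lambda>z. (q K z)\<^sup>2) else 0)"
    unfolding L2_norm_on_squared
    by (rule top_integral[OF m]) (auto simp: top_facet_traces intro!: continuous_intros cont_on)
  show "(L2_norm_on (flat_measure (top_bd \<Omega> T)) (top_bd \<Omega> T) (trace_from Q (nabla_x v)))\<^sup>2 =
    (\<Sum>K\<in>\<K>. \<Sum>F | F facet_of K \<and> F \<notin> interior_facets \<K>.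
      if F \<subseteq> top_plane then facet_int F (\<lambda>z. (norm (gx K z))\<^sup>2) else 0)"
    unfolding L2_norm_on_squared
    by (rule top_integral[OF m]) (auto simp: top_facet_traces intro!: continuous_intros cont_on)
qed

section \<open>Assembling the estimate\<close>

lemma coercivity:
  assumes C: "C > 0" "inverse_inequality C Q p \<K>"
    and Cu: "Cu > 0" "\<And>K. K \<in> \<K> \<Longrightarrow> diameter K \<le> mesh_size \<K>" "\<And>K. K \<in> \<K> \<Longrightarrow> mesh_size \<K> \<le> Cu * diameter K"
    and \<theta>: "\<theta> > 0" "\<theta> \<le> inverse (C\<^sup>2 * Cu\<^sup>2)" and \<delta>: "\<delta> > 0"
  shows "a_h \<Omega> T \<K> \<theta> \<delta> v v \<ge> 1/2 * (norm_h \<Omega> T \<K> \<theta> \<delta> v)\<^sup>2"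
proof -
  let ?\<Sigma> = "top_bd \<Omega> T"
  define a where "a = \<theta> * mesh_size \<K>"
  define nt :: "((real^'d) \<times> real) set \<Rightarrow> ((real^'d) \<times> real) set \<Rightarrow> real"
    where "nt = (\<lambda>K F. snd (outer_normal K F))"
  define S0 where "S0 = (\<lambda>K F. facet_int F (\<lambda>z. (q K z)\<^sup>2))"
  define S1 where "S1 = (\<lambda>K F. facet_int F (\<lambda>z. (norm (gx K z))\<^sup>2))"
  define E where "E = (\<lambda>K. LINT z:K|lebesgue. (norm (gx K z))\<^sup>2)"
  define X where "X = (L2_norm_on lebesgue Q (nabla_x v))\<^sup>2"
  define Y where "Y = (L2_norm_on lebesgue Q (dt v))\<^sup>2"
  define T0 where "T0 = (L2_norm_on (flat_measure ?\<Sigma>) ?\<Sigma> (trace_from Q v))\<^sup>2"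
  define T1 where "T1 = (L2_norm_on (flat_measure ?\<Sigma>) ?\<Sigma> (trace_from Q (nabla_x v)))\<^sup>2"
  define J where "J = (\<Sum>F\<in>interior_facets \<K>. (L2_norm_on (flat_measure F) F (jump_t \<K> F (nabla_x v)))\<^sup>2)"
  define Z where "Z = (\<Sum>F\<in>interior_facets \<K>. (L2_norm_on (flat_measure F) F (jump_x \<K> F (dt v)))\<^sup>2)"
  define I where "I = (\<Sum>F\<in>interior_facets \<K>. facet_int F (\<lambda>z.
        avg_up \<K> F (nabla_x v) z \<bullet> jump_t \<K> F (nabla_x v) z
         - avg \<K> F (nabla_x v) z \<bullet> jump_x \<K> F (dt v) z
         + avg \<K> F (nabla_x v) z \<bullet> jump_x \<K> F (dt v) z
         + \<delta> * (jump_x \<K> F (dt v) z \<bullet> jump_x \<K> F (dt v) z)))"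
  define B where "B = (\<lambda>K. {F. F facet_of K \<and> F \<notin> interior_facets \<K>})"
  \<comment> \<open>The flux of the squared gradient is split into \<open>N\<close>,
    \<open>T1\<close> and \<open>R\<close> because each share meets a different partner:
    \<open>N\<close> the upwind terms, \<open>T1\<close> the integral over
    \<open>\<Sigma>\<^sub>T\<close> in the form, \<open>R\<close> the gradient norm.\<close>
  define N where "N = (\<Sum>F\<in>interior_facets \<K>. nt (elem_i \<K> F) F * S1 (elem_i \<K> F) F
      + nt (elem_j \<K> F) F * S1 (elem_j \<K> F) F)"
  define R where "R = (\<Sum>K\<in>\<K>. \<Sum>F\<in>B K. if F \<subseteq> top_plane then 0 else nt K F * S1 K F)"
  have nonneg: "0 \<le> X" "0 \<le> Y" "0 \<le> T0" "0 \<le> T1" "0 \<le> J" "0 \<le> Z"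
    by (auto simp: X_def Y_def T0_def T1_def J_def Z_def intro: sum_nonneg)
  have B_eq: "{F. F facet_of K \<and> F \<notin> interior_facets \<K>} = B K" for K by (simp add: B_def)
  have S1_nonneg: "0 \<le> S1 K F" for K F
    unfolding S1_def set_lebesgue_integral_def by (rule Bochner_Integration.integral_nonneg) auto
  have E_nonneg: "0 \<le> E K" for K
    unfolding E_def set_lebesgue_integral_def by (rule Bochner_Integration.integral_nonneg) auto
  have top_nt: "nt K F = 1" if "K \<in> \<K>" "F \<in> B K" "F \<subseteq> top_plane" for K F
    using top_facet(1)[of K F] that by (simp add: nt_def B_def)

  have flux0: "(\<Sum>K\<in>\<K>. LINT z:K|lebesgue. gt K z * q K z) = 1/2 * T0"
  proof -
    have "(\<Sum>K\<in>\<K>. LINT z:K|lebesgue. gt K z * q K z) = 1/2 * (\<Sum>K\<in>\<K>. \<Sum>F | F facet_of K. nt K F * S0 K F)"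
      by (simp add: element_divergence(1) sum_distrib_left nt_def S0_def)
    also have "(\<Sum>K\<in>\<K>. \<Sum>F | F facet_of K. nt K F * S0 K F) =
      (\<Sum>F\<in>interior_facets \<K>. nt (elem_i \<K> F) F * S0 (elem_i \<K> F) F + nt (elem_j \<K> F) F * S0 (elem_j \<K> F) F)
      + (\<Sum>K\<in>\<K>. \<Sum>F\<in>B K. nt K F * S0 K F)"
      unfolding B_def by (rule sum_elements_facets[OF mesh])
    also have "(\<Sum>F\<in>interior_facets \<K>. nt (elem_i \<K> F) F * S0 (elem_i \<K> F) F + nt (elem_j \<K> F) F * S0 (elem_j \<K> F) F) = 0"
    proof (rule sum.neutral, rule ballI)
      fix F assume "F \<in> interior_facets \<K>"
      note e = interior_facet_elems[OF mesh this]
      have "F \<in> sets (flat_measure F)"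
        using borel_closed[OF compact_imp_closed[OF mesh_facet_compact[OF mesh e(1,4)]]] by simp
      moreover have "q (elem_i \<K> F) z = q (elem_j \<K> F) z" if "z \<in> F" for z
      proof -
        have "z \<in> elem_i \<K> F" "z \<in> elem_j \<K> F" using that e(4,5) facet_of_imp_subset by blast+
        then show ?thesis using vq[OF e(1)] vq[OF e(2)] by metis
      qed
      ultimately have "S0 (elem_i \<K> F) F = S0 (elem_j \<K> F) F"
        unfolding S0_def by (intro set_lebesgue_integral_cong) auto
      then show "nt (elem_i \<K> F) F * S0 (elem_i \<K> F) F + nt (elem_j \<K> F) F * S0 (elem_j \<K> F) F = 0"
        using mesh_shared_facet_normal[OF mesh e] by (simp add: nt_def)
    qed
    also have "(\<Sum>K\<in>\<K>. \<Sum>F\<in>B K. nt K F * S0 K F) = T0"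
      unfolding T0_def top_norms B_eq
    proof (intro sum.cong refl)
      fix K F assume K: "K \<in> \<K>" "F \<in> B K"
      show "nt K F * S0 K F = (if F \<subseteq> top_plane then facet_int F (\<lambda>z. (q K z)\<^sup>2) else 0)"
      proof (cases "F \<subseteq> top_plane")
        case True
        then show ?thesis using top_nt[OF K] by (simp add: S0_def)
      next
        case False
        then have "S0 K F = 0" using K boundary_facet_vanish[of K F] by (simp add: B_def S0_def)
        then show ?thesis using False by simp
      qed
    qed
    finally show ?thesis by simp
  qed

  have flux1: "(\<Sum>K\<in>\<K>. LINT z:K|lebesgue. gxt K z \<bullet> gx K z) = 1/2 * (N + T1 + R)"
  proof -
    have "(\<Sum>K\<in>\<K>. LINT z:K|lebesgue. gxt K z \<bullet> gx K z) = 1/2 * (\<Sum>K\<in>\<K>. \<Sum>F | F facet_of K. nt K F * S1 K F)"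
      by (simp add: element_divergence(2) sum_distrib_left nt_def S1_def)
    also have "(\<Sum>K\<in>\<K>. \<Sum>F | F facet_of K. nt K F * S1 K F) = N + (\<Sum>K\<in>\<K>. \<Sum>F\<in>B K. nt K F * S1 K F)"
      unfolding B_def N_def by (rule sum_elements_facets[OF mesh])
    also have "(\<Sum>K\<in>\<K>. \<Sum>F\<in>B K. nt K F * S1 K F) = T1 + R"
      unfolding T1_def R_def top_norms B_eq sum.distrib[symmetric]
    proof (intro sum.cong refl)
      fix K F assume K: "K \<in> \<K>" "F \<in> B K"
      show "nt K F * S1 K F = (if F \<subseteq> top_plane then facet_int F (\<lambda>z. (norm (gx K z))\<^sup>2) else 0)
          + (if F \<subseteq> top_plane then 0 else nt K F * S1 K F)"
        using top_nt[OF K] by (simp add: S1_def)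
    qed
    finally show ?thesis by simp
  qed

  have "\<K> \<noteq> {}"
    using mesh_Union[OF mesh] lipschitz closure_subset by (fastforce simp: bounded_lipschitz_domain_def)
  then obtain K0 where K0: "K0 \<in> \<K>" by blast
  have h: "mesh_size \<K> > 0" using diameter_pos[OF K0] Cu(2)[OF K0] by linarith
  then have a: "a > 0" using \<theta> by (simp add: a_def)
  \<comment> \<open>The estimate below yields only one factor \<open>Cu\<close>, while the bound on
    \<open>\<theta>\<close> contains its square; the gap is closed by \<open>Cu \<ge> 1\<close>,
    which holds because both mesh bounds apply to a single element.\<close>
  have "diameter K0 \<le> Cu * diameter K0" using Cu(2,3)[OF K0] by linarith
  then have Cu1: "1 \<le> Cu" using diameter_pos[OF K0] by simp

  have rest: "a * R \<le> X"
  proof -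
    \<comment> \<open>\<open>R\<close> is needed from above only, so
      \<open>n\<^sub>t \<le> 1\<close> suffices and facets with negative \<open>n\<^sub>t\<close>
      help.\<close>
    have "R \<le> (\<Sum>K\<in>\<K>. \<Sum>F\<in>B K. S1 K F)"
      unfolding R_def
    proof (intro sum_mono)
      fix K F assume K: "K \<in> \<K>" "F \<in> B K"
      have "nt K F \<le> 1" using facet_normal_time[of K F] K by (simp add: nt_def B_def)
      then show "(if F \<subseteq> top_plane then 0 else nt K F * S1 K F) \<le> S1 K F"
        using S1_nonneg[of K F] mult_right_mono[of "nt K F" 1 "S1 K F"] by simp
    qed
    also have "\<dots> \<le> (\<Sum>K\<in>\<K>. C\<^sup>2 / diameter K * E K)"
    proof (rule sum_mono)
      fix K assume K: "K \<in> \<K>"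
      have "(\<Sum>F\<in>B K. S1 K F) \<le> (\<Sum>F | F facet_of K. S1 K F)"
        using mesh_finite_facets[OF mesh K] S1_nonneg by (intro sum_mono2) (auto simp: B_def)
      also have "\<dots> \<le> C\<^sup>2 / diameter K * E K"
        using boundary_gradient_bound[OF C(2) K] by (simp add: S1_def E_def)
      finally show "(\<Sum>F\<in>B K. S1 K F) \<le> C\<^sup>2 / diameter K * E K" .
    qed
    finally have "a * R \<le> a * (\<Sum>K\<in>\<K>. C\<^sup>2 / diameter K * E K)" using a by simp
    also have "\<dots> = (\<Sum>K\<in>\<K>. a * (C\<^sup>2 / diameter K) * E K)"
      by (simp add: sum_distrib_left mult.assoc)
    also have "\<dots> \<le> (\<Sum>K\<in>\<K>. 1 * E K)"
    proof (intro sum_mono mult_right_mono E_nonneg)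
      fix K assume K: "K \<in> \<K>"
      note d = diameter_pos[OF K]
      have "a * (C\<^sup>2 / diameter K) \<le> \<theta> * (Cu * diameter K) * (C\<^sup>2 / diameter K)"
        unfolding a_def using \<theta>(1) Cu(3)[OF K] d by (intro mult_right_mono mult_left_mono) auto
      also have "\<dots> = \<theta> * (C\<^sup>2 * Cu)" using d by simp
      also have "\<dots> \<le> \<theta> * (C\<^sup>2 * Cu\<^sup>2)"
        using \<theta>(1) Cu1 by (intro mult_left_mono) (auto simp: power2_eq_square)
      also have "\<dots> \<le> inverse (C\<^sup>2 * Cu\<^sup>2) * (C\<^sup>2 * Cu\<^sup>2)"
        by (intro mult_right_mono \<theta>(2)) auto
      also have "\<dots> = 1" using C(1) Cu(1) by (intro left_inverse) simp
      finally show "a * (C\<^sup>2 / diameter K) \<le> 1" .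
    qed
    also have "\<dots> = X" by (simp add: X_def volume_terms(2) E_def)
    finally show ?thesis .
  qed

  have "1/2 * N + 1/2 * J + \<delta> * Z \<le> I"
  proof -
    have "1/2 * N + 1/2 * J + \<delta> * Z = (\<Sum>F\<in>interior_facets \<K>.
        1/2 * (nt (elem_i \<K> F) F * S1 (elem_i \<K> F) F + nt (elem_j \<K> F) F * S1 (elem_j \<K> F) F)
        + 1/2 * (L2_norm_on (flat_measure F) F (jump_t \<K> F (nabla_x v)))\<^sup>2
        + \<delta> * (L2_norm_on (flat_measure F) F (jump_x \<K> F (dt v)))\<^sup>2)"
      unfolding N_def J_def Z_def by (simp only: sum.distrib sum_distrib_left[symmetric])
    also have "\<dots> \<le> I"
      unfolding I_def nt_def S1_def by (intro sum_mono interior_facet_term)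
    finally show ?thesis .
  qed
  then have "a * (1/2 * N + 1/2 * J + \<delta> * Z) \<le> a * I" using a by simp
  then have interior: "1/2 * (a * N) + 1/2 * (a * J) + \<delta> * a * Z \<le> a * I"
    by (simp add: algebra_simps)

  have form: "a_h \<Omega> T \<K> \<theta> \<delta> v v =
      1/2 * T0 + a * Y + X - 1/2 * (a * N + a * T1 + a * R) + a * T1 + a * I"
  proof -
    have "(LINT z:?\<Sigma>|flat_measure ?\<Sigma>. trace_from Q (nabla_x v) z \<bullet> trace_from Q (nabla_x v) z) = T1"
      unfolding T1_def L2_norm_on_squared power2_norm_eq_inner ..
    moreover have "a * (1/2 * (N + T1 + R)) = 1/2 * (a * N + a * T1 + a * R)"
      by (simp only: distrib_left mult.left_commute)
    ultimately show ?thesis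
      unfolding a_h_def Let_def a_def[symmetric] volume_terms(1,3) flux0 flux1 I_def X_def Y_def
      by simp
  qed

  have norm: "(norm_h \<Omega> T \<K> \<theta> \<delta> v)\<^sup>2 = X + a * Y + 1/2 * T0 + 1/2 * (a * T1) + 1/2 * (a * J) + \<delta> * a * Z"
  proof -
    have "0 \<le> X + a * Y + 1/2 * T0 + 1/2 * (a * T1) + 1/2 * (a * J) + \<delta> * a * Z"
      using nonneg a \<delta> by (intro add_nonneg_nonneg) auto
    then show ?thesis
      unfolding norm_h_def Let_def
      by (simp add: a_def X_def Y_def T0_def T1_def J_def Z_def mult.assoc)
  qed

  have "0 \<le> a * Y" "0 \<le> a * T1" "0 \<le> a * J" "0 \<le> \<delta> * a * Z"
    using nonneg a \<delta> by auto
  \<comment> \<open>After inserting \<open>interior\<close>, the form minus half the squared norm is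
    at least half of \<open>X - a * R\<close>, nonnegative by \<open>rest\<close>, plus fractions of
    the other nonnegative norm terms; the \<open>N\<close> contributions cancel.\<close>
  then show ?thesis unfolding form norm using rest interior nonneg(1,3) by argo
qed

end

theorem lemma5:
  fixes \<Omega> :: "real \<Rightarrow> (real^'d) set"
    and T C_u C_inv \<theta> \<delta> :: real
    and p :: nat
    and \<M> :: "((real^'d) \<times> real) set set set"
  assumes "CARD('d) \<in> {1, 2, 3}"
    and "T > 0"
    and "space_time_domain \<Omega> T"
    and "\<forall>\<K> \<in> \<M>. mesh_of (st_domain \<Omega> T) \<K>"
    and "shape_regular \<M>"
    and "C_u > 0" and "quasi_uniform C_u \<M>"
    and "p \<ge> 1"
    and "C_inv > 0" and "\<forall>\<K> \<in> \<M>. inverse_inequality C_inv (st_domain \<Omega> T) p \<K>"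
    and "\<theta> > 0" and "\<theta> \<le> inverse (C_inv\<^sup>2 * C_u\<^sup>2)"
    and "\<delta> > 0"
  shows "\<forall>\<K> \<in> \<M>. \<forall>v \<in> V0h \<Omega> T p \<K>. a_h \<Omega> T \<K> \<theta> \<delta> v v \<ge> 1/2 * (norm_h \<Omega> T \<K> \<theta> \<delta> v)\<^sup>2"
proof (intro ballI)
  fix \<K> v assume \<K>: "\<K> \<in> \<M>" and v: "v \<in> V0h \<Omega> T p \<K>"
  \<comment> \<open>Polynomial extensions are chosen element by element; turning these choices into
    functions of \<open>K\<close> yields the parameters of \<open>mesh_function\<close>.\<close>
  have "\<exists>q gx gt gxt. (\<forall>z\<in>K. v z = q z) \<and> (\<forall>i. (\<lambda>z. gx z $ i) \<in> poly_fun p) \<and>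
      continuous_on UNIV q \<and> continuous_on UNIV gx \<and> continuous_on UNIV gt \<and> continuous_on UNIV gxt \<and>
      (\<forall>z. GDERIV (\<lambda>x. q (x, snd z)) (fst z) :> gx z) \<and>
      (\<forall>z. ((\<lambda>s. q (fst z, s)) has_real_derivative gt z) (at (snd z))) \<and>
      (\<forall>z. ((\<lambda>s. gx (fst z, s)) has_vector_derivative gxt z) (at (snd z)))" if K: "K \<in> \<K>" for K
  proof -
    obtain q where q: "q \<in> poly_fun p" "\<forall>z\<in>K. v z = q z"
      using v K by (auto simp: V0h_def Vh_def)
    show ?thesis
      by (rule poly_fun_partials[OF q(1)]) (use q poly_fun_continuous[OF q(1)] in blast)
  qed
  then obtain q gx gt gxt where *: "\<And>K. K \<in> \<K> \<Longrightarrow> (\<forall>z\<in>K. v z = q K z) \<and> (\<forall>i. (\<lambda>z. gx K z $ i) \<in> poly_fun p) \<and>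
      continuous_on UNIV (q K) \<and> continuous_on UNIV (gx K) \<and> continuous_on UNIV (gt K) \<and> continuous_on UNIV (gxt K) \<and>
      (\<forall>z. GDERIV (\<lambda>x. q K (x, snd z)) (fst z) :> gx K z) \<and>
      (\<forall>z. ((\<lambda>s. q K (fst z, s)) has_real_derivative gt K z) (at (snd z))) \<and>
      (\<forall>z. ((\<lambda>s. gx K (fst z, s)) has_vector_derivative gxt K z) (at (snd z)))"
    by metis
  interpret mesh_function \<Omega> T \<K> p v q gt gx gxt
    by unfold_locales (use assms(2,3,4) \<K> v * in blast)+
  show "a_h \<Omega> T \<K> \<theta> \<delta> v v \<ge> 1/2 * (norm_h \<Omega> T \<K> \<theta> \<delta> v)\<^sup>2"
    using assms \<K> by (intro coercivity[of C_inv C_u]) (auto simp: quasi_uniform_def)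
qed

end
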